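(* Assume Conditions (C1)–(C6). There exist $\delta_0\in(0,1/253]$ and constants $\delta_T>0$, $\kappa_T>0$ (with $\delta_0$ and $\delta_T$ sufficiently small), depending only on $\Lambda_{\tilde X,\min}$, $\Lambda_{h,\max}$, $K_X$, $K_g$, $J_h$, $A$ and $m$, such that whenever $\lambda,\mu,R>0$ satisfy $$\kappa_T\, n^{-\frac{2m}{2m+1}}\le \mu^2\le \frac{\delta_0R^2}{2\,(1+J(g^0)+J_h)^2},\quad R^2\le\lambda\le 1,\quad \frac{4\lambda^2 s_0}{\Lambda_{\tilde X,\min}^2}\le \delta_0R^2,\quad \lambda\ge \frac{\sqrt{2\log(2p)/n}}{\delta_T},\quad 1+\frac{\Lambda_{h,\max}}{\Lambda_{\tilde X,\min}}\le \mu^{-1},$$ then with probability at least $1-2/p-6\exp(-n\delta_T^2\mu^2)$, every minimizer $(\hat\beta,\hat g)$ of the doubly penalised least squares criterion satisfies $$\|\tilde X(\hat\beta-\beta^0)\|_n^2+\frac{\lambda}{4}\|\hat\beta-\beta^0\|_1\le \frac{s_0\lambda^2}{\Lambda_{\tilde X,\min}^2}.$$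
   Context: Setting. Let $(x,z)$ be a random vector with $x\in\mathbb R^p$ (a row vector) and $z\in\mathbb R^d$, joint distribution $Q$ and marginal $Q_z$ of $z$; let $(x_i,z_i)$, $i=1,\dots,n$, be i.i.d. copies of $(x,z)$, let $X$ be the $n\times p$ matrix with rows $x_i$, entries $X_{ij}$ and columns $X_j$. Let $\mathcal G$ be a linear subspace of $L_2(Q_z)$ equipped with a semi-inner product $J(\cdot,\cdot)$ with associated seminorm $J(\cdot)$. Fix $\beta^0\in\mathbb R^p$, $g^0\in\mathcal G$; $S_0=\{j:\beta^0_j\neq 0\}$, $s_0=|S_0|$. The responses are $Y=X\beta^0+g^0(Z)+E\in\mathbb R^n$, where $g(Z)=(g(z_1),\dots,g(z_n))^T$ and $E=(e_1,\dots,e_n)^T$. For a function $f$ of $(x,z)$: $\|f\|^2=\mathbb E f(x,z)^2$, $\|f\|_n^2=\frac1n\sum_{i=1}^n f(x_i,z_i)^2$, $\|f\|_\infty=\sup|f|$; for $v\in\mathbb R^n$, $\|v\|_n^2=v^Tv/n$. Let $h(z)=\mathbb E[x\mid z]\in\mathbb R^p$ with components $h_j$, $\tilde x=x-h(z)$; $h$ and $\tilde X$ also denote the $n\times p$ matrices with rows $h(z_i)$ and $\tilde x_i=x_i-h(z_i)$. $\Lambda_{\tilde X,\min}^2$ is the smallest eigenvalue of $\mathbb E[\tilde X^T\tilde X]/n=\mathbb E[\tilde x^T\tilde x]$ and $\Lambda_{h,\max}^2$ the largest eigenvalue of $\mathbb E[h^Th]/n$. Estimator: for $\lambda,\mu>0$,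 $(\hat\beta,\hat g)$ is a minimizer over $\mathbb R^p\times\mathcal G$ of $\|Y-X\beta-g(Z)\|_n^2+\lambda\|\beta\|_1+\mu^2J^2(g)$. Conditions. (C1) $e_1,\dots,e_n$ are i.i.d. $N(0,1)$, independent of $\{(x_i,z_i)\}$. (C2) $\max_{i,j}|X_{ij}|\le K_X$ for a constant $K_X$. (C3) $\Lambda_{\tilde X,\min}>0$ and $\Lambda_{h,\max}<\infty$. (C4) For constants $A>0$ and $m>1/2$: $\mathcal H(u,\{g\in\mathcal G:\|g\|\le1,J(g)\le1\},\|\cdot\|_\infty)\le Au^{-1/m}$ for all $u>0$, where for a class $\mathcal C$, $\mathcal H(u,\mathcal C,\|\cdot\|_\infty)=\log N$ with $N$ the smallest cardinality of a set $G\subset\mathcal G$ such that every element of $\mathcal C$ lies within $\|\cdot\|_\infty$-distance $u$ of some element of $G$. (C5) $\sup\{\|g\|_\infty: g\in\mathcal G,\|g\|\le1,J(g)\le1\}\le K_g$ for a constant $K_g$. (C6) $h_j\in\mathcal G$ and $J(h_j)\le J_h$ for all $j$, for a constant $J_h$. *)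

theory Defs
  imports "HOL-Probability.Probability"
begin

text \<open>Vectors in R^k are represented as functions nat => real; the Borel structure of R^k
  is the product sigma-algebra on the extensional functions on {..<k}.\<close>

definition Rvec :: "nat \<Rightarrow> (nat \<Rightarrow> real) measure" where
  "Rvec k = PiM {..<k} (\<lambda>_. borel)"

definition std_normal_measure :: "real measure" where
  "std_normal_measure = density lborel (\<lambda>x. ennreal (std_normal_density x))"

text \<open>Sample space for n i.i.d. copies ((x_i, z_i), e_i): (x_i,z_i) ~ Q, e_i ~ N(0,1),
  all independent (this builds in condition (C1)).\<close>
definition sample_space ::
  "nat \<Rightarrow> ((nat \<Rightarrow> real) \<times> (nat \<Rightarrow> real)) measure
     \<Rightarrow> (nat \<Rightarrow> ((nat \<Rightarrow> real) \<times> (nat \<Rightarrow> real)) \<times> real) measure" where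
  "sample_space n Q = PiM {..<n} (\<lambda>_. Q \<Otimes>\<^sub>M std_normal_measure)"

type_synonym sample = "nat \<Rightarrow> ((nat \<Rightarrow> real) \<times> (nat \<Rightarrow> real)) \<times> real"

definition Xs :: "sample \<Rightarrow> nat \<Rightarrow> nat \<Rightarrow> real" where
  "Xs \<omega> i j = fst (fst (\<omega> i)) j"

definition Zs :: "sample \<Rightarrow> nat \<Rightarrow> (nat \<Rightarrow> real)" where
  "Zs \<omega> i = snd (fst (\<omega> i))"

definition Es :: "sample \<Rightarrow> nat \<Rightarrow> real" where
  "Es \<omega> i = snd (\<omega> i)"

definition marg_z :: "nat \<Rightarrow> ((nat \<Rightarrow> real) \<times> (nat \<Rightarrow> real)) measure \<Rightarrow> (nat \<Rightarrow> real) measure" where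
  "marg_z d Q = distr Q (Rvec d) snd"

definition L2norm :: "(nat \<Rightarrow> real) measure \<Rightarrow> ((nat \<Rightarrow> real) \<Rightarrow> real) \<Rightarrow> real" where
  "L2norm Qz g = sqrt (\<integral>z. (g z)\<^sup>2 \<partial>Qz)"

definition L2_subspace :: "(nat \<Rightarrow> real) measure \<Rightarrow> ((nat \<Rightarrow> real) \<Rightarrow> real) set \<Rightarrow> bool" where
  "L2_subspace Qz G \<longleftrightarrow>
     (\<forall>g\<in>G. g \<in> borel_measurable Qz \<and> integrable Qz (\<lambda>z. (g z)\<^sup>2)) \<and>
     (\<lambda>_. 0) \<in> G \<and>
     (\<forall>f\<in>G. \<forall>g\<in>G. (\<lambda>z. f z + g z) \<in> G) \<and>
     (\<forall>a. \<forall>g\<in>G. (\<lambda>z. a * g z) \<in> G)"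

definition semi_inner_on ::
  "((nat \<Rightarrow> real) \<Rightarrow> real) set \<Rightarrow> (((nat \<Rightarrow> real) \<Rightarrow> real) \<Rightarrow> ((nat \<Rightarrow> real) \<Rightarrow> real) \<Rightarrow> real) \<Rightarrow> bool" where
  "semi_inner_on G J \<longleftrightarrow>
     (\<forall>f\<in>G. \<forall>g\<in>G. J f g = J g f) \<and>
     (\<forall>f\<in>G. \<forall>g\<in>G. \<forall>k\<in>G. \<forall>a b. J (\<lambda>z. a * f z + b * g z) k = a * J f k + b * J g k) \<and>
     (\<forall>g\<in>G. J g g \<ge> 0)"

definition Jnorm :: "(((nat \<Rightarrow> real) \<Rightarrow> real) \<Rightarrow> ((nat \<Rightarrow> real) \<Rightarrow> real) \<Rightarrow> real) \<Rightarrow> ((nat \<Rightarrow> real) \<Rightarrow> real) \<Rightarrow> real" where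
  "Jnorm J g = sqrt (J g g)"

definition unit_ball :: "(nat \<Rightarrow> real) measure \<Rightarrow> ((nat \<Rightarrow> real) \<Rightarrow> real) set
     \<Rightarrow> (((nat \<Rightarrow> real) \<Rightarrow> real) \<Rightarrow> ((nat \<Rightarrow> real) \<Rightarrow> real) \<Rightarrow> real) \<Rightarrow> ((nat \<Rightarrow> real) \<Rightarrow> real) set" where
  "unit_ball Qz G J = {g \<in> G. L2norm Qz g \<le> 1 \<and> Jnorm J g \<le> 1}"

definition sup_dist_le :: "nat \<Rightarrow> ((nat \<Rightarrow> real) \<Rightarrow> real) \<Rightarrow> ((nat \<Rightarrow> real) \<Rightarrow> real) \<Rightarrow> real \<Rightarrow> bool" where
  "sup_dist_le d f g u \<longleftrightarrow> (\<forall>z\<in>space (Rvec d). \<bar>f z - g z\<bar> \<le> u)"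

text \<open>H(u, C, sup-norm) \<le> b: log of the smallest cardinality of a u-cover of C by elements of G
  is at most b, i.e. some finite cover F \<subseteq> G of C has log(card F) \<le> b.\<close>
definition sup_entropy_le :: "nat \<Rightarrow> ((nat \<Rightarrow> real) \<Rightarrow> real) set \<Rightarrow> ((nat \<Rightarrow> real) \<Rightarrow> real) set \<Rightarrow> real \<Rightarrow> real \<Rightarrow> bool" where
  "sup_entropy_le d G C u b \<longleftrightarrow>
     (\<exists>F. F \<subseteq> G \<and> finite F \<and> ln (real (card F)) \<le> b \<and> (\<forall>g\<in>C. \<exists>f\<in>F. sup_dist_le d g f u))"

definition is_cond_exp_x_given_z :: "nat \<Rightarrow> nat \<Rightarrow> ((nat \<Rightarrow> real) \<times> (nat \<Rightarrow> real)) measure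
     \<Rightarrow> ((nat \<Rightarrow> real) \<Rightarrow> (nat \<Rightarrow> real)) \<Rightarrow> bool" where
  "is_cond_exp_x_given_z p d Q h \<longleftrightarrow>
     (\<forall>j<p. (\<lambda>z. h z j) \<in> borel_measurable (Rvec d) \<and>
            integrable Q (\<lambda>q. h (snd q) j) \<and>
            (\<forall>A\<in>sets (Rvec d).
               (\<integral>q. indicator A (snd q) * fst q j \<partial>Q) = (\<integral>q. indicator A (snd q) * h (snd q) j \<partial>Q)))"

definition is_eigenvalue :: "nat \<Rightarrow> (nat \<Rightarrow> nat \<Rightarrow> real) \<Rightarrow> real \<Rightarrow> bool" where
  "is_eigenvalue p M l \<longleftrightarrow>
     (\<exists>v. (\<exists>j<p. v j \<noteq> 0) \<and> (\<forall>j<p. (\<Sum>k<p. M j k * v k) = l * v j))"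

definition is_min_eigenvalue :: "nat \<Rightarrow> (nat \<Rightarrow> nat \<Rightarrow> real) \<Rightarrow> real \<Rightarrow> bool" where
  "is_min_eigenvalue p M l \<longleftrightarrow> is_eigenvalue p M l \<and> (\<forall>l'. is_eigenvalue p M l' \<longrightarrow> l \<le> l')"

definition is_max_eigenvalue :: "nat \<Rightarrow> (nat \<Rightarrow> nat \<Rightarrow> real) \<Rightarrow> real \<Rightarrow> bool" where
  "is_max_eigenvalue p M l \<longleftrightarrow> is_eigenvalue p M l \<and> (\<forall>l'. is_eigenvalue p M l' \<longrightarrow> l' \<le> l)"

text \<open>E[x-tilde^T x-tilde] and E[h^T h]/n = E[h(z)^T h(z)].\<close>
definition Sigma_xtilde :: "((nat \<Rightarrow> real) \<times> (nat \<Rightarrow> real)) measure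
     \<Rightarrow> ((nat \<Rightarrow> real) \<Rightarrow> (nat \<Rightarrow> real)) \<Rightarrow> nat \<Rightarrow> nat \<Rightarrow> real" where
  "Sigma_xtilde Q h j k = (\<integral>q. (fst q j - h (snd q) j) * (fst q k - h (snd q) k) \<partial>Q)"

definition Sigma_h :: "((nat \<Rightarrow> real) \<times> (nat \<Rightarrow> real)) measure
     \<Rightarrow> ((nat \<Rightarrow> real) \<Rightarrow> (nat \<Rightarrow> real)) \<Rightarrow> nat \<Rightarrow> nat \<Rightarrow> real" where
  "Sigma_h Q h j k = (\<integral>q. h (snd q) j * h (snd q) k \<partial>Q)"

definition Ys :: "nat \<Rightarrow> (nat \<Rightarrow> real) \<Rightarrow> ((nat \<Rightarrow> real) \<Rightarrow> real) \<Rightarrow> sample \<Rightarrow> nat \<Rightarrow> real" where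
  "Ys p \<beta>0 g0 \<omega> i = (\<Sum>j<p. Xs \<omega> i j * \<beta>0 j) + g0 (Zs \<omega> i) + Es \<omega> i"

definition l1norm :: "nat \<Rightarrow> (nat \<Rightarrow> real) \<Rightarrow> real" where
  "l1norm p \<beta> = (\<Sum>j<p. \<bar>\<beta> j\<bar>)"

definition emp_sq :: "nat \<Rightarrow> (nat \<Rightarrow> real) \<Rightarrow> real" where
  "emp_sq n v = (\<Sum>i<n. (v i)\<^sup>2) / real n"

definition criterion ::
  "nat \<Rightarrow> nat \<Rightarrow> (((nat \<Rightarrow> real) \<Rightarrow> real) \<Rightarrow> ((nat \<Rightarrow> real) \<Rightarrow> real) \<Rightarrow> real)
    \<Rightarrow> (nat \<Rightarrow> real) \<Rightarrow> ((nat \<Rightarrow> real) \<Rightarrow> real) \<Rightarrow> real \<Rightarrow> real \<Rightarrow> sample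
    \<Rightarrow> (nat \<Rightarrow> real) \<Rightarrow> ((nat \<Rightarrow> real) \<Rightarrow> real) \<Rightarrow> real" where
  "criterion n p J \<beta>0 g0 lam mu \<omega> \<beta> g =
     emp_sq n (\<lambda>i. Ys p \<beta>0 g0 \<omega> i - (\<Sum>j<p. Xs \<omega> i j * \<beta> j) - g (Zs \<omega> i))
     + lam * l1norm p \<beta> + mu\<^sup>2 * (Jnorm J g)\<^sup>2"

definition is_minimizer ::
  "nat \<Rightarrow> nat \<Rightarrow> ((nat \<Rightarrow> real) \<Rightarrow> real) set \<Rightarrow> (((nat \<Rightarrow> real) \<Rightarrow> real) \<Rightarrow> ((nat \<Rightarrow> real) \<Rightarrow> real) \<Rightarrow> real)
    \<Rightarrow> (nat \<Rightarrow> real) \<Rightarrow> ((nat \<Rightarrow> real) \<Rightarrow> real) \<Rightarrow> real \<Rightarrow> real \<Rightarrow> sample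
    \<Rightarrow> (nat \<Rightarrow> real) \<Rightarrow> ((nat \<Rightarrow> real) \<Rightarrow> real) \<Rightarrow> bool" where
  "is_minimizer n p G J \<beta>0 g0 lam mu \<omega> \<beta> g \<longleftrightarrow>
     g \<in> G \<and> (\<forall>\<beta>'. \<forall>g'\<in>G. criterion n p J \<beta>0 g0 lam mu \<omega> \<beta> g \<le> criterion n p J \<beta>0 g0 lam mu \<omega> \<beta>' g')"

definition cond_C2 :: "nat \<Rightarrow> ((nat \<Rightarrow> real) \<times> (nat \<Rightarrow> real)) measure \<Rightarrow> real \<Rightarrow> bool" where
  "cond_C2 p Q KX \<longleftrightarrow> (AE q in Q. \<forall>j<p. \<bar>fst q j\<bar> \<le> KX)"

text \<open>(C3): Lambda_Xt^2 is the smallest eigenvalue of E[xt^T xt], Lambda_Xt > 0,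
  Lambda_h^2 the largest eigenvalue of E[h^T h]/n (finite since it is a real number).\<close>
definition cond_C3 :: "nat \<Rightarrow> ((nat \<Rightarrow> real) \<times> (nat \<Rightarrow> real)) measure \<Rightarrow> ((nat \<Rightarrow> real) \<Rightarrow> (nat \<Rightarrow> real))
     \<Rightarrow> real \<Rightarrow> real \<Rightarrow> bool" where
  "cond_C3 p Q h LX Lh \<longleftrightarrow>
     LX > 0 \<and> is_min_eigenvalue p (Sigma_xtilde Q h) (LX\<^sup>2) \<and>
     Lh \<ge> 0 \<and> is_max_eigenvalue p (Sigma_h Q h) (Lh\<^sup>2)"

definition cond_C4 :: "nat \<Rightarrow> (nat \<Rightarrow> real) measure \<Rightarrow> ((nat \<Rightarrow> real) \<Rightarrow> real) set
     \<Rightarrow> (((nat \<Rightarrow> real) \<Rightarrow> real) \<Rightarrow> ((nat \<Rightarrow> real) \<Rightarrow> real) \<Rightarrow> real) \<Rightarrow> real \<Rightarrow> real \<Rightarrow> bool" where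
  "cond_C4 d Qz G J A m \<longleftrightarrow>
     (\<forall>u>0. sup_entropy_le d G (unit_ball Qz G J) u (A * u powr (-1/m)))"

definition cond_C5 :: "nat \<Rightarrow> (nat \<Rightarrow> real) measure \<Rightarrow> ((nat \<Rightarrow> real) \<Rightarrow> real) set
     \<Rightarrow> (((nat \<Rightarrow> real) \<Rightarrow> real) \<Rightarrow> ((nat \<Rightarrow> real) \<Rightarrow> real) \<Rightarrow> real) \<Rightarrow> real \<Rightarrow> bool" where
  "cond_C5 d Qz G J Kg \<longleftrightarrow> (\<forall>g\<in>unit_ball Qz G J. \<forall>z\<in>space (Rvec d). \<bar>g z\<bar> \<le> Kg)"

definition cond_C6 :: "nat \<Rightarrow> ((nat \<Rightarrow> real) \<Rightarrow> real) set
     \<Rightarrow> (((nat \<Rightarrow> real) \<Rightarrow> real) \<Rightarrow> ((nat \<Rightarrow> real) \<Rightarrow> real) \<Rightarrow> real)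
     \<Rightarrow> ((nat \<Rightarrow> real) \<Rightarrow> (nat \<Rightarrow> real)) \<Rightarrow> real \<Rightarrow> bool" where
  "cond_C6 p G J h Jh \<longleftrightarrow> (\<forall>j<p. (\<lambda>z. h z j) \<in> G \<and> Jnorm J (\<lambda>z. h z j) \<le> Jh)"

end

theory Submission
  imports Defs
begin

text \<open>
  Write \<open>b = \<beta> - \<beta>0\<close> for the parametric error and \<open>k = g - g0\<close> for the nonparametric one. Everything
  is expressed through \<open>x - h(z)\<close> and \<open>k + h b\<close>, which are orthogonal in the population.
  On an event where five empirical averages are uniformly close to their means, convexity of the
  criterion first localises \<open>(b, k)\<close> in the ball of radius \<open>R\<close>. There, first-order optimality along
  the direction \<open>(- b, h b)\<close>, in which only \<open>x - h(z)\<close> enters, gives a quadratic inequality for the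
  parametric error alone, whose cross terms are all small multiples of \<open>lam * l1norm p b\<close>.

  The uniform bounds reduce by homogeneity to the class \<open>U\<close> of \<open>u\<close> in \<open>G\<close> with norm at most \<open>\<mu>\<close> and
  \<open>J\<close>-seminorm at most 1, where deviations of order \<open>\<mu>\<^sup>2\<close> suffice. They follow by chaining
  over sup-norm nets, with moment generating functions controlled by \<open>exp x \<le> x + exp (x\<^sup>2)\<close>;
  conditionally on \<open>z\<close> the linear processes are sub-Gaussian with variance proxy proportional to the
  empirical norm of \<open>u\<close>, so no restriction on the range of the deviations arises.
\<close>

section \<open>Exponential inequalities and smallest eigenvalues\<close>

text \<open>The obstacle is the union over the \<open>p\<close> columns of the design. Each column
  has its own process over \<open>U\<close>, and a deviation of order \<open>\<mu>\<^sup>2\<close>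
  has probability of order \<open>exp (- c * n * \<mu>\<^sup>2)\<close>, which need not beat
  \<open>p\<close>. Chaining is therefore done at a free level \<open>\<rho> \<ge> \<mu>\<close>,
  with tolerance \<open>\<gamma> * \<mu> * \<rho>\<close> and exponent
  \<open>n * \<rho>\<^sup>2\<close>. Noise and squares use \<open>\<rho> = \<mu>\<close>; the
  columns use \<open>\<rho> = lam / R\<close>. This is at least \<open>lam\<close>, whose lower
  bound beats ln p, and rescaling from \<open>U\<close> to radius \<open>R\<close> turns
  \<open>\<mu> * (lam / R)\<close> into a multiple of \<open>lam\<close>, which the l1 penalty can
  absorb. The events come from finitely many finite nets, so no supremum over an uncountable class
  has to be measurable, and one event serves all minimizers at once. The number 1/253 is the
  tolerance of each error term relative to \<open>R\<^sup>2\<close> or \<open>lam\<close>. On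
  \<open>U\<close> it is 1/1012 = 1/(4 * 253), because rescaling by \<open>mu / (2 * R)\<close>
  costs a factor 4 in the squares.\<close>

lemma exp_le_quadratic:
  fixes x :: real
  assumes "\<bar>x\<bar> \<le> 1"
  shows "exp x \<le> 1 + x + x\<^sup>2"
proof (cases "x \<ge> 0")
  case True
  then show ?thesis using assms by (intro exp_bound) auto
next
  case False
  \<comment> \<open>For negative \<open>x\<close> the claim is multiplied by
    \<open>exp (- x)\<close>, which has a quadratic lower bound; what the product exceeds 1 by is
    then a sum of nonnegative terms.\<close>
  have "1 + (- x) + (- x)\<^sup>2 / 2 \<le> exp (- x)"
    using False by (intro exp_lower_Taylor_quadratic) auto
  moreover have "0 \<le> 1 + x + x\<^sup>2" using assms by (simp add: abs_le_iff)
  ultimately have "(1 + x + x\<^sup>2) * (1 + (- x) + (- x)\<^sup>2 / 2) \<le> (1 + x + x\<^sup>2) * exp (- x)"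
    by (intro mult_left_mono)
  moreover have "(1 + x + x\<^sup>2) * (1 + (- x) + (- x)\<^sup>2 / 2) = 1 + x\<^sup>2 / 2 + (- x) ^ 3 / 2 + x ^ 4 / 2"
    by (simp add: field_simps power2_eq_square power3_eq_cube power4_eq_xxxx)
  moreover have "0 \<le> x\<^sup>2 / 2 + (- x) ^ 3 / 2 + x ^ 4 / 2"
    using False by (intro add_nonneg_nonneg divide_nonneg_nonneg zero_le_power[of "- x"]) auto
  ultimately have "1 \<le> (1 + x + x\<^sup>2) * exp (- x)" by linarith
  then show ?thesis by (simp add: exp_minus field_simps)
qed

lemma exp_le_plus_exp_square: "exp x \<le> x + exp (x\<^sup>2)" for x :: real
proof -
  consider "\<bar>x\<bar> \<le> 1" | "x > 1" | "x < -1" by linarith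
  then show ?thesis
  proof cases
    case 1
    then have "exp x \<le> 1 + x + x\<^sup>2" by (rule exp_le_quadratic)
    then show ?thesis using exp_ge_add_one_self[of "x\<^sup>2"] by linarith
  next
    case 2
    then have "x \<le> x\<^sup>2" by (simp add: power2_eq_square)
    then have "exp x \<le> exp (x\<^sup>2)" by simp
    then show ?thesis using 2 by linarith
  next
    case 3
    then have "0 \<le> x * (x + 1)" by (simp add: mult_nonpos_nonpos)
    then have "0 \<le> x\<^sup>2 + x" by (simp add: algebra_simps power2_eq_square)
    moreover have "exp x \<le> 1" using 3 by simp
    ultimately show ?thesis using exp_ge_add_one_self[of "x\<^sup>2"] by linarith
  qed
qed

section \<open>The smallest eigenvalue as minimum of the Rayleigh quotient\<close>

definition qform :: "nat \<Rightarrow> (nat \<Rightarrow> nat \<Rightarrow> real) \<Rightarrow> (nat \<Rightarrow> real) \<Rightarrow> real" where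
  "qform p M v = (\<Sum>j<p. \<Sum>k<p. v j * M j k * v k)"

lemma qform_add_scaled:
  assumes sym: "\<And>j k. M j k = M k j"
  shows "qform p M (\<lambda>j. w j + t * v j)
    = qform p M w + 2 * t * (\<Sum>j<p. v j * (\<Sum>k<p. M j k * w k)) + t\<^sup>2 * qform p M v"
proof -
  have swap: "(\<Sum>j<p. \<Sum>k<p. w j * M j k * v k) = (\<Sum>j<p. \<Sum>k<p. v j * M j k * w k)"
    by (subst sum.swap) (intro sum.cong refl, simp add: sym mult_ac)
  have "qform p M (\<lambda>j. w j + t * v j) = (\<Sum>j<p. \<Sum>k<p. w j * M j k * w k
     + t * (w j * M j k * v k) + t * (v j * M j k * w k) + t\<^sup>2 * (v j * M j k * v k))"
    unfolding qform_def by (intro sum.cong refl) (simp add: algebra_simps power2_eq_square)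
  also have "\<dots> = qform p M w + t * (\<Sum>j<p. \<Sum>k<p. w j * M j k * v k)
     + t * (\<Sum>j<p. \<Sum>k<p. v j * M j k * w k) + t\<^sup>2 * qform p M v"
    by (simp add: sum.distrib sum_distrib_left qform_def)
  also have "\<dots> = qform p M w + 2 * t * (\<Sum>j<p. \<Sum>k<p. v j * M j k * w k) + t\<^sup>2 * qform p M v"
    unfolding swap by (simp add: algebra_simps)
  finally show ?thesis by (simp add: sum_distrib_left mult.assoc)
qed

lemma linear_coefficient_zero:
  fixes a b :: real
  assumes "\<And>t. 0 \<le> 2 * t * a + t\<^sup>2 * b"
  shows "a = 0"
proof (rule ccontr)
  assume "a \<noteq> 0"
  have b: "0 \<le> b" using assms[of 1] assms[of "-1"] by simp
  \<comment> \<open>The minimiser would be \<open>t = - a / b\<close>; the added 1 also covers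
    \<open>b = 0\<close>.\<close>
  define c where "c = 1 / (1 + b)"
  have c: "0 < c" "c * b \<le> 1" using b by (auto simp: c_def)
  have "0 \<le> 2 * (- (a * c)) * a + (- (a * c))\<^sup>2 * b" by (rule assms)
  also have "\<dots> = a\<^sup>2 * c * (c * b - 2)" by (simp add: algebra_simps power2_eq_square)
  also have "\<dots> < 0" using c \<open>a \<noteq> 0\<close> by (simp add: mult_pos_neg)
  finally show False by simp
qed

text \<open>\<open>is_min_eigenvalue\<close> only compares eigenvalues with each other. A minimiser
  of the form on the unit sphere exists by compactness and is an eigenvector because its first
  variation vanishes, so the minimum is itself an eigenvalue and hence at least
  \<open>l\<close>.\<close>

lemma min_eigenvalue_le_qform:
  assumes sym: "\<And>j k. M j k = M k j" and l: "is_min_eigenvalue p M l"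
  shows "l * (\<Sum>j<p. (v j)\<^sup>2) \<le> qform p M v"
proof -
  define sq where "sq v = (\<Sum>j<p. (v j)\<^sup>2)" for v :: "nat \<Rightarrow> real"
  \<comment> \<open>Vectors are functions on all of nat. Freezing the coordinates from
    \<open>p\<close> on at 0 gives a box that is compact by Tychonoff; the condition
    \<open>sq v = 1\<close> alone leaves those coordinates unbounded.\<close>
  define C :: "(nat \<Rightarrow> real) set" where "C = Pi\<^sub>E UNIV (\<lambda>j. if j < p then {-1..1} else {0})"
  define S where "S = C \<inter> {v. sq v = 1}"
  have "p > 0"
    using l by (auto simp: is_min_eigenvalue_def is_eigenvalue_def)
  have "compact C" 
    unfolding C_def compactin_euclidean_iff[symmetric] euclidean_product_topology[symmetric]
    by (subst compactin_PiE) auto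
  moreover have cont: "continuous_on A sq" for A
    unfolding sq_def
    by (intro continuous_intros continuous_on_subset[OF continuous_on_product_coordinates]) auto
  have "closed {v. sq v = 1}"
    using continuous_closed_vimage[of "{1}" sq] cont[of UNIV]
    by (simp add: vimage_def continuous_on_eq_continuous_at)
  ultimately have "compact S" unfolding S_def by (rule compact_Int_closed)
  moreover have "(\<lambda>j. if j = 0 then 1 else 0) \<in> S"
    using \<open>p > 0\<close> by (auto simp: S_def C_def sq_def if_distrib[of "\<lambda>x. x\<^sup>2"] cong: if_cong)
  then have "S \<noteq> {}" by blast
  moreover have "continuous_on S (qform p M)"
    unfolding qform_def
    by (intro continuous_intros continuous_on_subset[OF continuous_on_product_coordinates]) auto
  ultimately obtain w where w: "w \<in> S" and wmin: "\<And>v. v \<in> S \<Longrightarrow> qform p M w \<le> qform p M v"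
    using continuous_attains_inf[of S "qform p M"] by blast
  define l0 where "l0 = qform p M w"
  have w1: "sq w = 1" using w by (simp add: S_def)
  have ge: "l0 * sq v \<le> qform p M v" for v
  proof (cases "sq v = 0")
    case True
    then have "\<forall>j<p. v j = 0" by (simp add: sq_def sum_nonneg_eq_0_iff)
    then show ?thesis by (simp add: True qform_def)
  next
    case False
    define r where "r = sqrt (sq v)"
    have sq0: "sq v \<ge> 0" by (simp add: sq_def sum_nonneg)
    then have r: "r > 0" "r\<^sup>2 = sq v" using False by (auto simp: r_def)
    define u where "u j = (if j < p then v j / r else 0)" for j
    have su: "sq u = 1"
    proof -
      have "sq u = sq v / r\<^sup>2" by (simp add: sq_def u_def power_divide sum_divide_distrib)
      then show ?thesis using r False by simp
    qed
    have u1: "\<bar>u j\<bar> \<le> 1" for j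
    proof (cases "j < p")
      case True
      then have "(u j)\<^sup>2 \<le> sq u" unfolding sq_def by (intro member_le_sum) auto
      then show ?thesis by (simp add: su abs_square_le_1)
    qed (simp add: u_def)
    have "u \<in> C"
      unfolding C_def
    proof (rule PiE_I)
      fix j
      show "u j \<in> (if j < p then {-1..1} else {0})"
        using u1[of j] by (cases "j < p") (auto simp: abs_le_iff, simp add: u_def)
    qed simp
    then have "u \<in> S" by (simp add: S_def su)
    then have "l0 \<le> qform p M u" using wmin by (simp add: l0_def)
    also have "qform p M u = qform p M v / r\<^sup>2"
      by (simp add: qform_def u_def sum_divide_distrib power2_eq_square mult_ac)
    finally have "l0 * r\<^sup>2 \<le> qform p M v" using r(1) by (simp add: pos_le_divide_eq)
    then show ?thesis by (simp add: r(2))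
  qed
  have "is_eigenvalue p M l0"
    unfolding is_eigenvalue_def
  proof (intro exI[of _ w] conjI allI impI)
    show "\<exists>j<p. w j \<noteq> 0" using w1 by (auto simp: sq_def intro: ccontr)
  next
    fix i assume i: "i < p"
    define ei where "ei j = (if j = i then 1 else 0 :: real)" for j
    have d: "(\<Sum>j<p. ei j * f j) = f i" for f
      using i by (simp add: ei_def if_distrib[of "\<lambda>x. x * _"] cong: if_cong)
    \<comment> \<open>First variation in coordinate \<open>i\<close>: \<open>ge\<close> at
      \<open>w + t * ei\<close> compares two quadratics in \<open>t\<close> whose constant terms
      coincide.\<close>
    have "0 \<le> 2 * t * ((\<Sum>k<p. M i k * w k) - l0 * w i) + t\<^sup>2 * (qform p M ei - l0 * sq ei)" for t
    proof -
      have "sq (\<lambda>j. w j + t * ei j) = sq w + 2 * t * (\<Sum>j<p. ei j * w j) + t\<^sup>2 * sq ei"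
        by (simp add: sq_def power2_sum sum.distrib sum_distrib_left power_mult_distrib mult_ac)
      then have "sq (\<lambda>j. w j + t * ei j) = 1 + 2 * t * w i + t\<^sup>2 * sq ei" by (simp add: d w1)
      with ge[of "\<lambda>j. w j + t * ei j"] show ?thesis
        by (simp add: qform_add_scaled[OF sym] d l0_def[symmetric] algebra_simps)
    qed
    from linear_coefficient_zero[OF this] show "(\<Sum>k<p. M i k * w k) = l0 * w i" by simp
  qed
  then have "l \<le> l0" using l by (simp add: is_min_eigenvalue_def)
  then have "l * sq v \<le> l0 * sq v" by (intro mult_right_mono) (simp_all add: sq_def sum_nonneg)
  also have "\<dots> \<le> qform p M v" by (rule ge)
  finally show ?thesis by (simp add: sq_def)
qed

section \<open>Seminorms and entropy\<close>

lemma finite_subspace_sum: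
  assumes "L2_subspace Q G" "\<And>j. j < (p::nat) \<Longrightarrow> f j \<in> G"
  shows "(\<lambda>z. \<Sum>j<p. f j z * c j) \<in> G"
  using assms(2)
proof (induction p)
  case 0
  then show ?case using assms(1) by (simp add: L2_subspace_def)
next
  case (Suc p)
  have 1: "(\<lambda>z. \<Sum>j<p. f j z * c j) \<in> G" using Suc by simp
  have "(\<lambda>z. c p * f p z) \<in> G" using assms(1) Suc.prems[of p] by (simp add: L2_subspace_def)
  have add: "(\<lambda>z. f z + g z) \<in> G" if "f \<in> G" "g \<in> G" for f g
    using assms(1) that by (simp add: L2_subspace_def)
  have "(\<lambda>z. (\<Sum>j<p. f j z * c j) + c p * f p z) \<in> G"
    by (rule add[OF 1]) fact
  then show ?case by (simp add: mult.commute)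
qed

context
  fixes Qz G J
  assumes G: "L2_subspace Qz G" and J: "semi_inner_on G J"
begin

lemma subspace_add: "f \<in> G \<Longrightarrow> g \<in> G \<Longrightarrow> (\<lambda>z. f z + g z) \<in> G"
  and subspace_scale: "f \<in> G \<Longrightarrow> (\<lambda>z. c * f z) \<in> G"
  and subspace_zero: "(\<lambda>_. 0) \<in> G"
  using G by (auto simp: L2_subspace_def)

lemma subspace_lin: "f \<in> G \<Longrightarrow> g \<in> G \<Longrightarrow> (\<lambda>z. a * f z + b * g z) \<in> G"
  by (intro subspace_add subspace_scale)

lemma subspace_diff: "f \<in> G \<Longrightarrow> g \<in> G \<Longrightarrow> (\<lambda>z. f z - g z) \<in> G"
  using subspace_lin[of f g 1 "-1"] by simp

lemma semi_inner_sym: "f \<in> G \<Longrightarrow> g \<in> G \<Longrightarrow> J f g = J g f"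
  and semi_inner_lin: "f \<in> G \<Longrightarrow> g \<in> G \<Longrightarrow> k \<in> G \<Longrightarrow>
        J (\<lambda>z. a * f z + b * g z) k = a * J f k + b * J g k"
  and semi_inner_nonneg: "g \<in> G \<Longrightarrow> 0 \<le> J g g"
  using J by (auto simp: semi_inner_on_def)

lemma semi_inner_quadratic:
  assumes "f \<in> G" "g \<in> G"
  shows "J (\<lambda>z. a * f z + b * g z) (\<lambda>z. a * f z + b * g z)
    = a\<^sup>2 * J f f + 2 * a * b * J f g + b\<^sup>2 * J g g"
proof -
  have l: "(\<lambda>z. a * f z + b * g z) \<in> G" using assms by (rule subspace_lin)
  have *: "J k (\<lambda>z. a * f z + b * g z) = a * J f k + b * J g k" if "k \<in> G" for k
    using semi_inner_sym[OF that l] semi_inner_lin[OF assms that] by simp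
  show ?thesis
    using semi_inner_sym[OF assms]
    by (simp add: semi_inner_lin[OF assms l] * assms algebra_simps power2_eq_square)
qed

lemma Jnorm_square: "g \<in> G \<Longrightarrow> (Jnorm J g)\<^sup>2 = J g g"
  by (simp add: Jnorm_def semi_inner_nonneg)

lemma Jnorm_nonneg: "g \<in> G \<Longrightarrow> 0 \<le> Jnorm J g"
  by (simp add: Jnorm_def semi_inner_nonneg)

lemma Jnorm_scale: "g \<in> G \<Longrightarrow> Jnorm J (\<lambda>z. c * g z) = \<bar>c\<bar> * Jnorm J g"
  using semi_inner_quadratic[of g g c 0] by (simp add: Jnorm_def real_sqrt_mult)

lemma semi_inner_Cauchy_Schwarz:
  assumes f: "f \<in> G" and g: "g \<in> G"
  shows "\<bar>J f g\<bar> \<le> Jnorm J f * Jnorm J g"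
proof -
  have q: "0 \<le> a\<^sup>2 * J f f + 2 * a * b * J f g + b\<^sup>2 * J g g" for a b
    using semi_inner_nonneg[OF subspace_lin[OF f g]] semi_inner_quadratic[OF f g] by metis
  have "(J f g)\<^sup>2 \<le> J f f * J g g"
  proof (cases "J g g = 0")
    case True
    \<comment> \<open>Along a null vector \<open>g\<close> of the semi-inner product the quadratic
      is affine, and an affine function that is bounded below has slope 0.\<close>
    have "0 \<le> 2 * t * J f g + t\<^sup>2 * 0 + J f f" for t
      using q[of 1 t] True by simp
    then have "J f g = 0"
    proof -
      have False if "J f g \<noteq> 0"
        using \<open>\<And>t. 0 \<le> 2 * t * J f g + t\<^sup>2 * 0 + J f f\<close>[of "- (J f f + 1) / (J f g)"] that
          semi_inner_nonneg[OF f] by simp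
      then show ?thesis by blast
    qed
    then show ?thesis using True by simp
  next
    case False
    then have pos: "J g g > 0" using semi_inner_nonneg[OF g] by simp
    have "0 \<le> (J g g)\<^sup>2 * J f f + 2 * J g g * (- J f g) * J f g + (- J f g)\<^sup>2 * J g g"
      by (rule q)
    also have "\<dots> = J g g * (J f f * J g g - (J f g)\<^sup>2)"
      by (simp add: algebra_simps power2_eq_square)
    finally show ?thesis using pos by (simp add: zero_le_mult_iff)
  qed
  then have "sqrt ((J f g)\<^sup>2) \<le> sqrt (J f f * J g g)" by (rule real_sqrt_le_mono)
  then show ?thesis by (simp add: Jnorm_def real_sqrt_mult)
qed

lemma Jnorm_triangle:
  assumes f: "f \<in> G" and g: "g \<in> G"
  shows "Jnorm J (\<lambda>z. f z + g z) \<le> Jnorm J f + Jnorm J g"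
proof (rule power2_le_imp_le)
  have "(Jnorm J (\<lambda>z. f z + g z))\<^sup>2 = J f f + 2 * J f g + J g g"
    using semi_inner_quadratic[OF f g, of 1 1] by (simp add: Jnorm_square subspace_add f g)
  also have "\<dots> \<le> J f f + 2 * (Jnorm J f * Jnorm J g) + J g g"
    using semi_inner_Cauchy_Schwarz[OF f g] by linarith
  also have "\<dots> = (Jnorm J f + Jnorm J g)\<^sup>2"
    by (simp add: power2_sum Jnorm_square f g)
  finally show "(Jnorm J (\<lambda>z. f z + g z))\<^sup>2 \<le> (Jnorm J f + Jnorm J g)\<^sup>2" .
qed (simp add: Jnorm_nonneg f g)

lemma Jnorm_sum_le:
  assumes "\<And>j. j < (p::nat) \<Longrightarrow> f j \<in> G \<and> Jnorm J (f j) \<le> B"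
  shows "Jnorm J (\<lambda>z. \<Sum>j<p. f j z * c j) \<le> B * (\<Sum>j<p. \<bar>c j\<bar>)"
  using assms
proof (induction p)
  case 0
  have "Jnorm J (\<lambda>z. 0) = 0" using Jnorm_scale[OF subspace_zero, of 0] by simp
  then show ?case by simp
next
  case (Suc p)
  have 1: "(\<lambda>z. \<Sum>j<p. f j z * c j) \<in> G" using Suc.prems by (intro finite_subspace_sum[OF G]) auto
  have 2: "(\<lambda>z. c p * f p z) \<in> G" using Suc.prems by (intro subspace_scale) auto
  have "Jnorm J (\<lambda>z. (\<Sum>j<p. f j z * c j) + c p * f p z)
      \<le> Jnorm J (\<lambda>z. \<Sum>j<p. f j z * c j) + Jnorm J (\<lambda>z. c p * f p z)"
    by (rule Jnorm_triangle[OF 1 2])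
  also have "\<dots> \<le> B * (\<Sum>j<p. \<bar>c j\<bar>) + \<bar>c p\<bar> * B"
    using Suc by (intro add_mono) (auto simp: Jnorm_scale intro!: mult_left_mono)
  finally show ?case by (simp add: algebra_simps)
qed

end

lemma L2norm_scale: "L2norm Qz (\<lambda>z. c * g z) = \<bar>c\<bar> * L2norm Qz g"
  by (simp add: L2norm_def power_mult_distrib real_sqrt_mult)

lemma L2norm_nonneg: "0 \<le> L2norm Qz g"
  by (simp add: L2norm_def)

lemma L2norm_square: "(L2norm Qz g)\<^sup>2 = (\<integral>z. (g z)\<^sup>2 \<partial>Qz)"
  by (simp add: L2norm_def)

text \<open>Entropy condition (C4) allows centres outside the class; moving each centre to a nearby
  member of the class costs a factor two in the radius.\<close>

lemma inner_net:
  assumes "sup_entropy_le d G C u b" "U \<subseteq> C" "U \<noteq> {}"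
  shows "\<exists>N. N \<subseteq> U \<and> finite N \<and> N \<noteq> {} \<and> real (card N) \<le> exp b \<and>
           (\<forall>g\<in>U. \<exists>f\<in>N. sup_dist_le d g f (2 * u))"
proof -
  obtain F where F: "finite F" "ln (real (card F)) \<le> b" "\<And>g. g \<in> C \<Longrightarrow> \<exists>f\<in>F. sup_dist_le d g f u"
    using assms(1) unfolding sup_entropy_le_def by blast
  define F' where "F' = {f\<in>F. \<exists>g\<in>U. sup_dist_le d g f u}"
  define c where "c f = (SOME g. g \<in> U \<and> sup_dist_le d g f u)" for f
  have c: "c f \<in> U \<and> sup_dist_le d (c f) f u" if "f \<in> F'" for f
  proof -
    have "\<exists>g. g \<in> U \<and> sup_dist_le d g f u" using that by (auto simp: F'_def)
    then show ?thesis unfolding c_def by (rule someI_ex)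
  qed
  have cov: "\<exists>f\<in>c ` F'. sup_dist_le d g f (2 * u)" if g: "g \<in> U" for g
  proof -
    obtain f where f: "f \<in> F" "sup_dist_le d g f u" using F(3) g assms(2) by blast
    then have "f \<in> F'" using g by (auto simp: F'_def)
    moreover have "sup_dist_le d g (c f) (2 * u)"
      unfolding sup_dist_le_def
    proof
      fix z assume "z \<in> space (Rvec d)"
      then have "\<bar>g z - f z\<bar> \<le> u" "\<bar>c f z - f z\<bar> \<le> u"
        using f c[OF \<open>f \<in> F'\<close>] by (auto simp: sup_dist_le_def)
      then show "\<bar>g z - c f z\<bar> \<le> 2 * u" by linarith
    qed
    ultimately show ?thesis by blast
  qed
  have fin: "finite F'" using F(1) by (simp add: F'_def)
  have ne: "c ` F' \<noteq> {}" using cov assms(3) by blast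
  \<comment> \<open>\<open>ln 0\<close> is 0 by convention, so \<open>exp (ln (card F))\<close>
    equals \<open>card F\<close> only for a nonempty cover.\<close>
  then have pos: "0 < card F" using F(1) by (auto simp: F'_def card_gt_0_iff)
  have "card (c ` F') \<le> card F'" by (rule card_image_le[OF fin])
  also have "\<dots> \<le> card F" by (rule card_mono[OF F(1)]) (auto simp: F'_def)
  finally have "real (card (c ` F')) \<le> exp (ln (real (card F)))" using pos by simp
  also have "\<dots> \<le> exp b" using F(2) by simp
  finally show ?thesis using fin ne cov c by (intro exI[of _ "c ` F'"]) auto
qed

section \<open>Chaining\<close>

lemma power_powr: "0 < a \<Longrightarrow> (a ^ k) powr s = (a powr s) ^ k" for a s :: real
  by (induction k) (auto simp: powr_mult)

text \<open>Level \<open>k\<close> of the chain uses a net of radius about \<open>\<mu> 2\<^sup>-\<^sup>k\<close> and the tolerance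
  \<open>\<tau> k\<close>, proportional to \<open>2 powr (- k * (1 - 1/(2*m)))\<close>: then the Gaussian exponent and the
  entropy both grow like \<open>2 powr (k/m)\<close>, and the tolerances are summable because \<open>m > 1/2\<close>.
  The event \<open>B\<close> carries the information needed for the variance at the coarsest level.\<close>

lemma chaining:
  fixes Z :: "((nat \<Rightarrow> real) \<Rightarrow> real) \<Rightarrow> 'w \<Rightarrow> real"
  assumes M: "prob_space M" and B: "B \<in> sets M"
    and meas: "\<And>u. u \<in> U \<Longrightarrow> Z u \<in> borel_measurable M"
    and net: "\<And>r. 0 < r \<Longrightarrow> \<exists>N. N \<subseteq> U \<and> finite N \<and> N \<noteq> {} \<and>
        real (card N) \<le> exp (A * r powr (-1/m)) \<and> (\<forall>g\<in>U. \<exists>f\<in>N. sup_dist_le d g f (2 * r))"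
    and base: "\<And>u. u \<in> U \<Longrightarrow>
        measure M {\<omega>\<in>space M. \<omega> \<in> B \<and> \<bar>Z u \<omega>\<bar> > \<gamma> * \<mu> * \<rho> / 3} \<le> 2 * exp (- (c * n * \<rho>\<^sup>2))"
    and incr: "\<And>a b r t. a \<in> U \<Longrightarrow> b \<in> U \<Longrightarrow> sup_dist_le d a b r \<Longrightarrow> 0 < r \<Longrightarrow> 0 < t \<Longrightarrow>
        measure M {\<omega>\<in>space M. \<bar>Z a \<omega> - Z b \<omega>\<bar> > t} \<le> 2 * exp (- (n * t\<^sup>2 / (4 * L\<^sup>2 * r\<^sup>2)))"
    and last: "\<And>a b r \<omega>. a \<in> U \<Longrightarrow> b \<in> U \<Longrightarrow> sup_dist_le d a b r \<Longrightarrow> 0 < r \<Longrightarrow> \<omega> \<in> B \<Longrightarrow>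
        \<bar>Z a \<omega> - Z b \<omega>\<bar> \<le> 4 * L * r"
    and m: "m > 1/2" and pos: "A > 0" "L > 0" "\<gamma> > 0" "\<mu> > 0" "c > 0" "n > 0" and \<rho>: "\<mu> \<le> \<rho>"
    and \<eta>: "\<eta> = 1 - 2 powr (- (1 - 1 / (2 * m)))"
    and c: "c \<le> \<gamma>\<^sup>2 * \<eta>\<^sup>2 / (1296 * L\<^sup>2)"
    and rate: "A * \<mu> powr (-1/m) \<le> c / 4 * (n * \<mu>\<^sup>2)" "2 * m \<le> c * (n * \<mu>\<^sup>2)"
  shows "\<exists>E\<in>sets M. E \<subseteq> B \<and> measure M (B - E) \<le> 4 * exp (- (c * n * \<rho>\<^sup>2 / 2)) \<and>
           (\<forall>\<omega>\<in>E. \<forall>u\<in>U. \<bar>Z u \<omega>\<bar> \<le> \<gamma> * \<mu> * \<rho>)"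
proof -
  interpret prob_space M by (rule M)
  define q where "q = 2 powr (- (1 - 1 / (2 * m)))"
  define y where "y = 2 powr (1 / m)"
  define r where "r k = \<mu> * (1/2) ^ k" for k :: nat
  define \<tau> where "\<tau> k = \<gamma> * \<mu> * \<rho> / 3 * \<eta> * q ^ k" for k :: nat
  define V where "V = n * \<rho>\<^sup>2"
  have "\<rho> > 0" using pos \<rho> by linarith
  have q01: "0 < q" "q < 1"
    using m powr_less_one[of 2 "- (1 - 1 / (2 * m))"] by (auto simp: q_def field_simps)
  have \<eta>q: "\<eta> = 1 - q" by (simp add: \<eta> q_def)
  have "2 * q = 2 powr (1 + - (1 - 1 / (2 * m)))" by (simp add: q_def powr_diff)
  then have "(2 * q)\<^sup>2 = 2 powr ((1 / (2 * m)) * 2)" by (simp add: powr_power)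
  then have qy: "(2 * q)\<^sup>2 = y" by (simp add: y_def)
  have y1: "1 + ln 2 / m \<le> y"
    using exp_ge_add_one_self[of "ln 2 / m"] by (simp add: y_def powr_def)
  have ln2m: "0 \<le> ln 2 / m" using m by simp
  \<comment> \<open>Linear growth of the exponent is enough: combined with
    \<open>2 * m \<le> c * V\<close> it makes every level gain a factor 1/2 in
    \<open>Bad_le\<close>.\<close>
  have ybern: "1 + real k * (ln 2 / m) \<le> y ^ k" for k
  proof -
    have "1 + real k * (ln 2 / m) \<le> (1 + ln 2 / m) ^ k"
      using ln2m by (intro Bernoulli_inequality) linarith
    also have "\<dots> \<le> y ^ k" using y1 ln2m by (intro power_mono) auto
    finally show ?thesis .
  qed
  have y_ge1: "1 \<le> y" using y1 ln2m by linarith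
  have rpos: "0 < r k" for k using pos by (simp add: r_def)
  have nV: "n * \<mu>\<^sup>2 \<le> V" unfolding V_def using pos \<rho> by (intro mult_left_mono power_mono) auto
  have Vpos: "0 < V" using pos \<open>\<rho> > 0\<close> by (simp add: V_def)
  have ent: "A * r k powr (-1/m) \<le> c / 4 * V * y ^ k" for k
  proof -
    have "(1/2 :: real) powr (-1/m) = y"
      by (simp add: y_def powr_def ln_div)
    then have "r k powr (-1/m) = \<mu> powr (-1/m) * y ^ k"
      using pos by (simp add: r_def powr_mult power_powr del: power_one_over)
    then have "A * r k powr (-1/m) = (A * \<mu> powr (-1/m)) * y ^ k" by simp
    also have "\<dots> \<le> (c / 4 * (n * \<mu>\<^sup>2)) * y ^ k"
      using rate(1) y_ge1 by (intro mult_right_mono) auto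
    also have "\<dots> \<le> (c / 4 * V) * y ^ k"
      using nV pos y_ge1 by (intro mult_right_mono mult_left_mono) auto
    finally show ?thesis by simp
  qed
  have "\<exists>N. \<forall>k. N k \<subseteq> U \<and> finite (N k) \<and> N k \<noteq> {} \<and> real (card (N k)) \<le> exp (c / 4 * V * y ^ k)
      \<and> (\<forall>g\<in>U. \<exists>f\<in>N k. sup_dist_le d g f (2 * r k))"
  proof (intro choice allI)
    fix k
    obtain N where "N \<subseteq> U \<and> finite N \<and> N \<noteq> {} \<and> real (card N) \<le> exp (A * r k powr (-1/m))
        \<and> (\<forall>g\<in>U. \<exists>f\<in>N. sup_dist_le d g f (2 * r k))"
      using net[OF rpos[of k]] by blast
    moreover have "exp (A * r k powr (-1/m)) \<le> exp (c / 4 * V * y ^ k)" using ent[of k] by simp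
    ultimately show "\<exists>N. N \<subseteq> U \<and> finite N \<and> N \<noteq> {} \<and> real (card N) \<le> exp (c / 4 * V * y ^ k)
      \<and> (\<forall>g\<in>U. \<exists>f\<in>N. sup_dist_le d g f (2 * r k))"
      by (intro exI[of _ N]) (meson order_trans)
  qed
  then obtain N where N: "\<And>k. N k \<subseteq> U" "\<And>k. finite (N k)" "\<And>k. N k \<noteq> {}"
    "\<And>k. real (card (N k)) \<le> exp (c / 4 * V * y ^ k)"
    "\<And>k g. g \<in> U \<Longrightarrow> \<exists>f\<in>N k. sup_dist_le d g f (2 * r k)"
    by blast
  have cN: "finite (N k)" "N k \<subseteq> U" for k using N by auto
  \<comment> \<open>Only links that a chain can use: the points chosen for \<open>u\<close> at
    levels \<open>k\<close> and \<open>k - 1\<close> are within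
    \<open>2 * r k + 2 * r (k - 1) = 6 * r k\<close> of each other. Level 0 is treated separately,
    so the truncated \<open>0 - 1\<close> does no harm.\<close>
  define P where "P k = {ab \<in> N k \<times> N (k - 1). sup_dist_le d (fst ab) (snd ab) (6 * r k)}" for k
  \<comment> \<open>The chain stops at the level where the deterministic remainder
    \<open>4 * L * (2 * r K)\<close> drops below one third of the tolerance. The base point and the
    sum of the links get the other two thirds.\<close>
  have "\<exists>K. (1/2 :: real) ^ K < \<gamma> * \<rho> / (24 * L)"
    using pos \<open>\<rho> > 0\<close> by (intro real_arch_pow_inv) auto
  then obtain K where K: "(1/2 :: real) ^ K < \<gamma> * \<rho> / (24 * L)" by blast
  define Bad where "Bad k = (if k = 0 then \<Union>a\<in>N 0. {\<omega>\<in>space M. \<omega> \<in> B \<and> \<bar>Z a \<omega>\<bar> > \<gamma> * \<mu> * \<rho> / 3}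
     else \<Union>ab\<in>P k. {\<omega>\<in>space M. \<bar>Z (fst ab) \<omega> - Z (snd ab) \<omega>\<bar> > \<tau> k})" for k
  have finP: "finite (P k)" for k using N by (auto simp: P_def)
  have PU: "fst ab \<in> U" "snd ab \<in> U" if "ab \<in> P k" for ab k
    using that cN[of k] cN[of "k - 1"] by (auto simp: P_def)
  have meas0: "{\<omega>\<in>space M. \<omega> \<in> B \<and> \<bar>Z a \<omega>\<bar> > \<gamma> * \<mu> * \<rho> / 3} \<in> sets M" if "a \<in> U" for a
    using meas[OF that] B by measurable
  have meask: "{\<omega>\<in>space M. \<bar>Z a \<omega> - Z b \<omega>\<bar> > t} \<in> sets M" if "a \<in> U" "b \<in> U" for a b t
    using meas[OF that(1)] meas[OF that(2)] by measurable
  have Bad_0: "Bad k = (\<Union>a\<in>N 0. {\<omega>\<in>space M. \<omega> \<in> B \<and> \<bar>Z a \<omega>\<bar> > \<gamma> * \<mu> * \<rho> / 3})" if "k = 0" for k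
    using that by (simp only: Bad_def if_True refl)
  have Bad_pos: "Bad k = (\<Union>ab\<in>P k. {\<omega>\<in>space M. \<bar>Z (fst ab) \<omega> - Z (snd ab) \<omega>\<bar> > \<tau> k})"
    if "k \<noteq> 0" for k using that by (simp only: Bad_def if_False)
  have Bad_sets: "Bad k \<in> sets M" for k
  proof (cases "k = 0")
    case True
    show ?thesis unfolding Bad_0[OF True]
      by (intro sets.finite_UN N(2) meas0) (use N(1) in blast)
  next
    case False
    show ?thesis unfolding Bad_pos[OF False]
      by (intro sets.finite_UN finP meask PU)
  qed
  have Bad_le: "prob (Bad k) \<le> 2 * exp (- (c * V / 2)) * (1/2) ^ k" for k
  proof -
    have "prob (Bad k) \<le> 2 * exp (- (c / 2 * V * y ^ k))"
    proof (cases "k = 0")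
      case True
      have "prob (Bad k) \<le> (\<Sum>a\<in>N 0. prob {\<omega>\<in>space M. \<omega> \<in> B \<and> \<bar>Z a \<omega>\<bar> > \<gamma> * \<mu> * \<rho> / 3})"
        unfolding Bad_0[OF True] using N(1,2) meas0
        by (intro finite_measure_subadditive_finite) blast+
      also have "\<dots> \<le> (\<Sum>a\<in>N 0. 2 * exp (- (c * V)))"
      proof (intro sum_mono)
        fix a assume "a \<in> N 0"
        then have "a \<in> U" using N(1) by blast
        from base[OF this]
        show "prob {\<omega>\<in>space M. \<omega> \<in> B \<and> \<bar>Z a \<omega>\<bar> > \<gamma> * \<mu> * \<rho> / 3} \<le> 2 * exp (- (c * V))"
          by (simp only: V_def mult.assoc)
      qed
      also have "\<dots> = real (card (N 0)) * (2 * exp (- (c * V)))" by simp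
      also have "\<dots> \<le> exp (c / 4 * V * y ^ 0) * (2 * exp (- (c * V)))"
        by (intro mult_right_mono N) auto
      also have "\<dots> = 2 * exp (- (3 * (c * V) / 4))" by (simp add: exp_add[symmetric] algebra_simps)
      also have "\<dots> \<le> 2 * exp (- (c / 2 * V * y ^ k))" using True pos Vpos by simp
      finally show ?thesis .
    next
      case False
      have t: "0 < \<tau> k" using pos \<open>\<rho> > 0\<close> q01 by (simp add: \<tau>_def \<eta>q)
      \<comment> \<open>Origin of 1296: 4 from the Gaussian exponent, 6 squared from the length of a
        link, 3 squared from the share of the tolerance. The factor
        \<open>(2 * q)\<^sup>2 = y\<close> per level remains.\<close>
      have ex: "n * (\<tau> k)\<^sup>2 / (4 * L\<^sup>2 * (6 * r k)\<^sup>2) = (\<gamma>\<^sup>2 * \<eta>\<^sup>2 / (1296 * L\<^sup>2)) * V * y ^ k"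
      proof -
        have "y ^ k = (q ^ k)\<^sup>2 / ((1/2) ^ k)\<^sup>2"
        proof -
          have sq: "(a ^ k)\<^sup>2 = (a\<^sup>2) ^ k" for a :: real by (simp add: power_mult[symmetric] mult.commute)
          have "y ^ k = (q\<^sup>2 / (1/2)\<^sup>2) ^ k" by (simp add: qy[symmetric] power_divide mult.commute)
          then show ?thesis by (simp only: sq power_divide)
        qed
        then show ?thesis using pos by (simp add: \<tau>_def r_def V_def power_mult_distrib power_divide)
      qed
      have "prob (Bad k) \<le> (\<Sum>ab\<in>P k. prob {\<omega>\<in>space M. \<bar>Z (fst ab) \<omega> - Z (snd ab) \<omega>\<bar> > \<tau> k})"
        unfolding Bad_pos[OF False] using finP meask PU[of _ k]
        by (intro finite_measure_subadditive_finite) blast+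
      also have "\<dots> \<le> (\<Sum>ab\<in>P k. 2 * exp (- (n * (\<tau> k)\<^sup>2 / (4 * L\<^sup>2 * (6 * r k)\<^sup>2))))"
        using t rpos by (intro sum_mono incr PU) (auto simp: P_def)
      also have "\<dots> = real (card (P k)) * (2 * exp (- ((\<gamma>\<^sup>2 * \<eta>\<^sup>2 / (1296 * L\<^sup>2)) * V * y ^ k)))"
        by (simp only: ex sum_constant)
      also have "\<dots> \<le> real (card (P k)) * (2 * exp (- (c * V * y ^ k)))"
      proof -
        have "c * V * y ^ k \<le> (\<gamma>\<^sup>2 * \<eta>\<^sup>2 / (1296 * L\<^sup>2)) * V * y ^ k"
          using c Vpos y_ge1 by (intro mult_right_mono) auto
        then show ?thesis 
          by (intro mult_left_mono iffD2[OF exp_le_cancel_iff] iffD2[OF neg_le_iff_le]) auto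
      qed
      \<comment> \<open>A link involves two nets, each costing a quarter of the exponent, so half of
        the exponent survives the union bound.\<close>
      also have "real (card (P k)) \<le> exp (c / 2 * V * y ^ k)"
      proof -
        have "card (P k) \<le> card (N k \<times> N (k - 1))"
          using N by (intro card_mono) (auto simp: P_def)
        then have "real (card (P k)) \<le> real (card (N k)) * real (card (N (k - 1)))"
          by (simp add: card_cartesian_product flip: of_nat_mult)
        also have "\<dots> \<le> exp (c / 4 * V * y ^ k) * exp (c / 4 * V * y ^ (k - 1))"
          by (intro mult_mono N) auto
        also have "\<dots> \<le> exp (c / 4 * V * y ^ k) * exp (c / 4 * V * y ^ k)"
          using pos Vpos y_ge1 by (simp add: power_increasing)
        also have "\<dots> = exp (c / 2 * V * y ^ k)" by (simp add: exp_add[symmetric])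
        finally show ?thesis .
      qed
      then have "real (card (P k)) * (2 * exp (- (c * V * y ^ k)))
          \<le> exp (c / 2 * V * y ^ k) * (2 * exp (- (c * V * y ^ k)))"
        by (intro mult_right_mono) auto
      also have "\<dots> = 2 * exp (- (c / 2 * V * y ^ k))"
        by (simp add: exp_add[symmetric] algebra_simps)
      finally show ?thesis .
    qed
    also have "exp (- (c / 2 * V * y ^ k)) \<le> exp (- (c * V / 2)) * (1/2) ^ k"
    proof -
      \<comment> \<open>The surplus of \<open>y ^ k\<close> over 1 pays for \<open>k * ln 2\<close>,
        which makes the failure probabilities of the levels summable.\<close>
      have "c * V / 2 + real k * ln 2 \<le> c / 2 * V * y ^ k"
      proof -
        have "2 * m \<le> c * V"
          using rate(2) nV pos by (meson mult_left_mono order_less_imp_le order_trans)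
        then have "1 \<le> c / 2 * V * (1 / m)" using m by (simp add: field_simps)
        then have "1 * (real k * ln 2) \<le> (c / 2 * V * (1 / m)) * (real k * ln 2)"
          by (intro mult_right_mono) auto
        then have "c * V / 2 + real k * ln 2 \<le> c / 2 * V * (1 + real k * (ln 2 / m))"
          by (simp add: algebra_simps)
        also have "\<dots> \<le> c / 2 * V * y ^ k"
          using pos Vpos ybern[of k] by (intro mult_left_mono) auto
        finally show ?thesis .
      qed
      then have "exp (- (c / 2 * V * y ^ k)) \<le> exp (- (c * V / 2) + real k * (- ln 2))" by simp
      also have "\<dots> = exp (- (c * V / 2)) * (1/2) ^ k"
        by (simp only: exp_add exp_of_nat_mult) (simp add: exp_minus power_one_over inverse_eq_divide)
      finally show ?thesis .
    qed
    finally show ?thesis by simp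
  qed
  \<comment> \<open>A finite union over finite nets is removed, so \<open>E\<close> is measurable
    whatever \<open>U\<close> is.\<close>
  define E where "E = B - (\<Union>k\<le>K. Bad k)"
  have E: "E \<in> sets M" unfolding E_def using B Bad_sets by auto
  have "prob (B - E) \<le> prob (\<Union>k\<le>K. Bad k)"
    using Bad_sets by (intro finite_measure_mono) (auto simp: E_def)
  also have "\<dots> \<le> (\<Sum>k\<le>K. prob (Bad k))"
    using Bad_sets by (intro finite_measure_subadditive_finite) auto
  also have "\<dots> \<le> (\<Sum>k\<le>K. 2 * exp (- (c * V / 2)) * (1/2) ^ k)" by (intro sum_mono Bad_le)
  also have "\<dots> = 2 * exp (- (c * V / 2)) * (\<Sum>k\<le>K. (1/2) ^ k)" by (simp add: sum_distrib_left)
  also have "(\<Sum>k\<le>K. (1/2 :: real) ^ k) \<le> 2"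
    using sum_gp0[of "1/2 :: real" K] by simp
  then have "2 * exp (- (c * V / 2)) * (\<Sum>k\<le>K. (1/2) ^ k) \<le> 2 * exp (- (c * V / 2)) * 2"
    by (intro mult_left_mono) auto
  finally have PE: "prob (B - E) \<le> 4 * exp (- (c * n * \<rho>\<^sup>2 / 2))" by (simp add: V_def mult.assoc)
  have "\<bar>Z u \<omega>\<bar> \<le> \<gamma> * \<mu> * \<rho>" if \<omega>: "\<omega> \<in> E" and u: "u \<in> U" for \<omega> u
  proof -
    have "\<omega> \<in> B" "\<omega> \<in> space M" using \<omega> B sets.sets_into_space by (auto simp: E_def)
    have nb: "\<omega> \<notin> Bad k" if "k \<le> K" for k using \<omega> that by (auto simp: E_def)
    obtain f where f: "\<And>k. f k \<in> N k" "\<And>k. sup_dist_le d u (f k) (2 * r k)"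
      using N(5)[OF u] by metis
    have fU: "f k \<in> U" for k using f(1)[of k] N(1)[of k] by blast
    have z0: "\<bar>Z (f 0) \<omega>\<bar> \<le> \<gamma> * \<mu> * \<rho> / 3"
      using nb[of 0] f(1)[of 0] \<open>\<omega> \<in> B\<close> \<open>\<omega> \<in> space M\<close> by (auto simp: Bad_def not_less)
    have step: "\<bar>Z (f (Suc k)) \<omega> - Z (f k) \<omega>\<bar> \<le> \<tau> (Suc k)" if "k < K" for k
    proof -
      have "sup_dist_le d (f (Suc k)) (f k) (6 * r (Suc k))"
        unfolding sup_dist_le_def
      proof
        fix z assume "z \<in> space (Rvec d)"
        then have "\<bar>u z - f (Suc k) z\<bar> \<le> 2 * r (Suc k)" "\<bar>u z - f k z\<bar> \<le> 2 * r k"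
          using f(2) by (auto simp: sup_dist_le_def)
        then show "\<bar>f (Suc k) z - f k z\<bar> \<le> 6 * r (Suc k)" by (simp add: r_def)
      qed
      then have "(f (Suc k), f k) \<in> P (Suc k)" using f(1) by (simp add: P_def)
      then show ?thesis using nb[of "Suc k"] that \<open>\<omega> \<in> space M\<close>
        by (force simp: Bad_def not_less)
    qed
    have "k \<le> K \<Longrightarrow> \<bar>Z (f k) \<omega>\<bar> \<le> \<gamma> * \<mu> * \<rho> / 3 + (\<Sum>j<k. \<tau> (Suc j))" for k
    proof (induction k)
      case 0
      then show ?case using z0 by simp
    next
      case (Suc k)
      then show ?case using step[of k] by auto
    qed
    from this[of K] have "\<bar>Z (f K) \<omega>\<bar> \<le> \<gamma> * \<mu> * \<rho> / 3 + (\<Sum>j<K. \<tau> (Suc j))" by simp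
    also have "(\<Sum>j<K. \<tau> (Suc j)) \<le> \<gamma> * \<mu> * \<rho> / 3"
    proof -
      \<comment> \<open>The factor \<open>\<eta> = 1 - q\<close> in \<open>\<tau>\<close> normalises
        the geometric series.\<close>
      have "(\<Sum>j<K. \<tau> (Suc j)) = \<gamma> * \<mu> * \<rho> / 3 * (q * ((1 - q) * (\<Sum>j<K. q ^ j)))"
        by (simp add: \<tau>_def \<eta>q sum_distrib_left mult_ac)
      also have "(1 - q) * (\<Sum>j<K. q ^ j) = 1 - q ^ K" by (simp add: one_diff_power_eq)
      also have "q * (1 - q ^ K) \<le> 1 * 1" using q01 by (intro mult_mono) (auto simp: power_le_one)
      then have "\<gamma> * \<mu> * \<rho> / 3 * (q * (1 - q ^ K)) \<le> \<gamma> * \<mu> * \<rho> / 3 * 1"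
        using pos \<open>\<rho> > 0\<close> by (intro mult_left_mono) auto
      finally show ?thesis by simp
    qed
    finally have "\<bar>Z (f K) \<omega>\<bar> \<le> 2 * (\<gamma> * \<mu> * \<rho> / 3)" by simp
    moreover have "\<bar>Z u \<omega> - Z (f K) \<omega>\<bar> \<le> 4 * L * (2 * r K)"
      using rpos[of K] by (intro last u fU f \<open>\<omega> \<in> B\<close>) auto
    moreover have "4 * L * (2 * r K) \<le> \<gamma> * \<mu> * \<rho> / 3"
    proof -
      have "(8 * L * \<mu>) * (1/2) ^ K \<le> (8 * L * \<mu>) * (\<gamma> * \<rho> / (24 * L))"
        using K pos by (intro mult_left_mono) auto
      then show ?thesis using pos by (simp add: r_def mult_ac)
    qed
    ultimately show ?thesis by linarith
  qed
  then show ?thesis using E PE by (intro bexI[of _ E]) (auto simp: E_def)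
qed

section \<open>Exponential tail bounds for independent copies\<close>

text \<open>A self-normalised Chernoff bound: the variance proxy \<open>D\<close> is itself random
  and is compensated inside the exponential, whose expectation factorises by independence.
  Restricting to the event that the proxies add up to at most \<open>n * v\<close> replaces
  conditioning on the \<open>z\<close> sample, so no conditional distributions are
  constructed.\<close>

lemma iid_sum_tail:
  fixes S :: "'a measure"
  assumes S: "prob_space S" and [measurable]: "W \<in> borel_measurable S" "D \<in> borel_measurable S"
    and s: "s \<ge> 0" and mgf: "(\<integral>\<^sup>+q. ennreal (exp (s * W q - s\<^sup>2 * D q)) \<partial>S) \<le> 1"
  shows "measure (PiM {..<n} (\<lambda>_. S))
     {\<omega>\<in>space (PiM {..<n} (\<lambda>_. S)). (\<Sum>i<n. W (\<omega> i)) \<ge> real n * t \<and> (\<Sum>i<n. D (\<omega> i)) \<le> real n * v}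
     \<le> exp (- (real n * (s * t - s\<^sup>2 * v)))"
proof -
  let ?P = "PiM {..<n} (\<lambda>_. S)"
  interpret S: prob_space S by (rule S)
  interpret product_sigma_finite "\<lambda>_::nat. S" by standard
  interpret P: prob_space ?P by (rule prob_space_PiM) (rule S)
  let ?A = "{\<omega>\<in>space ?P. (\<Sum>i<n. W (\<omega> i)) \<ge> real n * t \<and> (\<Sum>i<n. D (\<omega> i)) \<le> real n * v}"
  let ?b = "real n * (s * t - s\<^sup>2 * v)"
  let ?f = "\<lambda>\<omega>. ennreal (exp (\<Sum>i<n. s * W (\<omega> i) - s\<^sup>2 * D (\<omega> i)))"
  have A: "?A \<in> sets ?P" by measurable
  have "ennreal (exp ?b) * emeasure ?P ?A = (\<integral>\<^sup>+\<omega>. ennreal (exp ?b) * indicator ?A \<omega> \<partial>?P)"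
    using A by (simp add: nn_integral_cmult_indicator)
  also have "\<dots> \<le> (\<integral>\<^sup>+\<omega>. ?f \<omega> \<partial>?P)"
  proof (intro nn_integral_mono)
    fix \<omega> assume "\<omega> \<in> space ?P"
    show "ennreal (exp ?b) * indicator ?A \<omega> \<le> ?f \<omega>"
    proof (cases "\<omega> \<in> ?A")
      case True
      have "s * (real n * t) \<le> s * (\<Sum>i<n. W (\<omega> i))" "s\<^sup>2 * (\<Sum>i<n. D (\<omega> i)) \<le> s\<^sup>2 * (real n * v)"
        using True s by (auto intro: mult_left_mono)
      then have "?b \<le> s * (\<Sum>i<n. W (\<omega> i)) - s\<^sup>2 * (\<Sum>i<n. D (\<omega> i))"
        by (simp add: algebra_simps)
      then show ?thesis using True by (simp add: sum_subtractf sum_distrib_left)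
    qed simp
  qed
  also have "\<dots> = (\<integral>\<^sup>+\<omega>. (\<Prod>i<n. ennreal (exp (s * W (\<omega> i) - s\<^sup>2 * D (\<omega> i)))) \<partial>?P)"
    by (simp add: exp_sum prod_ennreal)
  also have "\<dots> = (\<Prod>i<n. \<integral>\<^sup>+q. ennreal (exp (s * W q - s\<^sup>2 * D q)) \<partial>S)"
    by (rule product_nn_integral_prod) auto
  also have "\<dots> \<le> (\<Prod>i<n. 1)" by (intro prod_mono_ennreal) (use mgf in auto)
  finally have "ennreal (exp ?b * measure ?P ?A) \<le> ennreal 1"
    by (simp add: P.emeasure_eq_measure ennreal_mult)
  then have "exp ?b * measure ?P ?A \<le> 1" by (simp add: ennreal_le_iff2)
  then show ?thesis by (simp add: exp_minus pos_le_divide_eq mult.commute inverse_eq_divide del: of_nat_sum)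
qed

section \<open>Moment generating functions of a single observation\<close>

lemma prob_space_std_normal: "prob_space std_normal_measure"
  unfolding std_normal_measure_def using prob_space_normal_density[of 1 0] by simp

lemma sets_std_normal [measurable_cong, simp]: "sets std_normal_measure = sets borel"
  by (simp add: std_normal_measure_def)

lemma std_normal_mgf: "(\<integral>\<^sup>+e. ennreal (exp (a * e)) \<partial>std_normal_measure) = ennreal (exp (a\<^sup>2 / 2))"
proof -
  have "(\<integral>\<^sup>+e. ennreal (exp (a * e)) \<partial>std_normal_measure)
      = (\<integral>\<^sup>+e. ennreal (std_normal_density e) * ennreal (exp (a * e)) \<partial>lborel)"
    unfolding std_normal_measure_def by (rule nn_integral_density) auto
  also have "\<dots> = (\<integral>\<^sup>+e. ennreal (exp (a\<^sup>2 / 2)) * ennreal (normal_density a 1 e) \<partial>lborel)"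
  proof (intro nn_integral_cong)
    fix e
    have "- e\<^sup>2 / 2 + a * e = a\<^sup>2 / 2 - (e - a)\<^sup>2 / 2" by (simp add: power2_eq_square algebra_simps diff_divide_distrib add_divide_distrib)
    then have "std_normal_density e * exp (a * e) = exp (a\<^sup>2 / 2) * normal_density a 1 e"
      by (simp add: normal_density_def exp_add[symmetric])
    then show "ennreal (std_normal_density e) * ennreal (exp (a * e))
        = ennreal (exp (a\<^sup>2 / 2)) * ennreal (normal_density a 1 e)"
      by (simp flip: ennreal_mult)
  qed
  also have "\<dots> = ennreal (exp (a\<^sup>2 / 2)) * (\<integral>\<^sup>+e. ennreal (normal_density a 1 e) \<partial>lborel)"
    by (rule nn_integral_cmult) auto
  also have "(\<integral>\<^sup>+e. ennreal (normal_density a 1 e) \<partial>lborel) = ennreal 1"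
    by (subst nn_integral_eq_integral) auto
  finally show ?thesis by simp
qed

text \<open>For bounded centred variables: \<open>exp y \<le> y + exp (y\<^sup>2)\<close> with \<open>y = s * W\<close>, where the linear
  term integrates to zero.\<close>

lemma (in prob_space) centred_weighted_mgf:
  assumes [measurable]: "W \<in> borel_measurable M" "D \<in> borel_measurable M"
    and WD: "AE q in M. (W q)\<^sup>2 \<le> D q"
    and int: "integrable M (\<lambda>q. W q * exp (- (s\<^sup>2 * D q)))"
    and zero: "(\<integral>q. W q * exp (- (s\<^sup>2 * D q)) \<partial>M) = 0"
  shows "(\<integral>\<^sup>+q. ennreal (exp (s * W q - s\<^sup>2 * D q)) \<partial>M) \<le> 1"
proof -
  let ?g = "\<lambda>q. 1 + s * (W q * exp (- (s\<^sup>2 * D q)))"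
  have le: "AE q in M. exp (s * W q - s\<^sup>2 * D q) \<le> ?g q"
    using WD
  proof eventually_elim
    case (elim q)
    have "exp (s * W q - s\<^sup>2 * D q) = exp (s * W q) * exp (- (s\<^sup>2 * D q))" by (simp add: exp_add[symmetric])
    also have "\<dots> \<le> (s * W q + exp ((s * W q)\<^sup>2)) * exp (- (s\<^sup>2 * D q))"
      by (intro mult_right_mono exp_le_plus_exp_square) auto
    also have "\<dots> = s * (W q * exp (- (s\<^sup>2 * D q))) + exp (s\<^sup>2 * ((W q)\<^sup>2 - D q))"
      by (simp add: algebra_simps power_mult_distrib exp_add[symmetric])
    also have "exp (s\<^sup>2 * ((W q)\<^sup>2 - D q)) \<le> 1"
      using elim by (simp add: mult_nonneg_nonpos)
    finally show ?case by simp
  qed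
  have "(\<integral>\<^sup>+q. ennreal (exp (s * W q - s\<^sup>2 * D q)) \<partial>M) \<le> (\<integral>\<^sup>+q. ennreal (?g q) \<partial>M)"
    by (rule nn_integral_mono_AE) (use le in \<open>eventually_elim, simp add: ennreal_leI\<close>)
  also have "\<dots> = ennreal (\<integral>q. ?g q \<partial>M)"
  proof (rule nn_integral_eq_integral)
    show "AE q in M. 0 \<le> ?g q" using le by eventually_elim (meson exp_ge_zero order_trans)
  qed (use int in simp)
  also have "(\<integral>q. ?g q \<partial>M) = 1" using int zero by (simp add: prob_space)
  finally show ?thesis by simp
qed

lemma (in prob_space) bounded_centred_mgf:
  assumes [measurable]: "W \<in> borel_measurable M"
    and w: "AE q in M. \<bar>W q\<bar> \<le> w" and zero: "(\<integral>q. W q \<partial>M) = 0"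
  shows "(\<integral>\<^sup>+q. ennreal (exp (s * W q - s\<^sup>2 * w\<^sup>2)) \<partial>M) \<le> 1"
proof (rule centred_weighted_mgf)
  show "AE q in M. (W q)\<^sup>2 \<le> w\<^sup>2" using w
    by eventually_elim (metis abs_ge_zero power2_abs power_mono)
  have "integrable M W" by (rule integrable_const_bound[of _ w]) (use w in auto)
  then show "integrable M (\<lambda>q. W q * exp (- (s\<^sup>2 * w\<^sup>2)))" by simp
  show "(\<integral>q. W q * exp (- (s\<^sup>2 * w\<^sup>2)) \<partial>M) = 0" using zero by simp
qed auto

text \<open>For the centred square the crude proxy would be of order \<open>K ^ 4\<close>. Its
  variance is at most the fourth moment, hence at most \<open>K\<^sup>2 * v\<close>, which is small
  when \<open>v\<close> is. This gain makes deviations of order \<open>v\<close> visible; the price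
  is the range restriction on \<open>s\<close>.\<close>

lemma (in prob_space) bernstein_mgf:
  assumes [measurable]: "u \<in> borel_measurable M"
    and K: "\<And>q. q \<in> space M \<Longrightarrow> \<bar>u q\<bar> \<le> K" and s: "\<bar>s\<bar> * K\<^sup>2 \<le> 1"
    and v: "(\<integral>q. (u q)\<^sup>2 \<partial>M) \<le> v"
  shows "(\<integral>\<^sup>+q. ennreal (exp (s * ((u q)\<^sup>2 - (\<integral>q. (u q)\<^sup>2 \<partial>M)) - s\<^sup>2 * (K\<^sup>2 * v))) \<partial>M) \<le> 1"
proof -
  define c where "c = (\<integral>q. (u q)\<^sup>2 \<partial>M)"
  have u2: "(u q)\<^sup>2 \<le> K\<^sup>2" if "q \<in> space M" for q
    using K[OF that] by (metis abs_ge_zero power2_abs power_mono)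
  have i2: "integrable M (\<lambda>q. (u q)\<^sup>2)"
    by (rule integrable_const_bound[of _ "K\<^sup>2"]) (use u2 in auto)
  have u4: "norm (((u q)\<^sup>2)\<^sup>2) \<le> (K\<^sup>2)\<^sup>2" if "q \<in> space M" for q
    using power_mono[OF u2[OF that], of 2] by simp
  have i4: "integrable M (\<lambda>q. ((u q)\<^sup>2)\<^sup>2)"
    by (rule integrable_const_bound[OF AE_I2[OF u4]]) auto
  have c0: "0 \<le> c" by (simp add: c_def)
  have "c \<le> (\<integral>q. K\<^sup>2 \<partial>M)" unfolding c_def by (rule integral_mono_AE[OF i2]) (use u2 in auto)
  then have cK: "c \<le> K\<^sup>2" by (simp add: prob_space)
  let ?W = "\<lambda>q. (u q)\<^sup>2 - c"
  have iW: "integrable M (\<lambda>q. (?W q)\<^sup>2)" using i2 i4 by (simp add: power2_diff)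
  have "(\<integral>q. (?W q)\<^sup>2 \<partial>M) = (\<integral>q. ((u q)\<^sup>2)\<^sup>2 \<partial>M) - c\<^sup>2"
    using i2 i4 by (simp add: power2_diff prob_space c_def[symmetric] power2_eq_square[of c])
  also have "\<dots> \<le> (\<integral>q. ((u q)\<^sup>2)\<^sup>2 \<partial>M)" by simp
  also have "\<dots> \<le> (\<integral>q. K\<^sup>2 * (u q)\<^sup>2 \<partial>M)"
  proof (rule integral_mono[OF i4])
    fix q assume "q \<in> space M"
    from mult_right_mono[OF u2[OF this], of "(u q)\<^sup>2"]
    show "((u q)\<^sup>2)\<^sup>2 \<le> K\<^sup>2 * (u q)\<^sup>2" by (simp add: power2_eq_square)
  qed (use i2 in simp)
  also have "\<dots> \<le> K\<^sup>2 * v" using v by (simp add: mult_left_mono)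
  finally have var: "(\<integral>q. (?W q)\<^sup>2 \<partial>M) \<le> K\<^sup>2 * v" .
  let ?g = "\<lambda>q. 1 + s * ?W q + s\<^sup>2 * (?W q)\<^sup>2"
  have le: "exp (s * ?W q) \<le> ?g q" if q: "q \<in> space M" for q
  proof -
    have "\<bar>?W q\<bar> \<le> K\<^sup>2" 
      using u2[OF q] c0 cK zero_le_power2[of "u q"] unfolding abs_le_iff by linarith
    then have "\<bar>s * ?W q\<bar> \<le> \<bar>s\<bar> * K\<^sup>2" by (simp add: abs_mult mult_left_mono)
    then have y: "\<bar>s * ?W q\<bar> \<le> 1" using s by linarith
    show ?thesis using exp_le_quadratic[OF y] by (simp add: power_mult_distrib)
  qed
  have ig: "integrable M ?g" using i2 iW by simp
  have "(\<integral>\<^sup>+q. ennreal (exp (s * ?W q)) \<partial>M) \<le> (\<integral>\<^sup>+q. ennreal (?g q) \<partial>M)"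
    by (intro nn_integral_mono ennreal_leI le)
  also have "\<dots> = ennreal (\<integral>q. ?g q \<partial>M)"
    by (rule nn_integral_eq_integral[OF ig]) (auto intro!: AE_I2 order_trans[OF exp_ge_zero le])
  also have "(\<integral>q. ?g q \<partial>M) = 1 + s\<^sup>2 * (\<integral>q. (?W q)\<^sup>2 \<partial>M)"
    using i2 iW by (simp add: prob_space c_def[symmetric])
  also have "\<dots> \<le> 1 + s\<^sup>2 * (K\<^sup>2 * v)" using var by (simp add: mult_left_mono)
  also have "\<dots> \<le> exp (s\<^sup>2 * (K\<^sup>2 * v))" by (rule exp_ge_add_one_self)
  finally have *: "(\<integral>\<^sup>+q. ennreal (exp (s * ?W q)) \<partial>M) \<le> ennreal (exp (s\<^sup>2 * (K\<^sup>2 * v)))"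
    by (simp add: ennreal_leI)
  have "(\<integral>\<^sup>+q. ennreal (exp (s * ?W q - s\<^sup>2 * (K\<^sup>2 * v))) \<partial>M)
     = (\<integral>\<^sup>+q. ennreal (exp (- (s\<^sup>2 * (K\<^sup>2 * v)))) * ennreal (exp (s * ?W q)) \<partial>M)"
    by (simp add: exp_add[symmetric] flip: ennreal_mult)
  also have "\<dots> = ennreal (exp (- (s\<^sup>2 * (K\<^sup>2 * v)))) * (\<integral>\<^sup>+q. ennreal (exp (s * ?W q)) \<partial>M)"
    by (rule nn_integral_cmult) measurable
  also have "\<dots> \<le> ennreal (exp (- (s\<^sup>2 * (K\<^sup>2 * v)))) * ennreal (exp (s\<^sup>2 * (K\<^sup>2 * v)))"
    by (rule mult_left_mono[OF *]) simp
  also have "\<dots> = 1" by (simp add: exp_add[symmetric] flip: ennreal_mult)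
  finally show ?thesis by (simp add: c_def)
qed

lemma iid_abs_sum_tail:
  fixes S :: "'a measure"
  assumes S: "prob_space S" and [measurable]: "W \<in> borel_measurable S" "D \<in> borel_measurable S"
    and s: "s \<ge> 0"
    and mgf: "(\<integral>\<^sup>+q. ennreal (exp (s * W q - s\<^sup>2 * D q)) \<partial>S) \<le> 1"
             "(\<integral>\<^sup>+q. ennreal (exp ((- s) * W q - (- s)\<^sup>2 * D q)) \<partial>S) \<le> 1"
  shows "measure (PiM {..<n} (\<lambda>_. S))
     {\<omega>\<in>space (PiM {..<n} (\<lambda>_. S)). \<bar>\<Sum>i<n. W (\<omega> i)\<bar> \<ge> real n * t \<and> (\<Sum>i<n. D (\<omega> i)) \<le> real n * v}
     \<le> 2 * exp (- (real n * (s * t - s\<^sup>2 * v)))"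
proof -
  let ?P = "PiM {..<n} (\<lambda>_. S)"
  interpret P: prob_space ?P by (rule prob_space_PiM) (rule S)
  let ?A = "\<lambda>W. {\<omega>\<in>space ?P. (\<Sum>i<n. W (\<omega> i)) \<ge> real n * t \<and> (\<Sum>i<n. D (\<omega> i)) \<le> real n * v}"
  have "{\<omega>\<in>space ?P. \<bar>\<Sum>i<n. W (\<omega> i)\<bar> \<ge> real n * t \<and> (\<Sum>i<n. D (\<omega> i)) \<le> real n * v}
      \<subseteq> ?A W \<union> ?A (\<lambda>q. - W q)"
    by (auto simp: sum_negf)
  moreover have m: "?A W \<in> sets ?P" "?A (\<lambda>q. - W q) \<in> sets ?P" by measurable
  ultimately have "P.prob {\<omega>\<in>space ?P. \<bar>\<Sum>i<n. W (\<omega> i)\<bar> \<ge> real n * t \<and> (\<Sum>i<n. D (\<omega> i)) \<le> real n * v}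
      \<le> P.prob (?A W \<union> ?A (\<lambda>q. - W q))"
    by (intro P.finite_measure_mono) auto
  also have "\<dots> \<le> P.prob (?A W) + P.prob (?A (\<lambda>q. - W q))"
    by (rule measure_Un_le[OF m])
  also have "\<dots> \<le> exp (- (real n * (s * t - s\<^sup>2 * v))) + exp (- (real n * (s * t - s\<^sup>2 * v)))"
    using s mgf by (intro add_mono iid_sum_tail[OF S]) auto
  finally show ?thesis by simp
qed

lemma iid_mean_tail:
  fixes S :: "'a measure"
  assumes S: "prob_space S" and [measurable]: "W \<in> borel_measurable S" "D \<in> borel_measurable S"
    and mgf: "\<And>s. (\<integral>\<^sup>+q. ennreal (exp (s * W q - s\<^sup>2 * D q)) \<partial>S) \<le> 1"
    and n: "n > 0" and v: "v > 0" and t: "t \<ge> 0"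
  shows "measure (PiM {..<n} (\<lambda>_. S))
     {\<omega>\<in>space (PiM {..<n} (\<lambda>_. S)). \<bar>(\<Sum>i<n. W (\<omega> i)) / real n\<bar> > t \<and> (\<Sum>i<n. D (\<omega> i)) \<le> real n * v}
     \<le> 2 * exp (- (real n * t\<^sup>2 / (4 * v)))"
proof -
  let ?P = "PiM {..<n} (\<lambda>_. S)"
  interpret P: prob_space ?P by (rule prob_space_PiM) (rule S)
  have "P.prob {\<omega>\<in>space ?P. \<bar>(\<Sum>i<n. W (\<omega> i)) / real n\<bar> > t \<and> (\<Sum>i<n. D (\<omega> i)) \<le> real n * v}
    \<le> P.prob {\<omega>\<in>space ?P. \<bar>\<Sum>i<n. W (\<omega> i)\<bar> \<ge> real n * t \<and> (\<Sum>i<n. D (\<omega> i)) \<le> real n * v}"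
    using n by (intro P.finite_measure_mono) (auto simp: field_simps abs_mult)
  \<comment> \<open>\<open>t / (2 * v)\<close> maximises
    \<open>s * t - s\<^sup>2 * v\<close>.\<close>
  also have "\<dots> \<le> 2 * exp (- (real n * ((t / (2 * v)) * t - (t / (2 * v))\<^sup>2 * v)))"
    using v t by (intro iid_abs_sum_tail S mgf) auto
  also have "(t / (2 * v)) * t - (t / (2 * v))\<^sup>2 * v = t\<^sup>2 / (4 * v)"
    using v by (simp add: field_simps power2_eq_square)
  finally show ?thesis by simp
qed

section \<open>The partially linear model\<close>

locale partial_linear_model =
  fixes p d :: nat and Q :: "((nat \<Rightarrow> real) \<times> (nat \<Rightarrow> real)) measure"
    and G :: "((nat \<Rightarrow> real) \<Rightarrow> real) set"
    and J :: "((nat \<Rightarrow> real) \<Rightarrow> real) \<Rightarrow> ((nat \<Rightarrow> real) \<Rightarrow> real) \<Rightarrow> real"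
    and h :: "(nat \<Rightarrow> real) \<Rightarrow> nat \<Rightarrow> real" and KX Kg Jh :: real
  assumes Q: "prob_space Q" and sets_Q [measurable_cong]: "sets Q = sets (Rvec p \<Otimes>\<^sub>M Rvec d)"
    and G: "L2_subspace (marg_z d Q) G" and J: "semi_inner_on G J"
    and cond_exp: "is_cond_exp_x_given_z p d Q h"
    and C2: "cond_C2 p Q KX" and C5: "cond_C5 d (marg_z d Q) G J Kg" and C6: "cond_C6 p G J h Jh"
begin

sublocale Q: prob_space Q by (rule Q)

text \<open>The given constants carry no sign assumption; the absolute values and the added 1 make
  both bounds at least 1. \<open>Kb\<close> bounds the unit ball in sup-norm, and \<open>Kt\<close>
  is the bound \<open>KX\<close> on the covariates plus the resulting sup-norm bound on the
  components of \<open>h\<close>.\<close>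

definition Kb :: real where "Kb = \<bar>Kg\<bar> + 1"
definition Kt :: real where "Kt = \<bar>KX\<bar> + Kb * (1 + \<bar>Jh\<bar> + \<bar>KX\<bar>)"

abbreviation xt :: "(nat \<Rightarrow> real) \<times> (nat \<Rightarrow> real) \<Rightarrow> nat \<Rightarrow> real" where
  "xt q j \<equiv> fst q j - h (snd q) j"

abbreviation S :: "(((nat \<Rightarrow> real) \<times> (nat \<Rightarrow> real)) \<times> real) measure" where
  "S \<equiv> Q \<Otimes>\<^sub>M std_normal_measure"

sublocale N: prob_space std_normal_measure by (rule prob_space_std_normal)
sublocale QN: pair_prob_space Q std_normal_measure ..

lemma Kb: "1 \<le> Kb" and Kt: "1 \<le> Kt" "0 < Kt"
proof -
  show "1 \<le> Kb" by (simp add: Kb_def)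
  then have "1 * 1 \<le> Kb * (1 + \<bar>Jh\<bar> + \<bar>KX\<bar>)" by (intro mult_mono) auto
  then show "1 \<le> Kt" by (simp add: Kt_def)
  then show "0 < Kt" by simp
qed

lemma space_Q: "space Q = space (Rvec p) \<times> space (Rvec d)"
  using sets_eq_imp_space_eq[OF sets_Q] by (simp add: space_pair_measure)

lemma snd_Q [measurable]: "snd \<in> Q \<rightarrow>\<^sub>M Rvec d" and fst_Q: "fst \<in> Q \<rightarrow>\<^sub>M Rvec p"
  by measurable

lemma snd_space: "q \<in> space Q \<Longrightarrow> snd q \<in> space (Rvec d)"
  by (auto simp: space_Q)

lemma x_measurable [measurable]: "j < p \<Longrightarrow> (\<lambda>q. fst q j) \<in> borel_measurable Q"
  using measurable_compose[OF fst_Q[unfolded Rvec_def] measurable_component_singleton[of j "{..<p}" "\<lambda>_. borel"]]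
  by simp

lemma G_measurable: "g \<in> G \<Longrightarrow> g \<in> borel_measurable (Rvec d)"
  using G by (simp add: L2_subspace_def marg_z_def)

lemma h_in_G: "j < p \<Longrightarrow> (\<lambda>z. h z j) \<in> G" and Jnorm_h: "j < p \<Longrightarrow> Jnorm J (\<lambda>z. h z j) \<le> Jh"
  using C6 by (auto simp: cond_C6_def)

lemma h_measurable [measurable]: "j < p \<Longrightarrow> (\<lambda>z. h z j) \<in> borel_measurable (Rvec d)"
  using cond_exp by (simp add: is_cond_exp_x_given_z_def)

lemma h_snd_measurable [measurable]: "j < p \<Longrightarrow> (\<lambda>q. h (snd q) j) \<in> borel_measurable Q"
  by measurable

lemma integral_marg: "f \<in> borel_measurable (Rvec d) \<Longrightarrow> (\<integral>z. f z \<partial>marg_z d Q) = (\<integral>q. f (snd q) \<partial>Q)"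
  for f :: "(nat \<Rightarrow> real) \<Rightarrow> real"
  unfolding marg_z_def by (rule integral_distr) measurable

lemma G_bounded:
  assumes g: "g \<in> G" and a: "0 < a" "L2norm (marg_z d Q) g \<le> a" "Jnorm J g \<le> a"
    and z: "z \<in> space (Rvec d)"
  shows "\<bar>g z\<bar> \<le> a * Kb"
proof -
  let ?u = "\<lambda>z. (1 / a) * g z"
  have u: "?u \<in> G" by (rule subspace_scale[OF G J g])
  have "\<bar>1 / a\<bar> * L2norm (marg_z d Q) g \<le> 1" "\<bar>1 / a\<bar> * Jnorm J g \<le> 1" using a by auto
  then have ub: "?u \<in> unit_ball (marg_z d Q) G J"
    using u unfolding unit_ball_def L2norm_scale[symmetric] Jnorm_scale[OF G J g, symmetric] by blast
  have "\<bar>?u z\<bar> \<le> Kg" by (rule bspec[OF bspec[OF C5[unfolded cond_C5_def] ub] z])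
  then have "\<bar>?u z\<bar> \<le> Kb" by (simp add: Kb_def)
  then show ?thesis using a by (simp add: abs_mult field_simps)
qed

lemma x_bounded: "AE q in Q. \<forall>j<p. \<bar>fst q j\<bar> \<le> \<bar>KX\<bar>"
  using C2 unfolding cond_C2_def by eventually_elim (meson abs_ge_self order_trans)

lemma x_integrable: "j < p \<Longrightarrow> integrable Q (\<lambda>q. fst q j)"
  by (rule Q.integrable_const_bound[of _ "\<bar>KX\<bar>"]) (use x_bounded in auto)

lemma h_integrable: "j < p \<Longrightarrow> integrable Q (\<lambda>q. h (snd q) j)"
  using cond_exp by (simp add: is_cond_exp_x_given_z_def)

text \<open>The hypothesis on \<open>h\<close> tests against indicators of sets in \<open>z\<close>
  only. It identifies the conditional expectation of \<open>xt\<close> given the sigma-algebra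
  \<open>F\<close> generated by \<open>z\<close> as zero, and pulling out a bounded function of
  \<open>z\<close> gives the general statement.\<close>

lemma xt_orthogonal:
  assumes j: "j < p" and \<phi>[measurable]: "\<phi> \<in> borel_measurable (Rvec d)"
    and b: "\<And>z. z \<in> space (Rvec d) \<Longrightarrow> \<bar>\<phi> z\<bar> \<le> b"
  shows "integrable Q (\<lambda>q. \<phi> (snd q) * xt q j)" "(\<integral>q. \<phi> (snd q) * xt q j \<partial>Q) = 0"
proof -
  note [measurable] = x_measurable[OF j] h_snd_measurable[OF j]
  define F where "F = vimage_algebra (space Q) snd (Rvec d)"
  have sF: "sets F = {snd -` A \<inter> space Q |A. A \<in> sets (Rvec d)}"
    unfolding F_def by (rule sets_vimage_algebra2) (use snd_space in auto)
  have Fsub: "subalgebra Q F"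
    unfolding subalgebra_def sF using measurable_sets[OF snd_Q] by (auto simp: F_def)
  interpret F: finite_measure_subalgebra Q F
    by unfold_locales (rule Fsub)
  have ixt: "integrable Q (\<lambda>q. xt q j)" using x_integrable[OF j] h_integrable[OF j] by simp
  show i: "integrable Q (\<lambda>q. \<phi> (snd q) * xt q j)"
  proof (rule Bochner_Integration.integrable_bound)
    show "integrable Q (\<lambda>q. b * xt q j)" using ixt by simp
    show "AE q in Q. norm (\<phi> (snd q) * xt q j) \<le> norm (b * xt q j)"
    proof (rule AE_I2)
      fix q assume "q \<in> space Q"
      then have "\<bar>\<phi> (snd q)\<bar> \<le> \<bar>b\<bar>" using b[OF snd_space, of q] by linarith
      then show "norm (\<phi> (snd q) * xt q j) \<le> norm (b * xt q j)"
        unfolding real_norm_def abs_mult by (rule mult_right_mono) simp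
    qed
  qed measurable
  have "AE q in Q. real_cond_exp Q F (\<lambda>q. xt q j) q = 0"
  proof (rule F.real_cond_exp_charact)
    fix B assume "B \<in> sets F"
    then obtain A where A: "A \<in> sets (Rvec d)" "B = snd -` A \<inter> space Q"
      unfolding sF by blast
    have As[measurable]: "A \<in> sets (Rvec d)" by (rule A)
    have 1: "integrable Q (\<lambda>q. indicator A (snd q) * fst q j)"
      by (rule Bochner_Integration.integrable_bound[OF x_integrable[OF j]])
        (auto simp: indicator_def intro!: AE_I2 measurable_compose[OF snd_Q])
    have 2: "integrable Q (\<lambda>q. indicator A (snd q) * h (snd q) j)"
      by (rule Bochner_Integration.integrable_bound[OF h_integrable[OF j]])
        (auto simp: indicator_def intro!: AE_I2 measurable_compose[OF snd_Q])
    have "(\<integral>q\<in>B. xt q j \<partial>Q) = (\<integral>q. indicator A (snd q) * fst q j - indicator A (snd q) * h (snd q) j \<partial>Q)"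
      unfolding set_lebesgue_integral_def
      by (intro Bochner_Integration.integral_cong refl) (auto simp: A indicator_def)
    also have "\<dots> = 0" using 1 2 cond_exp j A(1) by (simp add: is_cond_exp_x_given_z_def)
    finally show "(\<integral>q\<in>B. xt q j \<partial>Q) = (\<integral>q\<in>B. 0 \<partial>Q)" by (simp add: set_lebesgue_integral_def)
  qed (use ixt in auto)
  moreover have "(\<lambda>q. \<phi> (snd q)) \<in> borel_measurable F"
    unfolding F_def
    by (rule measurable_compose[OF measurable_vimage_algebra1 \<phi>]) (use snd_space in auto)
  then have "(\<integral>q. \<phi> (snd q) * real_cond_exp Q F (\<lambda>q. xt q j) q \<partial>Q) = (\<integral>q. \<phi> (snd q) * xt q j \<partial>Q)"
    by (intro F.real_cond_exp_intg(2) i) auto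
  moreover have "(\<integral>q. \<phi> (snd q) * real_cond_exp Q F (\<lambda>q. xt q j) q \<partial>Q) = (\<integral>q. 0 \<partial>Q)"
    using calculation(1) by (intro integral_cong_AE) auto
  ultimately show "(\<integral>q. \<phi> (snd q) * xt q j \<partial>Q) = 0" by simp
qed

text \<open>Conditional expectation contracts the L2 norm: by orthogonality the second moment of
  \<open>h\<close> equals that of \<open>x\<close> minus that of \<open>x - h\<close>.\<close>

lemma L2norm_h: assumes j: "j < p" shows "L2norm (marg_z d Q) (\<lambda>z. h z j) \<le> \<bar>KX\<bar>"
proof -
  note [measurable] = x_measurable[OF j] h_snd_measurable[OF j]
  let ?n = "L2norm (marg_z d Q) (\<lambda>z. h z j)"
  \<comment> \<open>This sup-norm bound involves the very norm being estimated. It only secures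
    integrability and admits \<open>h\<close> as test function; \<open>h_bounded\<close> later
    replaces it by a uniform bound.\<close>
  let ?a = "?n + \<bar>Jh\<bar> + 1"
  have b: "\<bar>h z j\<bar> \<le> ?a * Kb" if "z \<in> space (Rvec d)" for z
    using G_bounded[OF h_in_G[OF j], of ?a z] that L2norm_nonneg[of "marg_z d Q" "\<lambda>z. h z j"] Jnorm_h[OF j]
    by auto
  have h2: "integrable Q (\<lambda>q. (h (snd q) j)\<^sup>2)"
    by (rule Q.integrable_const_bound[of _ "(?a * Kb)\<^sup>2"])
      (auto intro!: AE_I2 power2_le_iff_abs_le[THEN iffD2] b snd_space order_trans[OF _ b]
        simp: power2_le_iff_abs_le)
  have x2: "AE q in Q. (fst q j)\<^sup>2 \<le> KX\<^sup>2"
    using x_bounded by eventually_elim (use j in \<open>simp add: abs_le_square_iff\<close>)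
  have ix2: "integrable Q (\<lambda>q. (fst q j)\<^sup>2)"
    by (rule Q.integrable_const_bound[of _ "KX\<^sup>2"]) (use x2 in auto)
  note o = xt_orthogonal[OF j h_measurable[OF j] b]
  have "(\<integral>q. (h (snd q) j)\<^sup>2 \<partial>Q) \<le> (\<integral>q. KX\<^sup>2 - (h (snd q) j * xt q j) * 2 \<partial>Q)"
  proof (rule integral_mono_AE)
    show "AE q in Q. (h (snd q) j)\<^sup>2 \<le> KX\<^sup>2 - (h (snd q) j * xt q j) * 2"
      using x2
    proof eventually_elim
      case (elim q)
      have "0 \<le> (fst q j - h (snd q) j)\<^sup>2" by simp
      have "(h (snd q) j)\<^sup>2 + h (snd q) j * xt q j * 2 = (fst q j)\<^sup>2 - (fst q j - h (snd q) j)\<^sup>2"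
        by (simp add: power2_eq_square algebra_simps)
      then show ?case using elim \<open>0 \<le> _\<close> by linarith
    qed
  qed (use h2 o(1) in auto)
  also have "\<dots> = KX\<^sup>2" using o by (simp add: Q.prob_space)
  finally have "?n\<^sup>2 \<le> \<bar>KX\<bar>\<^sup>2" by (simp add: L2norm_square integral_marg j)
  then show ?thesis by (rule power2_le_imp_le) simp
qed

lemma h_bounded: "j < p \<Longrightarrow> z \<in> space (Rvec d) \<Longrightarrow> \<bar>h z j\<bar> \<le> Kb * (1 + \<bar>Jh\<bar> + \<bar>KX\<bar>)"
  using G_bounded[OF h_in_G, of j "1 + \<bar>Jh\<bar> + \<bar>KX\<bar>" z] L2norm_h[of j] Jnorm_h[of j]
  by (simp add: mult.commute)

lemma xt_bounded: "AE q in Q. \<forall>j<p. \<bar>xt q j\<bar> \<le> Kt"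
  using x_bounded AE_space
proof eventually_elim
  case (elim q)
  show ?case
  proof (intro allI impI)
    fix j assume "j < p"
    then show "\<bar>xt q j\<bar> \<le> Kt"
      using elim h_bounded[of j "snd q"] snd_space[of q] unfolding Kt_def
      by (smt (verit))
  qed
qed

lemma nn_integral_fst_S: "f \<in> borel_measurable Q \<Longrightarrow> (\<integral>\<^sup>+w. f (fst w) \<partial>S) = (\<integral>\<^sup>+q. f q \<partial>Q)"
  using nn_integral_distr[of fst S Q f] N.distr_pair_fst[of Q] by simp

text \<open>The proxy depends on \<open>z\<close> alone, so the weight
  \<open>exp (- (s\<^sup>2 * D))\<close> in \<open>centred_weighted_mgf\<close> can be merged with
  \<open>\<phi>\<close> into one bounded function of \<open>z\<close>, against which
  \<open>xt\<close> is orthogonal. This is why the proxy may be the random \<open>\<phi>\<close> at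
  \<open>z\<close> squared instead of its supremum.\<close>

lemma mgf_design:
  assumes j: "j < p" and \<phi>[measurable]: "\<phi> \<in> borel_measurable (Rvec d)"
    and b: "\<And>z. z \<in> space (Rvec d) \<Longrightarrow> \<bar>\<phi> z\<bar> \<le> b"
  shows "(\<integral>\<^sup>+w. ennreal (exp (s * (xt (fst w) j * \<phi> (snd (fst w))) - s\<^sup>2 * (Kt\<^sup>2 * (\<phi> (snd (fst w)))\<^sup>2))) \<partial>S) \<le> 1"
proof -
  note [measurable] = x_measurable[OF j] h_snd_measurable[OF j]
  have \<phi>Q[measurable]: "(\<lambda>q. \<phi> (snd q)) \<in> borel_measurable Q" by measurable
  define \<psi> where "\<psi> z = \<phi> z * exp (- (s\<^sup>2 * (Kt\<^sup>2 * (\<phi> z)\<^sup>2)))" for z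
  have \<psi>: "\<psi> \<in> borel_measurable (Rvec d)" unfolding \<psi>_def by measurable
  have \<psi>b: "\<bar>\<psi> z\<bar> \<le> b" if "z \<in> space (Rvec d)" for z
  proof -
    have "\<bar>\<psi> z\<bar> \<le> \<bar>\<phi> z\<bar> * 1" unfolding \<psi>_def abs_mult by (intro mult_left_mono) auto
    then show ?thesis using b[OF that] by simp
  qed
  note o = xt_orthogonal[OF j \<psi> \<psi>b]
  have eq: "(xt q j * \<phi> (snd q)) * exp (- (s\<^sup>2 * (Kt\<^sup>2 * (\<phi> (snd q))\<^sup>2))) = \<psi> (snd q) * xt q j" for q
    by (simp add: \<psi>_def)
  have "(\<integral>\<^sup>+q. ennreal (exp (s * (xt q j * \<phi> (snd q)) - s\<^sup>2 * (Kt\<^sup>2 * (\<phi> (snd q))\<^sup>2))) \<partial>Q) \<le> 1"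
  proof (rule Q.centred_weighted_mgf)
    show "AE q in Q. (xt q j * \<phi> (snd q))\<^sup>2 \<le> Kt\<^sup>2 * (\<phi> (snd q))\<^sup>2"
      using xt_bounded
    proof eventually_elim
      case (elim q)
      then have "\<bar>xt q j\<bar> \<le> \<bar>Kt\<bar>" using j Kt by auto
      then have "(xt q j)\<^sup>2 \<le> Kt\<^sup>2" by (simp only: abs_le_square_iff)
      then show ?case unfolding power_mult_distrib by (rule mult_right_mono) simp
    qed
  qed (simp_all only: eq o, measurable)
  then show ?thesis by (subst nn_integral_fst_S) measurable
qed

text \<open>The noise is integrated first with the covariates fixed; the Gaussian factor
  \<open>exp (s\<^sup>2 * f\<^sup>2 / 2)\<close> is dominated by the subtracted proxy.\<close>

lemma mgf_noise:
  assumes [measurable]: "f \<in> borel_measurable Q"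
  shows "(\<integral>\<^sup>+w. ennreal (exp (s * (snd w * f (fst w)) - s\<^sup>2 * (f (fst w))\<^sup>2)) \<partial>S) \<le> 1"
proof -
  have "(\<integral>\<^sup>+w. ennreal (exp (s * (snd w * f (fst w)) - s\<^sup>2 * (f (fst w))\<^sup>2)) \<partial>S)
     = (\<integral>\<^sup>+q. \<integral>\<^sup>+e. ennreal (exp (s * (e * f q) - s\<^sup>2 * (f q)\<^sup>2)) \<partial>std_normal_measure \<partial>Q)"
    by (subst N.nn_integral_fst[symmetric]) auto
  also have "\<dots> \<le> (\<integral>\<^sup>+q. 1 \<partial>Q)"
  proof (rule nn_integral_mono)
    fix q
    have "(\<integral>\<^sup>+e. ennreal (exp (s * (e * f q) - s\<^sup>2 * (f q)\<^sup>2)) \<partial>std_normal_measure)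
      = (\<integral>\<^sup>+e. ennreal (exp (- (s\<^sup>2 * (f q)\<^sup>2))) * ennreal (exp ((s * f q) * e)) \<partial>std_normal_measure)"
      by (intro nn_integral_cong) (simp add: exp_add[symmetric] algebra_simps flip: ennreal_mult)
    also have "\<dots> = ennreal (exp (- (s\<^sup>2 * (f q)\<^sup>2))) * ennreal (exp ((s * f q)\<^sup>2 / 2))"
      by (subst nn_integral_cmult) (auto simp: std_normal_mgf)
    also have "\<dots> = ennreal (exp (- (s\<^sup>2 * (f q)\<^sup>2) / 2))"
      by (simp add: exp_add[symmetric] power_mult_distrib flip: ennreal_mult)
    also have "\<dots> \<le> 1" by simp
    finally show "(\<integral>\<^sup>+e. ennreal (exp (s * (e * f q) - s\<^sup>2 * (f q)\<^sup>2)) \<partial>std_normal_measure) \<le> 1" .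
  qed
  finally show ?thesis by (simp add: Q.emeasure_space_1)
qed

lemma mgf_bounded:
  assumes [measurable]: "W \<in> borel_measurable Q"
    and w: "AE q in Q. \<bar>W q\<bar> \<le> w" and zero: "(\<integral>q. W q \<partial>Q) = 0"
  shows "(\<integral>\<^sup>+v. ennreal (exp (s * W (fst v) - s\<^sup>2 * w\<^sup>2)) \<partial>S) \<le> 1"
  using Q.bounded_centred_mgf[OF assms, of s]
  by (subst nn_integral_fst_S) measurable

text \<open>The Chernoff parameter is fixed at 1, and the proxy 2 is chosen large enough for
  \<open>2 * exp (1/2 - 2) \<le> 1\<close>. It yields the crude bound on the mean absolute noise
  that ends the chain of the noise process.\<close>

lemma mgf_abs_noise: "(\<integral>\<^sup>+w. ennreal (exp (1 * \<bar>snd w\<bar> - 1\<^sup>2 * 2)) \<partial>S) \<le> 1"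
proof -
  have "(\<integral>\<^sup>+w. ennreal (exp (1 * \<bar>snd w\<bar> - 1\<^sup>2 * 2)) \<partial>S)
     = (\<integral>\<^sup>+q. \<integral>\<^sup>+e. ennreal (exp (\<bar>e\<bar> - 2)) \<partial>std_normal_measure \<partial>Q)"
    by (subst N.nn_integral_fst[symmetric]) auto
  also have "\<dots> = (\<integral>\<^sup>+e. ennreal (exp (\<bar>e\<bar> - 2)) \<partial>std_normal_measure)"
    by (simp add: Q.emeasure_space_1)
  also have "\<dots> \<le> (\<integral>\<^sup>+e. ennreal (exp (- 2)) * (ennreal (exp (1 * e)) + ennreal (exp ((-1) * e))) \<partial>std_normal_measure)"
  proof (intro nn_integral_mono)
    fix e :: real
    have "exp (\<bar>e\<bar> - 2) = exp (-2) * exp \<bar>e\<bar>" by (simp add: exp_add[symmetric])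
    also have "\<dots> \<le> exp (- 2) * (exp e + exp (- e))" by (intro mult_left_mono) (auto simp: abs_if)
    finally show "ennreal (exp (\<bar>e\<bar> - 2)) \<le> ennreal (exp (- 2)) * (ennreal (exp (1 * e)) + ennreal (exp ((-1) * e)))"
      by (simp add: ennreal_leI flip: ennreal_mult ennreal_plus)
  qed
  also have "\<dots> = ennreal (exp (- 2)) * (ennreal (exp (1 / 2)) + ennreal (exp (1 / 2)))"
    by (subst nn_integral_cmult, measurable) (subst nn_integral_add, auto simp only: std_normal_mgf, simp_all)
  also have "\<dots> = ennreal (2 * exp (- (3 / 2)))"
  proof -
    have "exp (-2) * exp (1/2) = exp (- (3/2) :: real)" by (simp add: exp_add[symmetric])
    then show ?thesis by (simp add: distrib_left flip: ennreal_mult ennreal_plus)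
  qed
  also have "\<dots> \<le> 1"
  proof -
    have "2 \<le> exp (3 / 2 :: real)" using exp_ge_add_one_self[of "3/2::real"] by simp
    then have "2 * exp (- (3 / 2)) \<le> (1::real)" by (simp add: exp_minus field_simps)
    then show ?thesis by (simp add: ennreal_leI flip: ennreal_1)
  qed
  finally show ?thesis .
qed

end

section \<open>Uniform deviation bounds\<close>

text \<open>One constant \<open>c\<close> governs all chained processes. The fourth power in its
  bound covers the square of the Lipschitz constant that chaining asks for as well as the proxies at
  the base level. The two rate conditions balance entropy against \<open>n * \<mu>\<^sup>2\<close>
  at scale \<open>\<mu>\<close> and keep the levels summable.\<close>

locale localized_sample = partial_linear_model +
  fixes n :: nat and \<mu> \<gamma> c A m :: real
  assumes n: "n > 0" and \<mu>: "0 < \<mu>" "\<mu> \<le> 1" and \<gamma>: "0 < \<gamma>" "\<gamma> \<le> 1"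
    and A: "A > 0" and m: "m > 1/2" and C4: "cond_C4 d (marg_z d Q) G J A m"
    and c: "0 < c"
      "c \<le> \<gamma>\<^sup>2 * (1 - 2 powr (- (1 - 1 / (2 * m))))\<^sup>2 / (1296 * (4 * Kb + Kt) ^ 4)"
    and rate: "A * \<mu> powr (-1/m) \<le> c / 4 * (real n * \<mu>\<^sup>2)" "2 * m \<le> c * (real n * \<mu>\<^sup>2)"
begin

text \<open>A common Lipschitz constant in sup-norm: \<open>4 * Kb\<close> for the centred squares,
  \<open>Kt\<close> for the variance proxies of the linear processes.\<close>

definition L :: real where "L = 4 * Kb + Kt"
definition \<eta> :: real where "\<eta> = 1 - 2 powr (- (1 - 1 / (2 * m)))"
definition U :: "((nat \<Rightarrow> real) \<Rightarrow> real) set" where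
  "U = {u\<in>G. L2norm (marg_z d Q) u \<le> \<mu> \<and> Jnorm J u \<le> 1}"

abbreviation M :: "(nat \<Rightarrow> ((nat \<Rightarrow> real) \<times> (nat \<Rightarrow> real)) \<times> real) measure" where
  "M \<equiv> PiM {..<n} (\<lambda>_. S)"

lemma prob_space_S: "prob_space S"
  by unfold_locales

sublocale M: prob_space M by (rule prob_space_PiM) (rule prob_space_S)

lemma L: "5 \<le> L" "4 * Kb \<le> L" "Kt \<le> L"
  using Kb Kt by (auto simp: L_def)

lemma \<eta>: "0 < \<eta>" "\<eta> < 1"
  using m powr_less_one[of 2 "- (1 - 1 / (2 * m))"] by (auto simp: \<eta>_def field_simps)

lemma c_le: "x \<le> 1296 * L ^ 4 \<Longrightarrow> 0 < x \<Longrightarrow> c \<le> \<gamma>\<^sup>2 / x"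
proof -
  assume x: "x \<le> 1296 * L ^ 4" "0 < x"
  have "c \<le> \<gamma>\<^sup>2 * \<eta>\<^sup>2 / (1296 * L ^ 4)" using c by (simp add: \<eta>_def L_def)
  also have "\<dots> \<le> \<gamma>\<^sup>2 * 1 / x"
    using x \<eta> by (intro frac_le mult_left_mono) (auto simp: power_le_one)
  finally show ?thesis by simp
qed

lemma L_powers: "L\<^sup>2 \<le> L ^ 4" "Kb\<^sup>2 \<le> L\<^sup>2" "Kt\<^sup>2 \<le> L\<^sup>2" "Kt ^ 4 \<le> L ^ 4"
  using L Kb Kt by (auto intro!: power_mono power_increasing)

lemma U_G: "u \<in> U \<Longrightarrow> u \<in> G" by (simp add: U_def)

lemma U_measurable: "u \<in> U \<Longrightarrow> u \<in> borel_measurable (Rvec d)"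
  by (intro G_measurable U_G)

lemma U_bounded: "u \<in> U \<Longrightarrow> z \<in> space (Rvec d) \<Longrightarrow> \<bar>u z\<bar> \<le> Kb"
  using G_bounded[of u 1 z] \<mu> by (auto simp: U_def)

lemma U_zero: "(\<lambda>_. 0) \<in> U"
  using Jnorm_scale[OF G J subspace_zero[OF G J], of 0] subspace_zero[OF G J] \<mu>
  by (simp add: U_def L2norm_def)

lemma U_net:
  assumes "0 < r"
  shows "\<exists>N. N \<subseteq> U \<and> finite N \<and> N \<noteq> {} \<and>
        real (card N) \<le> exp (A * r powr (-1/m)) \<and> (\<forall>g\<in>U. \<exists>f\<in>N. sup_dist_le d g f (2 * r))"
proof (rule inner_net)
  show "sup_entropy_le d G (unit_ball (marg_z d Q) G J) r (A * r powr (-1/m))"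
    using C4 assms unfolding cond_C4_def by blast
  show "U \<subseteq> unit_ball (marg_z d Q) G J" using \<mu> by (auto simp: U_def unit_ball_def)
  show "U \<noteq> {}" using U_zero by blast
qed

lemma component_measurable: "i < n \<Longrightarrow> f \<in> borel_measurable S \<Longrightarrow> (\<lambda>\<omega>. f (\<omega> i)) \<in> borel_measurable M"
  for f :: "_ \<Rightarrow> real"
  by (rule measurable_compose[OF measurable_component_singleton[of i "{..<n}" "\<lambda>_. S"]]) auto

lemma sum_measurable: "f \<in> borel_measurable S \<Longrightarrow> (\<lambda>\<omega>. \<Sum>i<n. f (\<omega> i)) \<in> borel_measurable M"
  for f :: "_ \<Rightarrow> real"
  by (intro borel_measurable_sum component_measurable) auto

lemma mean_measurable: "f \<in> borel_measurable S \<Longrightarrow> (\<lambda>\<omega>. (\<Sum>i<n. f (\<omega> i)) / real n) \<in> borel_measurable M"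
  for f :: "_ \<Rightarrow> real"
  by (intro borel_measurable_divide sum_measurable borel_measurable_const)

lemma fst_S: "i < n \<Longrightarrow> \<omega> \<in> space M \<Longrightarrow> fst (\<omega> i) \<in> space Q"
  by (force simp: space_PiM space_pair_measure PiE_iff)

lemma abs_mean_le:
  assumes "\<And>i. i < n \<Longrightarrow> \<bar>f i\<bar> \<le> b"
  shows "\<bar>(\<Sum>i<n. f i) / real n\<bar> \<le> b"
proof -
  have "\<bar>\<Sum>i<n. f i\<bar> \<le> (\<Sum>i<n. \<bar>f i\<bar>)" by (rule sum_abs)
  also have "\<dots> \<le> real n * b" using assms by (intro order_trans[OF sum_bounded_above[of _ _ b]]) auto
  finally show ?thesis using n by (simp add: field_simps abs_mult)
qed

lemma sum_le_n: "(\<And>i. i < n \<Longrightarrow> f i \<le> b) \<Longrightarrow> (\<Sum>i<n. f i) \<le> real n * b" for f :: "nat \<Rightarrow> real"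
  by (intro order_trans[OF sum_bounded_above[of _ _ b]]) auto

lemma sup_dist_leD: "sup_dist_le d a b r \<Longrightarrow> z \<in> space (Rvec d) \<Longrightarrow> \<bar>a z - b z\<bar> \<le> r"
  by (simp add: sup_dist_le_def)

text \<open>Only the base points use the small variance \<open>\<mu>\<^sup>2\<close>. For the links
  the sup-norm bound on the increments suffices, because their radius shrinks with the level. No
  prior event is imposed, and the result supplies the empirical norms that the linear processes rely
  on.\<close>

lemma quadratic_event:
  "\<exists>E\<in>sets M. M.prob (space M - E) \<le> 4 * exp (- (c * real n * \<mu>\<^sup>2 / 2)) \<and>
     (\<forall>\<omega>\<in>E. \<forall>u\<in>U. \<bar>(\<Sum>i<n. (u (Zs \<omega> i))\<^sup>2) / real n - (L2norm (marg_z d Q) u)\<^sup>2\<bar> \<le> \<gamma> * \<mu>\<^sup>2)"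
proof -
  define e where "e u = (\<integral>q. (u (snd q))\<^sup>2 \<partial>Q)" for u :: "(nat \<Rightarrow> real) \<Rightarrow> real"
  define W where "W u q = (u (snd q))\<^sup>2 - e u" for u :: "(nat \<Rightarrow> real) \<Rightarrow> real" and q :: "(nat \<Rightarrow> real) \<times> (nat \<Rightarrow> real)"
  define Z where "Z u \<omega> = (\<Sum>i<n. W u (fst (\<omega> i))) / real n"
    for u and \<omega> :: "nat \<Rightarrow> ((nat \<Rightarrow> real) \<times> (nat \<Rightarrow> real)) \<times> real"
  have uQ: "(\<lambda>q. u (snd q)) \<in> borel_measurable Q" if "u \<in> U" for u
    using U_measurable[OF that] by measurable
  have WQ: "W u \<in> borel_measurable Q" if "u \<in> U" for u
    unfolding W_def using uQ[OF that] by measurable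
  have WS: "(\<lambda>w. W u (fst w)) \<in> borel_measurable S" if "u \<in> U" for u
    by (rule measurable_compose[OF measurable_fst WQ[OF that]])
  have i2: "integrable Q (\<lambda>q. (u (snd q))\<^sup>2)" if u: "u \<in> U" for u
  proof (rule Q.integrable_const_bound[of _ "Kb\<^sup>2"])
    show "AE q in Q. norm ((u (snd q))\<^sup>2) \<le> Kb\<^sup>2"
    proof (rule AE_I2)
      fix q assume "q \<in> space Q"
      then have "\<bar>u (snd q)\<bar> \<le> Kb" using U_bounded[OF u snd_space] by blast
      from power_mono[OF this, of 2] show "norm ((u (snd q))\<^sup>2) \<le> Kb\<^sup>2" by simp
    qed
  qed (use uQ[OF u] in measurable)
  have eL: "e u = (L2norm (marg_z d Q) u)\<^sup>2" if "u \<in> U" for u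
    using U_measurable[OF that] by (simp add: e_def L2norm_square integral_marg)
  have e\<mu>: "e u \<le> \<mu>\<^sup>2" if "u \<in> U" for u
    using that L2norm_nonneg[of "marg_z d Q" u] by (auto simp: eL U_def intro!: power_mono)
  have W0: "(\<integral>q. W u q \<partial>Q) = 0" if "u \<in> U" for u
    using i2[OF that] by (simp add: W_def e_def Q.prob_space)
  have iW: "integrable Q (W u)" if "u \<in> U" for u
    unfolding W_def using i2[OF that] by simp
  have sqd: "\<bar>(a (snd q))\<^sup>2 - (b (snd q))\<^sup>2\<bar> \<le> 2 * Kb * r"
    if ab: "a \<in> U" "b \<in> U" "sup_dist_le d a b r" and q: "q \<in> space Q" for a b r q
  proof -
    have "\<bar>a (snd q)\<bar> \<le> Kb" "\<bar>b (snd q)\<bar> \<le> Kb" "\<bar>a (snd q) - b (snd q)\<bar> \<le> r"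
      using U_bounded[OF _ snd_space[OF q]] sup_dist_leD[OF ab(3) snd_space[OF q]] ab by auto
    moreover from this have "\<bar>a (snd q) + b (snd q)\<bar> \<le> 2 * Kb" by linarith
    ultimately have "\<bar>a (snd q) + b (snd q)\<bar> * \<bar>a (snd q) - b (snd q)\<bar> \<le> (2 * Kb) * r"
      using Kb by (intro mult_mono) auto
    then show ?thesis by (simp add: power2_eq_square square_diff_square_factored abs_mult)
  qed
  have Wd: "\<bar>W a q - W b q\<bar> \<le> L * r"
    if ab: "a \<in> U" "b \<in> U" "sup_dist_le d a b r" and r: "0 < r" and q: "q \<in> space Q" for a b r q
  proof -
    have "e a - e b = (\<integral>q. (a (snd q))\<^sup>2 - (b (snd q))\<^sup>2 \<partial>Q)"
      using i2 ab by (simp add: e_def)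
    also have "\<bar>\<dots>\<bar> \<le> (\<integral>q. \<bar>(a (snd q))\<^sup>2 - (b (snd q))\<^sup>2\<bar> \<partial>Q)"
      by (rule integral_abs_bound)
    also have "\<dots> \<le> (\<integral>q. 2 * Kb * r \<partial>Q)"
      using i2 ab sqd[OF ab] by (intro integral_mono) auto
    finally have "\<bar>e a - e b\<bar> \<le> 2 * Kb * r" by (simp add: Q.prob_space)
    moreover have "\<bar>(a (snd q))\<^sup>2 - (b (snd q))\<^sup>2\<bar> \<le> 2 * Kb * r" by (rule sqd[OF ab q])
    ultimately have "\<bar>W a q - W b q\<bar> \<le> 4 * Kb * r" by (simp add: W_def)
    also have "\<dots> \<le> L * r" using L r by (intro mult_right_mono) auto
    finally show ?thesis .
  qed
  have "\<exists>E\<in>sets M. E \<subseteq> space M \<and> M.prob (space M - E) \<le> 4 * exp (- (c * real n * \<mu>\<^sup>2 / 2)) \<and>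
           (\<forall>\<omega>\<in>E. \<forall>u\<in>U. \<bar>Z u \<omega>\<bar> \<le> \<gamma> * \<mu> * \<mu>)"
  proof (rule chaining[where Z = Z and L = L and A = A and m = m and d = d and \<eta> = \<eta>])
    show "Z u \<in> borel_measurable M" if "u \<in> U" for u
      unfolding Z_def by (rule mean_measurable[OF WS[OF that]])
  next
    fix u assume u: "u \<in> U"
    \<comment> \<open>The maximiser of
      \<open>s * t - s\<^sup>2 * (Kb\<^sup>2 * \<mu>\<^sup>2)\<close> at
      \<open>t = \<gamma> * \<mu>\<^sup>2 / 3\<close>. It does not depend on \<open>\<mu>\<close>,
      and \<open>\<gamma> \<le> 1\<close> keeps it in the range allowed by
      \<open>bernstein_mgf\<close>.\<close>
    let ?s = "\<gamma> / (6 * Kb\<^sup>2)"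
    have s: "\<bar>?s\<bar> * Kb\<^sup>2 \<le> 1" using \<gamma> Kb by simp
    have e2: "(\<integral>q. (u (snd q))\<^sup>2 \<partial>Q) \<le> \<mu>\<^sup>2" using e\<mu>[OF u] by (simp add: e_def)
    have mgf: "(\<integral>\<^sup>+w. ennreal (exp (s * W u (fst w) - s\<^sup>2 * (Kb\<^sup>2 * \<mu>\<^sup>2))) \<partial>S) \<le> 1"
      if "\<bar>s\<bar> * Kb\<^sup>2 \<le> 1" for s
    proof -
      have "(\<integral>\<^sup>+q. ennreal (exp (s * W u q - s\<^sup>2 * (Kb\<^sup>2 * \<mu>\<^sup>2))) \<partial>Q) \<le> 1"
        using Q.bernstein_mgf[OF uQ[OF u] U_bounded[OF u snd_space] that e2]
        unfolding W_def e_def .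
      moreover note [measurable] = WQ[OF u]
      ultimately show ?thesis by (subst nn_integral_fst_S) measurable
    qed
    let ?t = "\<gamma> * \<mu> * \<mu> / 3"
    have "M.prob {\<omega>\<in>space M. \<omega> \<in> space M \<and> \<bar>Z u \<omega>\<bar> > ?t}
      \<le> M.prob {\<omega>\<in>space M. \<bar>\<Sum>i<n. W u (fst (\<omega> i))\<bar> \<ge> real n * ?t \<and> (\<Sum>i<n. Kb\<^sup>2 * \<mu>\<^sup>2) \<le> real n * (Kb\<^sup>2 * \<mu>\<^sup>2)}"
      using n WS[OF u] by (intro M.finite_measure_mono) (auto simp: Z_def field_simps abs_mult)
    also have "\<dots> \<le> 2 * exp (- (real n * (?s * ?t - ?s\<^sup>2 * (Kb\<^sup>2 * \<mu>\<^sup>2))))"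
      using mgf[of ?s] mgf[of "- ?s"] s \<gamma> WS[OF u]
      by (intro iid_abs_sum_tail[where W = "\<lambda>w. W u (fst w)" and D = "\<lambda>_. Kb\<^sup>2 * \<mu>\<^sup>2"] prob_space_S) auto
    also have "?s * ?t - ?s\<^sup>2 * (Kb\<^sup>2 * \<mu>\<^sup>2) = \<gamma>\<^sup>2 / (36 * Kb\<^sup>2) * \<mu>\<^sup>2"
      using Kb by (simp add: field_simps power2_eq_square)
    also have "2 * exp (- (real n * (\<gamma>\<^sup>2 / (36 * Kb\<^sup>2) * \<mu>\<^sup>2))) \<le> 2 * exp (- (c * real n * \<mu>\<^sup>2))"
    proof -
      have "36 * Kb\<^sup>2 \<le> 1296 * L ^ 4" using L_powers Kb
        by (intro mult_mono) auto
      then have "c * (real n * \<mu>\<^sup>2) \<le> \<gamma>\<^sup>2 / (36 * Kb\<^sup>2) * (real n * \<mu>\<^sup>2)"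
        using Kb by (intro mult_right_mono c_le) auto
      then show ?thesis by (simp add: mult_ac)
    qed
    finally show "M.prob {\<omega>\<in>space M. \<omega> \<in> space M \<and> \<bar>Z u \<omega>\<bar> > ?t} \<le> 2 * exp (- (c * real n * \<mu>\<^sup>2))" .
  next
    fix a b r t :: _ assume ab: "a \<in> U" "b \<in> U" "sup_dist_le d a b r" and r: "0 < r" and t: "0 < (t::real)"
    let ?W = "\<lambda>q. W a q - W b q"
    have "(\<integral>q. ?W q \<partial>Q) = 0" using W0 iW ab by simp
    moreover have [measurable]: "?W \<in> borel_measurable Q" using WQ ab by measurable
    ultimately have mgf: "(\<integral>\<^sup>+w. ennreal (exp (s * ?W (fst w) - s\<^sup>2 * (L * r)\<^sup>2)) \<partial>S) \<le> 1" for s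
      using Wd[OF ab r] by (intro mgf_bounded) auto
    have "{\<omega>\<in>space M. \<bar>Z a \<omega> - Z b \<omega>\<bar> > t}
        = {\<omega>\<in>space M. \<bar>(\<Sum>i<n. ?W (fst (\<omega> i))) / real n\<bar> > t \<and> (\<Sum>i<n. (L * r)\<^sup>2) \<le> real n * (L * r)\<^sup>2}"
      by (simp add: Z_def diff_divide_distrib[symmetric] sum_subtractf)
    also have "M.prob \<dots> \<le> 2 * exp (- (real n * t\<^sup>2 / (4 * (L * r)\<^sup>2)))"
      using n t r L mgf by (intro iid_mean_tail[where W = "\<lambda>w. ?W (fst w)" and D = "\<lambda>_. (L * r)\<^sup>2"] prob_space_S) auto
    finally show "M.prob {\<omega>\<in>space M. \<bar>Z a \<omega> - Z b \<omega>\<bar> > t} \<le> 2 * exp (- (real n * t\<^sup>2 / (4 * L\<^sup>2 * r\<^sup>2)))"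
      by (simp add: power_mult_distrib mult.assoc)
  next
    fix a b r \<omega> assume ab: "a \<in> U" "b \<in> U" "sup_dist_le d a b r" and r: "0 < r" and \<omega>: "\<omega> \<in> space M"
    have "\<bar>Z a \<omega> - Z b \<omega>\<bar> = \<bar>(\<Sum>i<n. W a (fst (\<omega> i)) - W b (fst (\<omega> i))) / real n\<bar>"
      by (simp add: Z_def diff_divide_distrib[symmetric] sum_subtractf)
    also have "\<dots> \<le> L * r" using Wd[OF ab r fst_S[OF _ \<omega>]] by (rule abs_mean_le)
    also have "\<dots> \<le> 4 * L * r" using L r by simp
    finally show "\<bar>Z a \<omega> - Z b \<omega>\<bar> \<le> 4 * L * r" .
  next
    have "L\<^sup>2 * 1 \<le> L ^ 4" using L_powers by simp
    then have "\<gamma>\<^sup>2 * \<eta>\<^sup>2 / (1296 * L ^ 4) \<le> \<gamma>\<^sup>2 * \<eta>\<^sup>2 / (1296 * L\<^sup>2)"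
      using L by (intro divide_left_mono) auto
    then show "c \<le> \<gamma>\<^sup>2 * \<eta>\<^sup>2 / (1296 * L\<^sup>2)" 
      using c(2) unfolding L_def[symmetric] \<eta>_def[symmetric] by linarith
  qed (use U_net M.prob_space_axioms m A L \<gamma> \<mu> c n rate in \<open>simp_all add: \<eta>_def\<close>)
  then obtain E where E: "E \<in> sets M" "M.prob (space M - E) \<le> 4 * exp (- (c * real n * \<mu>\<^sup>2 / 2))"
    "\<And>\<omega> u. \<omega> \<in> E \<Longrightarrow> u \<in> U \<Longrightarrow> \<bar>Z u \<omega>\<bar> \<le> \<gamma> * \<mu> * \<mu>" by blast
  have "Z u \<omega> = (\<Sum>i<n. (u (Zs \<omega> i))\<^sup>2) / real n - (L2norm (marg_z d Q) u)\<^sup>2" if "u \<in> U" for u \<omega>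
    using n by (simp add: Z_def W_def Zs_def sum_subtractf eL[OF that] diff_divide_distrib)
  then show ?thesis using E by (intro bexI[of _ E]) (auto simp: power2_eq_square mult.assoc)
qed

text \<open>Stated for a general weight \<open>w\<close> so that noise and design columns share one
  proof. At a base point the random proxy is controlled by \<open>B\<close> through the empirical
  norm of \<open>u\<close>; on a link the sup-distance bounds the proxy surely; the bound on the
  mean of \<open>w\<close> in absolute value handles the remainder of the chain.\<close>

lemma linear_event:
  assumes w: "w \<in> borel_measurable S"
    and mgf: "\<And>\<phi> b s. \<phi> \<in> borel_measurable (Rvec d) \<Longrightarrow> (\<And>z. z \<in> space (Rvec d) \<Longrightarrow> \<bar>\<phi> z\<bar> \<le> b) \<Longrightarrow>
      (\<integral>\<^sup>+v. ennreal (exp (s * (w v * \<phi> (snd (fst v))) - s\<^sup>2 * (Kt\<^sup>2 * (\<phi> (snd (fst v)))\<^sup>2))) \<partial>S) \<le> 1"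
    and B: "B \<in> sets M"
    and Bw: "\<And>\<omega>. \<omega> \<in> B \<Longrightarrow> (\<Sum>i<n. \<bar>w (\<omega> i)\<bar>) \<le> real n * (4 * L)"
    and Bu: "\<And>\<omega> u. \<omega> \<in> B \<Longrightarrow> u \<in> U \<Longrightarrow> (\<Sum>i<n. (u (Zs \<omega> i))\<^sup>2) \<le> real n * (2 * \<mu>\<^sup>2)"
    and \<rho>: "\<mu> \<le> \<rho>"
  shows "\<exists>E\<in>sets M. E \<subseteq> B \<and> M.prob (B - E) \<le> 4 * exp (- (c * real n * \<rho>\<^sup>2 / 2)) \<and>
     (\<forall>\<omega>\<in>E. \<forall>u\<in>U. \<bar>(\<Sum>i<n. w (\<omega> i) * u (Zs \<omega> i)) / real n\<bar> \<le> \<gamma> * \<mu> * \<rho>)"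
proof -
  note [measurable] = w
  define Z where "Z u \<omega> = (\<Sum>i<n. w (\<omega> i) * u (snd (fst (\<omega> i)))) / real n"
    for u :: "(nat \<Rightarrow> real) \<Rightarrow> real" and \<omega> :: "nat \<Rightarrow> ((nat \<Rightarrow> real) \<times> (nat \<Rightarrow> real)) \<times> real"
  have \<phi>S: "(\<lambda>v. \<phi> (snd (fst v))) \<in> borel_measurable S" if "\<phi> \<in> borel_measurable (Rvec d)"
    for \<phi> :: "(nat \<Rightarrow> real) \<Rightarrow> real"
    using that by measurable
  have W: "(\<lambda>v. w v * \<phi> (snd (fst v))) \<in> borel_measurable S" if "\<phi> \<in> borel_measurable (Rvec d)"
    for \<phi> :: "(nat \<Rightarrow> real) \<Rightarrow> real"
    by (intro borel_measurable_times w \<phi>S that)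
  have D: "(\<lambda>v. Kt\<^sup>2 * (\<phi> (snd (fst v)))\<^sup>2) \<in> borel_measurable S" if "\<phi> \<in> borel_measurable (Rvec d)"
    for \<phi> :: "(nat \<Rightarrow> real) \<Rightarrow> real"
    by (intro borel_measurable_times borel_measurable_const borel_measurable_power \<phi>S that)
  have Zm: "Z u \<in> borel_measurable M" if "u \<in> U" for u
    unfolding Z_def by (rule mean_measurable[OF W[OF U_measurable[OF that]]])
  have "\<exists>E\<in>sets M. E \<subseteq> B \<and> M.prob (B - E) \<le> 4 * exp (- (c * real n * \<rho>\<^sup>2 / 2)) \<and>
           (\<forall>\<omega>\<in>E. \<forall>u\<in>U. \<bar>Z u \<omega>\<bar> \<le> \<gamma> * \<mu> * \<rho>)"
  proof (rule chaining[where Z = Z and L = L and A = A and m = m and d = d and \<eta> = \<eta>])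
    fix u assume u: "u \<in> U"
    note um = U_measurable[OF u]
    let ?t = "\<gamma> * \<mu> * \<rho> / 3" and ?v = "2 * Kt\<^sup>2 * \<mu>\<^sup>2"
    have "M.prob {\<omega>\<in>space M. \<omega> \<in> B \<and> \<bar>Z u \<omega>\<bar> > ?t}
      \<le> M.prob {\<omega>\<in>space M. \<bar>(\<Sum>i<n. w (\<omega> i) * u (snd (fst (\<omega> i)))) / real n\<bar> > ?t \<and>
           (\<Sum>i<n. Kt\<^sup>2 * (u (snd (fst (\<omega> i))))\<^sup>2) \<le> real n * ?v}"
    proof (rule M.finite_measure_mono)
      show "{\<omega>\<in>space M. \<omega> \<in> B \<and> \<bar>Z u \<omega>\<bar> > ?t}
        \<subseteq> {\<omega>\<in>space M. \<bar>(\<Sum>i<n. w (\<omega> i) * u (snd (fst (\<omega> i)))) / real n\<bar> > ?t \<and>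
           (\<Sum>i<n. Kt\<^sup>2 * (u (snd (fst (\<omega> i))))\<^sup>2) \<le> real n * ?v}"
      proof safe
        fix \<omega> assume "\<omega> \<in> B"
        from mult_left_mono[OF Bu[OF this u], of "Kt\<^sup>2"]
        show "(\<Sum>i<n. Kt\<^sup>2 * (u (snd (fst (\<omega> i))))\<^sup>2) \<le> real n * ?v"
          by (simp add: Zs_def sum_distrib_left mult_ac)
      qed (simp add: Z_def)
      have "(\<lambda>\<omega>. \<Sum>i<n. Kt\<^sup>2 * (u (snd (fst (\<omega> i))))\<^sup>2) \<in> borel_measurable M"
        by (rule sum_measurable[OF D[OF um]])
      then show "{\<omega>\<in>space M. \<bar>(\<Sum>i<n. w (\<omega> i) * u (snd (fst (\<omega> i)))) / real n\<bar> > ?t \<and>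
           (\<Sum>i<n. Kt\<^sup>2 * (u (snd (fst (\<omega> i))))\<^sup>2) \<le> real n * ?v} \<in> sets M"
        using Zm[OF u] unfolding Z_def by measurable
    qed
    also have "\<dots> \<le> 2 * exp (- (real n * ?t\<^sup>2 / (4 * ?v)))"
      using n \<mu> \<gamma> \<rho> Kt
      by (intro iid_mean_tail[where W = "\<lambda>v. w v * u (snd (fst v))" and D = "\<lambda>v. Kt\<^sup>2 * (u (snd (fst v)))\<^sup>2"]
          prob_space_S W D um mgf[OF um U_bounded[OF u]]) auto
    \<comment> \<open>The \<open>\<mu>\<close> in the tolerance cancels against the
      \<open>\<mu>\<close> in the standard deviation, which leaves the exponent
      \<open>n * \<rho>\<^sup>2\<close>.\<close>
    also have "real n * ?t\<^sup>2 / (4 * ?v) = \<gamma>\<^sup>2 / (72 * Kt\<^sup>2) * (real n * \<rho>\<^sup>2)"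
      using \<mu> Kt by (simp add: field_simps power2_eq_square)
    also have "2 * exp (- (\<gamma>\<^sup>2 / (72 * Kt\<^sup>2) * (real n * \<rho>\<^sup>2))) \<le> 2 * exp (- (c * real n * \<rho>\<^sup>2))"
    proof -
      have "72 * Kt\<^sup>2 \<le> 1296 * L ^ 4" using L_powers Kt by (intro mult_mono) auto
      then have "c * (real n * \<rho>\<^sup>2) \<le> \<gamma>\<^sup>2 / (72 * Kt\<^sup>2) * (real n * \<rho>\<^sup>2)"
        using Kt by (intro mult_right_mono c_le) auto
      then show ?thesis by (simp add: mult_ac)
    qed
    finally show "M.prob {\<omega>\<in>space M. \<omega> \<in> B \<and> \<bar>Z u \<omega>\<bar> > ?t} \<le> 2 * exp (- (c * real n * \<rho>\<^sup>2))" .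
  next
    fix a b r t :: _ assume ab: "a \<in> U" "b \<in> U" "sup_dist_le d a b r" and r: "0 < r" and t: "0 < (t::real)"
    let ?\<phi> = "\<lambda>z. a z - b z"
    have \<phi>: "?\<phi> \<in> borel_measurable (Rvec d)" using U_measurable[OF ab(1)] U_measurable[OF ab(2)]
      by (rule borel_measurable_diff)
    have \<phi>r: "\<bar>?\<phi> z\<bar> \<le> r" if "z \<in> space (Rvec d)" for z by (rule sup_dist_leD[OF ab(3) that])
    let ?A = "{\<omega>\<in>space M. \<bar>(\<Sum>i<n. w (\<omega> i) * ?\<phi> (snd (fst (\<omega> i)))) / real n\<bar> > t \<and>
        (\<Sum>i<n. Kt\<^sup>2 * (?\<phi> (snd (fst (\<omega> i))))\<^sup>2) \<le> real n * (L * r)\<^sup>2}"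
    have "{\<omega>\<in>space M. \<bar>Z a \<omega> - Z b \<omega>\<bar> > t} = ?A"
    proof -
      have "(\<Sum>i<n. Kt\<^sup>2 * (?\<phi> (snd (fst (\<omega> i))))\<^sup>2) \<le> real n * (L * r)\<^sup>2" if \<omega>: "\<omega> \<in> space M" for \<omega>
      proof (rule sum_le_n)
        fix i assume i: "i < n"
        have "\<bar>?\<phi> (snd (fst (\<omega> i)))\<bar> \<le> r" by (rule \<phi>r[OF snd_space[OF fst_S[OF i \<omega>]]])
        from power_mono[OF this, of 2] have "(?\<phi> (snd (fst (\<omega> i))))\<^sup>2 \<le> r\<^sup>2" by simp
        then show "Kt\<^sup>2 * (?\<phi> (snd (fst (\<omega> i))))\<^sup>2 \<le> (L * r)\<^sup>2"
          unfolding power_mult_distrib using L_powers by (intro mult_mono) auto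
      qed
      then show ?thesis
        by (auto simp: Z_def diff_divide_distrib[symmetric] sum_subtractf right_diff_distrib)
    qed
    also have "M.prob ?A \<le> 2 * exp (- (real n * t\<^sup>2 / (4 * (L * r)\<^sup>2)))"
      using n t r L
      by (intro iid_mean_tail[where W = "\<lambda>v. w v * ?\<phi> (snd (fst v))" and D = "\<lambda>v. Kt\<^sup>2 * (?\<phi> (snd (fst v)))\<^sup>2"]
          prob_space_S W[OF \<phi>] D[OF \<phi>] mgf[OF \<phi> \<phi>r]) auto
    finally show "M.prob {\<omega>\<in>space M. \<bar>Z a \<omega> - Z b \<omega>\<bar> > t} \<le> 2 * exp (- (real n * t\<^sup>2 / (4 * L\<^sup>2 * r\<^sup>2)))"
      by (simp add: power_mult_distrib mult.assoc)
  next
    fix a b r \<omega> assume ab: "a \<in> U" "b \<in> U" "sup_dist_le d a b r" and r: "0 < r" and \<omega>: "\<omega> \<in> B"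
    have \<omega>M: "\<omega> \<in> space M" using sets.sets_into_space[OF B] \<omega> by blast
    have "Z a \<omega> - Z b \<omega> = (\<Sum>i<n. w (\<omega> i) * (a (snd (fst (\<omega> i))) - b (snd (fst (\<omega> i))))) / real n"
      by (simp add: Z_def diff_divide_distrib[symmetric] sum_subtractf right_diff_distrib)
    also have "\<bar>\<dots>\<bar> \<le> (\<Sum>i<n. \<bar>w (\<omega> i)\<bar> * r) / real n"
      unfolding abs_divide abs_of_nat
      by (intro divide_right_mono order_trans[OF sum_abs] sum_mono)
        (auto simp: abs_mult intro!: mult_left_mono sup_dist_leD[OF ab(3)] snd_space fst_S \<omega>M)
    also have "\<dots> = (\<Sum>i<n. \<bar>w (\<omega> i)\<bar>) / real n * r" by (simp add: sum_distrib_right)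
    also have "\<dots> \<le> 4 * L * r"
      using Bw[OF \<omega>] n r by (intro mult_right_mono) (auto simp: field_simps)
    finally show "\<bar>Z a \<omega> - Z b \<omega>\<bar> \<le> 4 * L * r" .
  next
    have "L\<^sup>2 * 1 \<le> L ^ 4" using L_powers by simp
    then have "\<gamma>\<^sup>2 * \<eta>\<^sup>2 / (1296 * L ^ 4) \<le> \<gamma>\<^sup>2 * \<eta>\<^sup>2 / (1296 * L\<^sup>2)"
      using L by (intro divide_left_mono) auto
    then show "c \<le> \<gamma>\<^sup>2 * \<eta>\<^sup>2 / (1296 * L\<^sup>2)"
      using c(2) unfolding L_def[symmetric] \<eta>_def[symmetric] by linarith
  qed (use U_net M.prob_space_axioms m A L \<gamma> \<mu> c n rate B \<rho> Zm in \<open>simp_all add: \<eta>_def\<close>)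
  then show ?thesis unfolding Z_def Zs_def .
qed

text \<open>(C2) is an almost sure statement; on this event of full measure it holds at every sample
  point.\<close>

definition bounded_design :: "(nat \<Rightarrow> ((nat \<Rightarrow> real) \<times> (nat \<Rightarrow> real)) \<times> real) set" where
  "bounded_design = {\<omega>\<in>space M. \<forall>i\<in>{..<n}. \<forall>j\<in>{..<p}. \<bar>xt (fst (\<omega> i)) j\<bar> \<le> Kt}"

lemma xt_measurable: "j < p \<Longrightarrow> (\<lambda>q. xt q j) \<in> borel_measurable Q"
  by (intro borel_measurable_diff x_measurable h_snd_measurable)

lemma xt_fst_measurable: "j < p \<Longrightarrow> (\<lambda>v. xt (fst v) j) \<in> borel_measurable S"
  by (rule measurable_compose[OF measurable_fst xt_measurable])

lemma bounded_design_sets: "bounded_design \<in> sets M"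
proof -
  have [measurable]: "(\<lambda>\<omega>. xt (fst (\<omega> i)) j) \<in> borel_measurable M" if "i < n" "j < p" for i j
    by (rule component_measurable[OF that(1) xt_fst_measurable[OF that(2)]])
  show ?thesis unfolding bounded_design_def
    by (intro sets.sets_Collect_finite_All borel_measurable_le borel_measurable_abs borel_measurable_const) auto
qed

lemma bounded_design_prob: "M.prob (space M - bounded_design) = 0"
proof -
  have "AE q in distr S Q fst. \<forall>j<p. \<bar>xt q j\<bar> \<le> Kt"
    by (subst N.distr_pair_fst) (rule xt_bounded)
  then have "AE v in S. \<forall>j<p. \<bar>xt (fst v) j\<bar> \<le> Kt"
    by (rule AE_distrD[rotated]) (rule measurable_fst)
  then have "AE \<omega> in M. \<forall>i\<in>{..<n}. \<forall>j<p. \<bar>xt (fst (\<omega> i)) j\<bar> \<le> Kt"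
    by (intro AE_finite_allI AE_PiM_component[where P = "\<lambda>v. \<forall>j<p. \<bar>xt (fst v) j\<bar> \<le> Kt"] prob_space_S) auto
  then have "AE \<omega> in M. \<omega> \<in> bounded_design"
    using AE_space by eventually_elim (auto simp: bounded_design_def)
  then have "M.prob bounded_design = 1" using M.prob_eq_1[OF bounded_design_sets] by simp
  then show ?thesis using M.prob_compl[OF bounded_design_sets] by simp
qed

lemma bounded_designD: "\<omega> \<in> bounded_design \<Longrightarrow> i < n \<Longrightarrow> j < p \<Longrightarrow> \<bar>xt (fst (\<omega> i)) j\<bar> \<le> Kt"
  by (simp add: bounded_design_def)

lemma noise_event:
  "\<exists>E\<in>sets M. M.prob (space M - E) \<le> exp (- real n) \<and> (\<forall>\<omega>\<in>E. (\<Sum>i<n. \<bar>snd (\<omega> i)\<bar>) \<le> real n * (4 * L))"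
proof -
  let ?A = "{\<omega>\<in>space M. (\<Sum>i<n. \<bar>snd (\<omega> i)\<bar>) \<ge> real n * 3 \<and> (\<Sum>i<n. 2) \<le> real n * 2}"
  have "snd \<in> S \<rightarrow>\<^sub>M std_normal_measure" by (rule measurable_snd)
  then have e: "(\<lambda>v. \<bar>snd v\<bar>) \<in> borel_measurable S"
    by (intro borel_measurable_abs) (simp cong: measurable_cong_sets)
  have [measurable]: "(\<lambda>\<omega>. \<Sum>i<n. \<bar>snd (\<omega> i)\<bar>) \<in> borel_measurable M"
    by (rule sum_measurable[OF e])
  have A: "?A \<in> sets M" by measurable
  have "M.prob ?A \<le> exp (- (real n * (1 * 3 - 1\<^sup>2 * 2)))"
    using mgf_abs_noise e by (intro iid_sum_tail[where W = "\<lambda>v. \<bar>snd v\<bar>" and D = "\<lambda>_. 2"] prob_space_S) auto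
  moreover have "space M - (space M - ?A) = ?A" by auto
  moreover have "(\<Sum>i<n. \<bar>snd (\<omega> i)\<bar>) \<le> real n * (4 * L)" if "\<omega> \<in> space M - ?A" for \<omega>
  proof -
    have "(\<Sum>i<n. \<bar>snd (\<omega> i)\<bar>) \<le> real n * 3" using that by auto
    also have "\<dots> \<le> real n * (4 * L)" using L by (intro mult_left_mono) auto
    finally show ?thesis .
  qed
  ultimately show ?thesis using A by (intro bexI[of _ "space M - ?A"]) auto
qed

lemma covariance_tail:
  assumes j: "j < p" "k < p" and \<nu>: "0 \<le> \<nu>"
  shows "M.prob {\<omega>\<in>space M. \<bar>(\<Sum>i<n. xt (fst (\<omega> i)) j * xt (fst (\<omega> i)) k - Sigma_xtilde Q h j k) / real n\<bar> > \<nu>}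
    \<le> 2 * exp (- (real n * \<nu>\<^sup>2 / (16 * Kt ^ 4)))"
proof -
  let ?W = "\<lambda>q. xt q j * xt q k - Sigma_xtilde Q h j k"
  have Wm: "?W \<in> borel_measurable Q"
    by (intro borel_measurable_diff[OF borel_measurable_times] xt_measurable j borel_measurable_const)
  have b: "AE q in Q. \<bar>xt q j * xt q k\<bar> \<le> Kt\<^sup>2"
    using xt_bounded
  proof eventually_elim
    case (elim q)
    then have "\<bar>xt q j\<bar> * \<bar>xt q k\<bar> \<le> Kt * Kt" using j Kt by (intro mult_mono) auto
    then show ?case by (simp add: abs_mult power2_eq_square)
  qed
  have int: "integrable Q (\<lambda>q. xt q j * xt q k)"
    by (rule Q.integrable_const_bound[of _ "Kt\<^sup>2"])
      (use b in simp, intro borel_measurable_times xt_measurable j)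
  have "\<bar>Sigma_xtilde Q h j k\<bar> \<le> (\<integral>q. \<bar>xt q j * xt q k\<bar> \<partial>Q)"
    unfolding Sigma_xtilde_def by (rule integral_abs_bound)
  also have "\<dots> \<le> (\<integral>q. Kt\<^sup>2 \<partial>Q)" using int b by (intro integral_mono_AE) auto
  finally have sb: "\<bar>Sigma_xtilde Q h j k\<bar> \<le> Kt\<^sup>2" by (simp add: Q.prob_space)
  have "AE q in Q. \<bar>?W q\<bar> \<le> 2 * Kt\<^sup>2"
    using b by eventually_elim (use sb in linarith)
  moreover have "(\<integral>q. ?W q \<partial>Q) = 0"
    using int by (simp add: Q.prob_space) (simp add: Sigma_xtilde_def)
  ultimately have mgf: "(\<integral>\<^sup>+v. ennreal (exp (s * ?W (fst v) - s\<^sup>2 * (2 * Kt\<^sup>2)\<^sup>2)) \<partial>S) \<le> 1" for s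
    by (intro mgf_bounded Wm)
  have "{\<omega>\<in>space M. \<bar>(\<Sum>i<n. ?W (fst (\<omega> i))) / real n\<bar> > \<nu>}
    = {\<omega>\<in>space M. \<bar>(\<Sum>i<n. ?W (fst (\<omega> i))) / real n\<bar> > \<nu> \<and> (\<Sum>i<n. (2 * Kt\<^sup>2)\<^sup>2) \<le> real n * (2 * Kt\<^sup>2)\<^sup>2}"
    by simp
  also have "M.prob \<dots> \<le> 2 * exp (- (real n * \<nu>\<^sup>2 / (4 * (2 * Kt\<^sup>2)\<^sup>2)))"
    using n \<nu> Kt mgf measurable_compose[OF measurable_fst Wm]
    by (intro iid_mean_tail[where W = "\<lambda>v. ?W (fst v)" and D = "\<lambda>_. (2 * Kt\<^sup>2)\<^sup>2"] prob_space_S) auto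
  also have "4 * (2 * Kt\<^sup>2)\<^sup>2 = 16 * Kt ^ 4" by (simp add: power_mult_distrib)
  finally show ?thesis .
qed

text \<open>The noise is unbounded, but given the design it is Gaussian with a proxy equal to the
  square of the design entry; \<open>bounded_design\<close> bounds the sum of these proxies.\<close>

lemma cross_tail:
  assumes j: "j < p" and \<nu>: "0 \<le> \<nu>"
  shows "M.prob {\<omega>\<in>space M. \<omega> \<in> bounded_design \<and> \<bar>(\<Sum>i<n. snd (\<omega> i) * xt (fst (\<omega> i)) j) / real n\<bar> > \<nu>}
    \<le> 2 * exp (- (real n * \<nu>\<^sup>2 / (4 * Kt\<^sup>2)))"
proof -
  let ?A = "{\<omega>\<in>space M. \<bar>(\<Sum>i<n. snd (\<omega> i) * xt (fst (\<omega> i)) j) / real n\<bar> > \<nu> \<and>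
      (\<Sum>i<n. (xt (fst (\<omega> i)) j)\<^sup>2) \<le> real n * Kt\<^sup>2}"
  have e: "snd \<in> borel_measurable S"
    using measurable_snd[of Q std_normal_measure] by (simp cong: measurable_cong_sets)
  have W: "(\<lambda>v. snd v * xt (fst v) j) \<in> borel_measurable S"
    by (intro borel_measurable_times e xt_fst_measurable j)
  have D: "(\<lambda>v. (xt (fst v) j)\<^sup>2) \<in> borel_measurable S"
    by (intro borel_measurable_power xt_fst_measurable j)
  have Dm: "(\<lambda>\<omega>. \<Sum>i<n. (xt (fst (\<omega> i)) j)\<^sup>2) \<in> borel_measurable M"
    by (rule sum_measurable[OF D])
  have "?A \<in> sets M" using Dm mean_measurable[OF W] by measurable
  then have "M.prob {\<omega>\<in>space M. \<omega> \<in> bounded_design \<and> \<bar>(\<Sum>i<n. snd (\<omega> i) * xt (fst (\<omega> i)) j) / real n\<bar> > \<nu>}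
      \<le> M.prob ?A"
  proof (rule M.finite_measure_mono[rotated], safe)
    fix \<omega> assume \<omega>: "\<omega> \<in> bounded_design"
    show "(\<Sum>i<n. (xt (fst (\<omega> i)) j)\<^sup>2) \<le> real n * Kt\<^sup>2"
    proof (rule sum_le_n)
      fix i assume "i < n"
      from power_mono[OF bounded_designD[OF \<omega> this j], of 2] show "(xt (fst (\<omega> i)) j)\<^sup>2 \<le> Kt\<^sup>2" by simp
    qed
  qed
  also have "\<dots> \<le> 2 * exp (- (real n * \<nu>\<^sup>2 / (4 * Kt\<^sup>2)))"
    using n \<nu> Kt mgf_noise[OF xt_measurable[OF j]]
    by (intro iid_mean_tail[where W = "\<lambda>v. snd v * xt (fst v) j" and D = "\<lambda>v. (xt (fst v) j)\<^sup>2"]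
        prob_space_S W D) auto
  finally show ?thesis .
qed

text \<open>The linear events are built inside the event \<open>B\<close> on which the empirical
  norms over \<open>U\<close> are already under control. The noise process contributes once, the
  design processes \<open>p\<close> times and the covariances \<open>p\<^sup>2\<close> times, so the
  design gets its own level \<open>\<rho>\<close> and the matrix entries their own tolerance
  \<open>\<nu>\<close>, both large enough to pay for the unions.\<close>

lemma good_event:
  assumes \<rho>: "\<mu> \<le> \<rho>" and \<nu>: "0 \<le> \<nu>"
  shows "\<exists>E\<in>sets M. M.prob (space M - E) \<le> 8 * exp (- (c * real n * \<mu>\<^sup>2 / 2)) + exp (- real n)
      + real p * (4 * exp (- (c * real n * \<rho>\<^sup>2 / 2)))
      + (real p)\<^sup>2 * (2 * exp (- (real n * \<nu>\<^sup>2 / (16 * Kt ^ 4))))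
      + real p * (2 * exp (- (real n * \<nu>\<^sup>2 / (4 * Kt\<^sup>2)))) \<and>
    (\<forall>\<omega>\<in>E.
      (\<forall>j<p. \<forall>k<p. \<bar>(\<Sum>i<n. (Xs \<omega> i j - h (Zs \<omega> i) j) * (Xs \<omega> i k - h (Zs \<omega> i) k)) / real n
          - Sigma_xtilde Q h j k\<bar> \<le> \<nu>) \<and>
      (\<forall>j<p. \<forall>u\<in>U. \<bar>(\<Sum>i<n. (Xs \<omega> i j - h (Zs \<omega> i) j) * u (Zs \<omega> i)) / real n\<bar> \<le> \<gamma> * \<mu> * \<rho>) \<and>
      (\<forall>u\<in>U. \<bar>(\<Sum>i<n. (u (Zs \<omega> i))\<^sup>2) / real n - (L2norm (marg_z d Q) u)\<^sup>2\<bar> \<le> \<gamma> * \<mu>\<^sup>2) \<and>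
      (\<forall>j<p. \<bar>(\<Sum>i<n. Es \<omega> i * (Xs \<omega> i j - h (Zs \<omega> i) j)) / real n\<bar> \<le> \<nu>) \<and>
      (\<forall>u\<in>U. \<bar>(\<Sum>i<n. Es \<omega> i * u (Zs \<omega> i)) / real n\<bar> \<le> \<gamma> * \<mu>\<^sup>2))"
proof -
  have xe: "xt (fst (\<omega> i)) j = Xs \<omega> i j - h (Zs \<omega> i) j" for \<omega> i j
    by (simp add: Xs_def Zs_def)
  obtain E1 where E1: "E1 \<in> sets M" "M.prob (space M - E1) \<le> 4 * exp (- (c * real n * \<mu>\<^sup>2 / 2))"
    "\<And>\<omega> u. \<omega> \<in> E1 \<Longrightarrow> u \<in> U \<Longrightarrow> \<bar>(\<Sum>i<n. (u (Zs \<omega> i))\<^sup>2) / real n - (L2norm (marg_z d Q) u)\<^sup>2\<bar> \<le> \<gamma> * \<mu>\<^sup>2"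
    using quadratic_event by blast
  obtain EN where EN: "EN \<in> sets M" "M.prob (space M - EN) \<le> exp (- real n)"
    "\<And>\<omega>. \<omega> \<in> EN \<Longrightarrow> (\<Sum>i<n. \<bar>snd (\<omega> i)\<bar>) \<le> real n * (4 * L)"
    using noise_event by blast
  define B where "B = bounded_design \<inter> EN \<inter> E1"
  have B: "B \<in> sets M" unfolding B_def using bounded_design_sets EN(1) E1(1) by auto
  have Bu: "(\<Sum>i<n. (u (Zs \<omega> i))\<^sup>2) \<le> real n * (2 * \<mu>\<^sup>2)" if "\<omega> \<in> B" "u \<in> U" for \<omega> u
  proof -
    have "(L2norm (marg_z d Q) u)\<^sup>2 \<le> \<mu>\<^sup>2"
      using that(2) L2norm_nonneg[of "marg_z d Q" u] by (auto simp: U_def intro!: power_mono)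
    moreover have "\<gamma> * \<mu>\<^sup>2 \<le> 1 * \<mu>\<^sup>2" using \<gamma> by (intro mult_right_mono) auto
    moreover have "\<bar>(\<Sum>i<n. (u (Zs \<omega> i))\<^sup>2) / real n - (L2norm (marg_z d Q) u)\<^sup>2\<bar> \<le> \<gamma> * \<mu>\<^sup>2"
      using that by (intro E1) (auto simp: B_def)
    ultimately have "(\<Sum>i<n. (u (Zs \<omega> i))\<^sup>2) / real n \<le> 2 * \<mu>\<^sup>2" by linarith
    then show ?thesis using n by (simp add: pos_divide_le_eq mult.commute)
  qed
  have e: "snd \<in> borel_measurable S"
    using measurable_snd[of Q std_normal_measure] by (simp cong: measurable_cong_sets)
  have "\<exists>E\<in>sets M. E \<subseteq> B \<and> M.prob (B - E) \<le> 4 * exp (- (c * real n * \<mu>\<^sup>2 / 2)) \<and>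
     (\<forall>\<omega>\<in>E. \<forall>u\<in>U. \<bar>(\<Sum>i<n. snd (\<omega> i) * u (Zs \<omega> i)) / real n\<bar> \<le> \<gamma> * \<mu> * \<mu>)"
  proof (rule linear_event[OF e])
    fix \<phi> :: "(nat \<Rightarrow> real) \<Rightarrow> real" and b s :: real assume \<phi>: "\<phi> \<in> borel_measurable (Rvec d)"
    have \<phi>Q: "(\<lambda>q. \<phi> (snd q)) \<in> borel_measurable Q" by (rule measurable_compose[OF snd_Q \<phi>])
    have "(\<integral>\<^sup>+v. ennreal (exp (s * (snd v * \<phi> (snd (fst v))) - s\<^sup>2 * (Kt\<^sup>2 * (\<phi> (snd (fst v)))\<^sup>2))) \<partial>S)
        \<le> (\<integral>\<^sup>+v. ennreal (exp (s * (snd v * \<phi> (snd (fst v))) - s\<^sup>2 * (\<phi> (snd (fst v)))\<^sup>2)) \<partial>S)"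
    \<comment> \<open>The natural proxy of the noise process lacks the factor
      \<open>Kt\<^sup>2\<close>; since \<open>Kt \<ge> 1\<close>, enlarging it fits the common
      hypothesis of \<open>linear_event\<close>.\<close>
    proof (intro nn_integral_mono ennreal_leI)
      fix v :: "((nat \<Rightarrow> real) \<times> (nat \<Rightarrow> real)) \<times> real"
      have "1 * (\<phi> (snd (fst v)))\<^sup>2 \<le> Kt\<^sup>2 * (\<phi> (snd (fst v)))\<^sup>2"
        using Kt by (intro mult_right_mono) auto
      then have "s\<^sup>2 * (\<phi> (snd (fst v)))\<^sup>2 \<le> s\<^sup>2 * (Kt\<^sup>2 * (\<phi> (snd (fst v)))\<^sup>2)"
        by (intro mult_left_mono) auto
      then show "exp (s * (snd v * \<phi> (snd (fst v))) - s\<^sup>2 * (Kt\<^sup>2 * (\<phi> (snd (fst v)))\<^sup>2))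
         \<le> exp (s * (snd v * \<phi> (snd (fst v))) - s\<^sup>2 * (\<phi> (snd (fst v)))\<^sup>2)" by simp
    qed
    also have "\<dots> \<le> 1" by (rule mgf_noise[OF \<phi>Q])
    finally show "(\<integral>\<^sup>+v. ennreal (exp (s * (snd v * \<phi> (snd (fst v))) - s\<^sup>2 * (Kt\<^sup>2 * (\<phi> (snd (fst v)))\<^sup>2))) \<partial>S) \<le> 1" .
  qed (use B Bu EN(3) in \<open>auto simp: B_def\<close>)
  then obtain E2 where E2: "E2 \<in> sets M" "E2 \<subseteq> B" "M.prob (B - E2) \<le> 4 * exp (- (c * real n * \<mu>\<^sup>2 / 2))"
    "\<And>\<omega> u. \<omega> \<in> E2 \<Longrightarrow> u \<in> U \<Longrightarrow> \<bar>(\<Sum>i<n. snd (\<omega> i) * u (Zs \<omega> i)) / real n\<bar> \<le> \<gamma> * \<mu> * \<mu>"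
    by blast
  have "\<exists>E\<in>sets M. E \<subseteq> B \<and> M.prob (B - E) \<le> 4 * exp (- (c * real n * \<rho>\<^sup>2 / 2)) \<and>
     (\<forall>\<omega>\<in>E. \<forall>u\<in>U. \<bar>(\<Sum>i<n. xt (fst (\<omega> i)) j * u (Zs \<omega> i)) / real n\<bar> \<le> \<gamma> * \<mu> * \<rho>)" if j: "j < p" for j
  proof (rule linear_event[OF xt_fst_measurable[OF j] mgf_design[OF j] B])
    fix \<omega> assume "\<omega> \<in> B"
    then have "(\<Sum>i<n. \<bar>xt (fst (\<omega> i)) j\<bar>) \<le> real n * Kt"
      using j by (intro sum_le_n bounded_designD) (auto simp: B_def)
    also have "\<dots> \<le> real n * (4 * L)" using L by (intro mult_left_mono) auto
    finally show "(\<Sum>i<n. \<bar>xt (fst (\<omega> i)) j\<bar>) \<le> real n * (4 * L)" .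
  qed (use Bu \<rho> in auto)
  then have "\<forall>j\<in>{..<p}. \<exists>E. E \<in> sets M \<and> E \<subseteq> B \<and> M.prob (B - E) \<le> 4 * exp (- (c * real n * \<rho>\<^sup>2 / 2)) \<and>
     (\<forall>\<omega>\<in>E. \<forall>u\<in>U. \<bar>(\<Sum>i<n. xt (fst (\<omega> i)) j * u (Zs \<omega> i)) / real n\<bar> \<le> \<gamma> * \<mu> * \<rho>)"
    by (simp only: Bex_def lessThan_iff) simp
  from bchoice[OF this] obtain E3 where
    E3: "\<forall>j\<in>{..<p}. E3 j \<in> sets M \<and> E3 j \<subseteq> B \<and> M.prob (B - E3 j) \<le> 4 * exp (- (c * real n * \<rho>\<^sup>2 / 2)) \<and>
     (\<forall>\<omega>\<in>E3 j. \<forall>u\<in>U. \<bar>(\<Sum>i<n. xt (fst (\<omega> i)) j * u (Zs \<omega> i)) / real n\<bar> \<le> \<gamma> * \<mu> * \<rho>)"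
    by (elim exE)
  have E3: "\<And>j. j < p \<Longrightarrow> E3 j \<in> sets M"
    "\<And>j. j < p \<Longrightarrow> M.prob (B - E3 j) \<le> 4 * exp (- (c * real n * \<rho>\<^sup>2 / 2))"
    "\<And>\<omega> j u. j < p \<Longrightarrow> \<omega> \<in> E3 j \<Longrightarrow> u \<in> U \<Longrightarrow> \<bar>(\<Sum>i<n. xt (fst (\<omega> i)) j * u (Zs \<omega> i)) / real n\<bar> \<le> \<gamma> * \<mu> * \<rho>"
    using E3 by simp_all
  define C where "C jk = {\<omega>\<in>space M. \<bar>(\<Sum>i<n. xt (fst (\<omega> i)) (fst jk) * xt (fst (\<omega> i)) (snd jk)
      - Sigma_xtilde Q h (fst jk) (snd jk)) / real n\<bar> > \<nu>}" for jk
  define D where "D j = {\<omega>\<in>space M. \<omega> \<in> bounded_design \<and> \<bar>(\<Sum>i<n. snd (\<omega> i) * xt (fst (\<omega> i)) j) / real n\<bar> > \<nu>}" for j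
  have Cs: "C jk \<in> sets M" if "jk \<in> {..<p} \<times> {..<p}" for jk
  proof -
    have "(\<lambda>v. xt (fst v) (fst jk) * xt (fst v) (snd jk) - Sigma_xtilde Q h (fst jk) (snd jk)) \<in> borel_measurable S"
      using that by (intro borel_measurable_diff[OF borel_measurable_times] xt_fst_measurable borel_measurable_const) auto
    from mean_measurable[OF this] show ?thesis unfolding C_def by measurable
  qed
  have Ds: "D j \<in> sets M" if "j \<in> {..<p}" for j
  proof -
    have "(\<lambda>v. snd v * xt (fst v) j) \<in> borel_measurable S"
      using that by (intro borel_measurable_times e xt_fst_measurable) auto
    from mean_measurable[OF this] show ?thesis unfolding D_def
      using bounded_design_sets by measurable
  qed
  let ?R = "(space M - bounded_design) \<union> (space M - EN) \<union> (space M - E1) \<union> (B - E2)"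
  let ?R3 = "\<Union>j\<in>{..<p}. B - E3 j" and ?RC = "\<Union>jk\<in>{..<p}\<times>{..<p}. C jk" and ?RD = "\<Union>j\<in>{..<p}. D j"
  define E where "E = E2 - ?R3 - ?RC - ?RD"
  have s1: "space M - bounded_design \<in> sets M" "space M - EN \<in> sets M" "space M - E1 \<in> sets M" "B - E2 \<in> sets M"
    using bounded_design_sets EN(1) E1(1) B E2(1) by auto
  have s2: "?R3 \<in> sets M" "?RC \<in> sets M" "?RD \<in> sets M"
    by (rule sets.finite_UN; use B E3(1) Cs Ds in auto)+
  have s3: "?R \<in> sets M" using s1 by auto
  have E: "E \<in> sets M" unfolding E_def using E2(1) s2 by auto
  have Un4: "M.prob (X1 \<union> X2 \<union> X3 \<union> X4) \<le> M.prob X1 + M.prob X2 + M.prob X3 + M.prob X4"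
    if "X1 \<in> sets M" "X2 \<in> sets M" "X3 \<in> sets M" "X4 \<in> sets M" for X1 X2 X3 X4
    using measure_Un_le[of "X1 \<union> X2 \<union> X3" M X4] measure_Un_le[of "X1 \<union> X2" M X3]
      measure_Un_le[of X1 M X2] that by auto
  have "M.prob (space M - E) \<le> M.prob (?R \<union> ?R3 \<union> ?RC \<union> ?RD)"
  proof (rule M.finite_measure_mono)
    show "space M - E \<subseteq> ?R \<union> ?R3 \<union> ?RC \<union> ?RD" unfolding E_def B_def by blast
  qed (use s2 s3 in auto)
  also have "\<dots> \<le> M.prob ?R + M.prob ?R3 + M.prob ?RC + M.prob ?RD"
    by (rule Un4[OF s3 s2])
  also have "\<dots> \<le> (0 + exp (- real n) + 4 * exp (- (c * real n * \<mu>\<^sup>2 / 2)) + 4 * exp (- (c * real n * \<mu>\<^sup>2 / 2)))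
      + real p * (4 * exp (- (c * real n * \<rho>\<^sup>2 / 2)))
      + (real p)\<^sup>2 * (2 * exp (- (real n * \<nu>\<^sup>2 / (16 * Kt ^ 4))))
      + real p * (2 * exp (- (real n * \<nu>\<^sup>2 / (4 * Kt\<^sup>2))))"
  proof (intro add_mono)
    have "M.prob ?R \<le> M.prob (space M - bounded_design) + M.prob (space M - EN) + M.prob (space M - E1) + M.prob (B - E2)"
      by (rule Un4[OF s1])
    also have "\<dots> \<le> 0 + exp (- real n) + 4 * exp (- (c * real n * \<mu>\<^sup>2 / 2)) + 4 * exp (- (c * real n * \<mu>\<^sup>2 / 2))"
      using bounded_design_prob EN(2) E1(2) E2(3) by (intro add_mono) auto
    finally show "M.prob ?R \<le> 0 + exp (- real n) + 4 * exp (- (c * real n * \<mu>\<^sup>2 / 2)) + 4 * exp (- (c * real n * \<mu>\<^sup>2 / 2))" .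
    have "M.prob ?R3 \<le> (\<Sum>j\<in>{..<p}. M.prob (B - E3 j))"
      using B E3(1) by (intro M.finite_measure_subadditive_finite) auto
    also have "\<dots> \<le> (\<Sum>j\<in>{..<p}. 4 * exp (- (c * real n * \<rho>\<^sup>2 / 2)))"
      using E3(2) by (intro sum_mono) auto
    finally show "M.prob ?R3 \<le> real p * (4 * exp (- (c * real n * \<rho>\<^sup>2 / 2)))" by simp
    have "M.prob ?RC \<le> (\<Sum>jk\<in>{..<p}\<times>{..<p}. M.prob (C jk))"
      using Cs by (intro M.finite_measure_subadditive_finite) auto
    also have "\<dots> \<le> (\<Sum>jk\<in>{..<p}\<times>{..<p}. 2 * exp (- (real n * \<nu>\<^sup>2 / (16 * Kt ^ 4))))"
      unfolding C_def using \<nu> by (intro sum_mono covariance_tail) auto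
    finally show "M.prob ?RC \<le> (real p)\<^sup>2 * (2 * exp (- (real n * \<nu>\<^sup>2 / (16 * Kt ^ 4))))"
      by (simp add: power2_eq_square card_cartesian_product)
    have "M.prob ?RD \<le> (\<Sum>j\<in>{..<p}. M.prob (D j))"
      using Ds by (intro M.finite_measure_subadditive_finite) auto
    also have "\<dots> \<le> (\<Sum>j\<in>{..<p}. 2 * exp (- (real n * \<nu>\<^sup>2 / (4 * Kt\<^sup>2))))"
      unfolding D_def using \<nu> by (intro sum_mono cross_tail) auto
    finally show "M.prob ?RD \<le> real p * (2 * exp (- (real n * \<nu>\<^sup>2 / (4 * Kt\<^sup>2))))" by simp
  qed
  finally have PE: "M.prob (space M - E) \<le> 8 * exp (- (c * real n * \<mu>\<^sup>2 / 2)) + exp (- real n)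
      + real p * (4 * exp (- (c * real n * \<rho>\<^sup>2 / 2)))
      + (real p)\<^sup>2 * (2 * exp (- (real n * \<nu>\<^sup>2 / (16 * Kt ^ 4))))
      + real p * (2 * exp (- (real n * \<nu>\<^sup>2 / (4 * Kt\<^sup>2))))" by simp
  show ?thesis
  proof (intro bexI[OF _ E] conjI ballI allI impI PE)
    fix \<omega> assume \<omega>: "\<omega> \<in> E"
    then have \<omega>B: "\<omega> \<in> E2" "\<omega> \<in> B" "\<omega> \<in> E1" "\<omega> \<in> bounded_design" "\<omega> \<in> space M"
      using E2(2) sets.sets_into_space[OF E] by (auto simp: E_def B_def)
    {
      fix j k assume jk: "j < p" "k < p"
      then have "\<omega> \<notin> C (j, k)" using \<omega> by (auto simp: E_def)
      then have "\<bar>(\<Sum>i<n. xt (fst (\<omega> i)) j * xt (fst (\<omega> i)) k - Sigma_xtilde Q h j k) / real n\<bar> \<le> \<nu>"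
        using \<omega>B by (simp add: C_def)
      moreover have "(\<Sum>i<n. xt (fst (\<omega> i)) j * xt (fst (\<omega> i)) k - Sigma_xtilde Q h j k) / real n
         = (\<Sum>i<n. xt (fst (\<omega> i)) j * xt (fst (\<omega> i)) k) / real n - Sigma_xtilde Q h j k"
        using n by (simp add: sum_subtractf diff_divide_distrib)
      ultimately show "\<bar>(\<Sum>i<n. (Xs \<omega> i j - h (Zs \<omega> i) j) * (Xs \<omega> i k - h (Zs \<omega> i) k)) / real n
          - Sigma_xtilde Q h j k\<bar> \<le> \<nu>" unfolding xe by simp
    next
      fix j u assume j: "j < p" and u: "u \<in> U"
      then have "\<omega> \<in> E3 j" using \<omega> \<omega>B by (auto simp: E_def)
      from E3(3)[OF j this u]
      show "\<bar>(\<Sum>i<n. (Xs \<omega> i j - h (Zs \<omega> i) j) * u (Zs \<omega> i)) / real n\<bar> \<le> \<gamma> * \<mu> * \<rho>" unfolding xe .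
    next
      fix u assume u: "u \<in> U"
      show "\<bar>(\<Sum>i<n. (u (Zs \<omega> i))\<^sup>2) / real n - (L2norm (marg_z d Q) u)\<^sup>2\<bar> \<le> \<gamma> * \<mu>\<^sup>2"
        by (rule E1(3)[OF \<omega>B(3) u])
    next
      fix j assume j: "j < p"
      then have "\<omega> \<notin> D j" using \<omega> by (auto simp: E_def)
      then show "\<bar>(\<Sum>i<n. Es \<omega> i * (Xs \<omega> i j - h (Zs \<omega> i) j)) / real n\<bar> \<le> \<nu>"
        using \<omega>B by (simp add: D_def Es_def xe)
    next
      fix u assume u: "u \<in> U"
      from E2(4)[OF \<omega>B(1) u]
      show "\<bar>(\<Sum>i<n. Es \<omega> i * u (Zs \<omega> i)) / real n\<bar> \<le> \<gamma> * \<mu>\<^sup>2"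
        by (simp add: Es_def power2_eq_square mult.assoc)
    }
  qed
qed

end

section \<open>The oracle inequality for controlled noise\<close>

lemma l1norm_convex:
  assumes "0 \<le> s" "s \<le> 1"
  shows "l1norm p (\<lambda>j. a j + s * b j) \<le> (1 - s) * l1norm p a + s * l1norm p (\<lambda>j. a j + b j)"
proof -
  have "\<bar>a j + s * b j\<bar> \<le> (1 - s) * \<bar>a j\<bar> + s * \<bar>a j + b j\<bar>" for j
  proof -
    have "\<bar>(1 - s) * a j + s * (a j + b j)\<bar> \<le> \<bar>(1 - s) * a j\<bar> + \<bar>s * (a j + b j)\<bar>" by (rule abs_triangle_ineq)
    moreover have "(1 - s) * a j + s * (a j + b j) = a j + s * b j" by (simp add: algebra_simps)
    moreover have "\<bar>(1 - s) * a j\<bar> = (1 - s) * \<bar>a j\<bar>" "\<bar>s * (a j + b j)\<bar> = s * \<bar>a j + b j\<bar>"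
      using assms by (simp_all add: abs_mult)
    ultimately show ?thesis by simp
  qed
  then have "l1norm p (\<lambda>j. a j + s * b j) \<le> (\<Sum>j<p. (1 - s) * \<bar>a j\<bar> + s * \<bar>a j + b j\<bar>)"
    unfolding l1norm_def by (rule sum_mono)
  then show ?thesis by (simp add: l1norm_def sum.distrib sum_distrib_left)
qed

lemma l1norm_scale: "l1norm p (\<lambda>j. s * b j) = \<bar>s\<bar> * l1norm p b"
  by (simp add: l1norm_def abs_mult sum_distrib_left)

lemma l1norm_nonneg: "0 \<le> l1norm p b"
  by (simp add: l1norm_def sum_nonneg)

lemma abs_sum_mult_le:
  assumes "\<And>j. j < p \<Longrightarrow> \<bar>f j\<bar> \<le> B"
  shows "\<bar>\<Sum>j<p. f j * v j\<bar> \<le> B * l1norm p v"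
proof -
  have "\<bar>\<Sum>j<p. f j * v j\<bar> \<le> (\<Sum>j<p. \<bar>f j * v j\<bar>)" by (rule sum_abs)
  also have "\<dots> \<le> (\<Sum>j<p. B * \<bar>v j\<bar>)"
    using assms by (intro sum_mono) (auto simp: abs_mult intro!: mult_right_mono)
  finally show ?thesis by (simp add: l1norm_def sum_distrib_left)
qed

text \<open>A one-sided derivative at 0 in algebraic form: the l1 penalty is merely convex, so
  optimality yields an inequality on a segment only.\<close>

lemma nonneg_if_first_order:
  fixes P Q :: real
  assumes "\<And>s. 0 < s \<Longrightarrow> s \<le> 1 \<Longrightarrow> 0 \<le> s * P + s\<^sup>2 * Q"
  shows "0 \<le> P"
proof (rule ccontr)
  assume "\<not> 0 \<le> P"
  then have P: "P < 0" by simp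
  define s where "s = min 1 (- P / (2 * (\<bar>Q\<bar> + 1)))"
  have s: "0 < s" "s \<le> 1" using P by (auto simp: s_def intro!: divide_neg_pos)
  have "s \<le> - P / (2 * (\<bar>Q\<bar> + 1))" by (simp add: s_def)
  then have "s * (2 * (\<bar>Q\<bar> + 1)) \<le> - P" by (subst (asm) pos_le_divide_eq) auto
  moreover have "s * (2 * (\<bar>Q\<bar> + 1)) = 2 * (s * (\<bar>Q\<bar> + 1))" by simp
  ultimately have "s * (\<bar>Q\<bar> + 1) \<le> - P / 2" by linarith
  moreover have "s * Q \<le> s * (\<bar>Q\<bar> + 1)" using s by (intro mult_left_mono) auto
  ultimately have "P + s * Q < 0" using P by linarith
  then have "s * (P + s * Q) < 0" using s by (simp add: mult_pos_neg)
  with assms[OF s] show False by (simp add: algebra_simps power2_eq_square)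
qed

text \<open>Everything from here on is deterministic: one sample \<open>\<omega>\<close> is fixed,
  and the five bounds of the good event are hypotheses. The column process has tolerance
  \<open>mu * (lam / R)\<close>, the other two processes over \<open>U\<close> have
  \<open>mu\<^sup>2\<close>.\<close>

locale noise_controlled =
  fixes n p :: nat and Qz G J and h :: "(nat \<Rightarrow> real) \<Rightarrow> nat \<Rightarrow> real" and \<omega> :: sample
    and \<beta>0 :: "nat \<Rightarrow> real" and g0 and lam mu R Jh LX :: real and Sg :: "nat \<Rightarrow> nat \<Rightarrow> real"
  assumes n: "n > 0" and G: "L2_subspace Qz G" and J: "semi_inner_on G J"
    and hG: "\<And>j. j < p \<Longrightarrow> (\<lambda>z. h z j) \<in> G" "\<And>j. j < p \<Longrightarrow> Jnorm J (\<lambda>z. h z j) \<le> Jh"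
    and g0: "g0 \<in> G" and pos: "lam > 0" "mu > 0" "R > 0" "LX > 0" "Jh \<ge> 0"
    and mu_le: "mu\<^sup>2 \<le> (1/253) * R\<^sup>2 / (2 * (1 + Jnorm J g0 + Jh)\<^sup>2)"
    and R_le: "R\<^sup>2 \<le> lam"
    and sparse: "4 * lam\<^sup>2 * real (card {j\<in>{..<p}. \<beta>0 j \<noteq> 0}) / LX\<^sup>2 \<le> (1/253) * R\<^sup>2"
    and Sg: "\<And>v. LX\<^sup>2 * (\<Sum>j<p. (v j)\<^sup>2) \<le> qform p Sg v"
    and evA: "\<And>j k. j < p \<Longrightarrow> k < p \<Longrightarrow>
      \<bar>(\<Sum>i<n. (Xs \<omega> i j - h (Zs \<omega> i) j) * (Xs \<omega> i k - h (Zs \<omega> i) k)) / real n - Sg j k\<bar> \<le> (1/253) * lam"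
    and evB: "\<And>j u. j < p \<Longrightarrow> u \<in> G \<Longrightarrow> L2norm Qz u \<le> mu \<Longrightarrow> Jnorm J u \<le> 1 \<Longrightarrow>
      \<bar>(\<Sum>i<n. (Xs \<omega> i j - h (Zs \<omega> i) j) * u (Zs \<omega> i)) / real n\<bar> \<le> (1/1012) * mu * (lam / R)"
    and evC: "\<And>u. u \<in> G \<Longrightarrow> L2norm Qz u \<le> mu \<Longrightarrow> Jnorm J u \<le> 1 \<Longrightarrow>
      \<bar>(\<Sum>i<n. (u (Zs \<omega> i))\<^sup>2) / real n - (L2norm Qz u)\<^sup>2\<bar> \<le> (1/1012) * mu\<^sup>2"
    and evD: "\<And>j. j < p \<Longrightarrow> \<bar>(\<Sum>i<n. Es \<omega> i * (Xs \<omega> i j - h (Zs \<omega> i) j)) / real n\<bar> \<le> (1/253) * lam"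
    and evE: "\<And>u. u \<in> G \<Longrightarrow> L2norm Qz u \<le> mu \<Longrightarrow> Jnorm J u \<le> 1 \<Longrightarrow>
      \<bar>(\<Sum>i<n. Es \<omega> i * u (Zs \<omega> i)) / real n\<bar> \<le> (1/1012) * mu\<^sup>2"
begin

definition ip :: "(nat \<Rightarrow> real) \<Rightarrow> (nat \<Rightarrow> real) \<Rightarrow> real" where
  "ip a b = (\<Sum>i<n. a i * b i) / real n"
definition xb :: "(nat \<Rightarrow> real) \<Rightarrow> nat \<Rightarrow> real" where
  "xb v i = (\<Sum>j<p. (Xs \<omega> i j - h (Zs \<omega> i) j) * v j)"
definition hb :: "(nat \<Rightarrow> real) \<Rightarrow> (nat \<Rightarrow> real) \<Rightarrow> real" where
  "hb v z = (\<Sum>j<p. h z j * v j)"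
definition at_z :: "((nat \<Rightarrow> real) \<Rightarrow> real) \<Rightarrow> nat \<Rightarrow> real" where
  "at_z g i = g (Zs \<omega> i)"
text \<open>The right-hand side of the oracle inequality.\<close>

definition M :: real where
  "M = lam\<^sup>2 * real (card {j\<in>{..<p}. \<beta>0 j \<noteq> 0}) / LX\<^sup>2"
definition on_supp :: "(nat \<Rightarrow> real) \<Rightarrow> real" where
  "on_supp v = (\<Sum>j\<in>{j\<in>{..<p}. \<beta>0 j \<noteq> 0}. \<bar>v j\<bar>)"
definition off_supp :: "(nat \<Rightarrow> real) \<Rightarrow> real" where
  "off_supp v = (\<Sum>j\<in>{j\<in>{..<p}. \<beta>0 j = 0}. \<bar>v j\<bar>)"

abbreviation "e \<equiv> Es \<omega>"
abbreviation "q \<equiv> qform p Sg"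
abbreviation "N \<equiv> l1norm p"
abbreviation "L2 \<equiv> L2norm Qz"

section \<open>The empirical inner product and the support of \<open>\<beta>0\<close>\<close>

lemma emp_sq_ip: "emp_sq n v = ip v v"
  by (simp add: emp_sq_def ip_def power2_eq_square)

lemma ip_add_right: "ip a (\<lambda>i. b i + c i) = ip a b + ip a c"
  by (simp add: ip_def algebra_simps sum.distrib add_divide_distrib)

lemma ip_scale_right: "ip a (\<lambda>i. s * b i) = s * ip a b"
  by (simp add: ip_def mult.left_commute sum_distrib_left)

lemma ip_commute: "ip a b = ip b a"
  by (simp add: ip_def mult.commute)

lemma ip_nonneg: "0 \<le> ip a a"
  by (simp add: ip_def sum_nonneg)

lemma ip_sq_lin: "ip (\<lambda>i. a i + s * b i) (\<lambda>i. a i + s * b i) = ip a a + 2 * s * ip a b + s\<^sup>2 * ip b b"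
  by (simp add: ip_def sum.distrib add_divide_distrib algebra_simps power2_eq_square sum_distrib_left sum_divide_distrib)

lemma hb_G: "hb v \<in> G"
  unfolding hb_def by (rule finite_subspace_sum[OF G hG(1)])

lemma Jnorm_hb: "Jnorm J (hb v) \<le> Jh * N v"
  unfolding hb_def l1norm_def by (rule Jnorm_sum_le[OF G J]) (use hG in auto)

lemma hb_scale: "hb (\<lambda>j. s * v j) z = s * hb v z"
  by (simp add: hb_def sum_distrib_left mult_ac)

lemma xb_scale: "xb (\<lambda>j. s * v j) i = s * xb v i"
  by (simp add: xb_def sum_distrib_left mult_ac)

lemma q_scale: "q (\<lambda>j. s * v j) = s\<^sup>2 * q v"
  by (simp add: qform_def sum_distrib_left power2_eq_square mult_ac)

lemma q_nonneg: "0 \<le> q v"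
  using Sg[of v] by (meson order_trans mult_nonneg_nonneg sum_nonneg zero_le_power2)

lemma N_split: "N v = on_supp v + off_supp v"
proof -
  have "{..<p} = {j\<in>{..<p}. \<beta>0 j \<noteq> 0} \<union> {j\<in>{..<p}. \<beta>0 j = 0}" by auto
  then have "N v = (\<Sum>j\<in>{j\<in>{..<p}. \<beta>0 j \<noteq> 0} \<union> {j\<in>{..<p}. \<beta>0 j = 0}. \<bar>v j\<bar>)"
    unfolding l1norm_def by metis
  also have "\<dots> = on_supp v + off_supp v"
    unfolding on_supp_def off_supp_def by (rule sum.union_disjoint) auto
  finally show ?thesis .
qed

lemma supp_nonneg: "0 \<le> on_supp v" "0 \<le> off_supp v"
  by (auto simp: on_supp_def off_supp_def sum_nonneg)

lemma N_diff: "N \<beta>0 - N (\<lambda>j. \<beta>0 j + v j) \<le> on_supp v - off_supp v"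
proof -
  have "on_supp \<beta>0 \<le> on_supp (\<lambda>j. \<beta>0 j + v j) + on_supp v"
    unfolding on_supp_def sum.distrib[symmetric] by (intro sum_mono) linarith
  moreover have "off_supp \<beta>0 = 0" "off_supp (\<lambda>j. \<beta>0 j + v j) = off_supp v"
    by (simp_all add: off_supp_def)
  ultimately show ?thesis by (simp add: N_split)
qed

text \<open>Here sparsity meets the eigenvalue condition: Cauchy-Schwarz on the support gives the
  square root of its size times the Euclidean norm, and the latter is controlled by \<open>q\<close>
  through \<open>LX\<close>.\<close>

lemma on_supp_le: "(lam * on_supp v)\<^sup>2 \<le> M * q v"
proof -
  let ?S = "{j\<in>{..<p}. \<beta>0 j \<noteq> 0}"
  have "(\<Sum>j\<in>?S. 1 * \<bar>v j\<bar>)\<^sup>2 \<le> (\<Sum>j\<in>?S. 1\<^sup>2) * (\<Sum>j\<in>?S. \<bar>v j\<bar>\<^sup>2)"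
    by (rule Cauchy_Schwarz_ineq_sum)
  then have "(on_supp v)\<^sup>2 \<le> real (card ?S) * (\<Sum>j\<in>?S. (v j)\<^sup>2)" by (simp add: on_supp_def)
  also have "\<dots> \<le> real (card ?S) * (\<Sum>j<p. (v j)\<^sup>2)"
    by (intro mult_left_mono sum_mono2) auto
  also have "\<dots> \<le> real (card ?S) * (q v / LX\<^sup>2)"
    using Sg[of v] pos by (intro mult_left_mono) (auto simp: pos_le_divide_eq mult.commute)
  finally have "lam\<^sup>2 * (on_supp v)\<^sup>2 \<le> lam\<^sup>2 * (real (card ?S) * (q v / LX\<^sup>2))"
    by (rule mult_left_mono) simp
  then show ?thesis by (simp add: M_def power_mult_distrib)
qed

lemma M_nonneg: "0 \<le> M" by (simp add: M_def)

lemma M_le: "M \<le> R\<^sup>2 / 1012"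
proof -
  have "4 * lam\<^sup>2 * real (card {j\<in>{..<p}. \<beta>0 j \<noteq> 0}) / LX\<^sup>2 = 4 * M" by (simp add: M_def)
  then show ?thesis using sparse by linarith
qed

text \<open>The first form keeps three quarters of \<open>q\<close> on the left during localisation.
  The second gives \<open>M\<close> with constant 1 in the final bound, at the price of a full
  \<open>q\<close>.\<close>

lemma on_supp_am_gm:
  shows "lam * on_supp v \<le> M + q v / 4" "2 * (lam * on_supp v) \<le> M + q v"
proof -
  have "(lam * on_supp v)\<^sup>2 \<le> (M + q v / 4)\<^sup>2"
    using on_supp_le[of v] zero_le_power2[of "M - q v / 4"] by (simp add: power2_eq_square algebra_simps)
  then show "lam * on_supp v \<le> M + q v / 4"
    by (rule power2_le_imp_le) (use M_nonneg q_nonneg[of v] in simp)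
  have "(2 * (lam * on_supp v))\<^sup>2 \<le> (M + q v)\<^sup>2"
    using on_supp_le[of v] zero_le_power2[of "M - q v"] by (simp add: power2_eq_square algebra_simps)
  then show "2 * (lam * on_supp v) \<le> M + q v"
    by (rule power2_le_imp_le) (use M_nonneg q_nonneg[of v] in simp)
qed

lemma mu_bounds: "mu \<le> R / 22" "mu * Jnorm J g0 \<le> R / 22" "mu * Jh \<le> R / 22"
proof -
  let ?a = "1 + Jnorm J g0 + Jh"
  have J0: "0 \<le> Jnorm J g0" by (rule Jnorm_nonneg[OF G J g0])
  then have a: "0 < ?a" using pos by linarith
  have "mu\<^sup>2 \<le> (R\<^sup>2 / 506) / ?a\<^sup>2" using mu_le by simp
  then have "mu\<^sup>2 * ?a\<^sup>2 \<le> R\<^sup>2 / 506" using a by (subst (asm) pos_le_divide_eq) auto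
  \<comment> \<open>484 is 22 squared, the largest integer square below 506 = 2 * 253.\<close>
  then have "mu\<^sup>2 * ?a\<^sup>2 \<le> R\<^sup>2 / 484" using zero_le_power2[of R] by linarith
  then have "(mu * ?a)\<^sup>2 \<le> (R / 22)\<^sup>2" by (simp add: power_mult_distrib power_divide)
  then have "mu * ?a \<le> R / 22" by (rule power2_le_imp_le) (use pos in simp)
  then have "mu + mu * Jnorm J g0 + mu * Jh \<le> R / 22" by (simp add: algebra_simps)
  moreover have "0 \<le> mu * Jnorm J g0" "0 \<le> mu * Jh" using pos J0 by auto
  ultimately show "mu \<le> R / 22" "mu * Jnorm J g0 \<le> R / 22" "mu * Jh \<le> R / 22" using pos by linarith+
qed

text \<open>Homogeneity: multiplying by \<open>mu / (2 * R)\<close> moves such a \<open>g\<close>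
  into the class on which the hypotheses hold. In the linear bounds the factor cancels once, turning
  \<open>mu * (lam / R)\<close> into \<open>lam\<close> and \<open>mu\<^sup>2\<close> into
  \<open>R * mu\<close>, which is at most \<open>R\<^sup>2\<close>.\<close>

lemma scaled_events:
  assumes g: "g \<in> G" "L2 g \<le> R" "mu * Jnorm J g \<le> 2 * R"
  shows "j < p \<Longrightarrow> \<bar>ip (\<lambda>i. Xs \<omega> i j - h (Zs \<omega> i) j) (at_z g)\<bar> \<le> (1/253) * lam"
    and "\<bar>ip (at_z g) (at_z g) - (L2 g)\<^sup>2\<bar> \<le> (1/253) * R\<^sup>2"
    and "\<bar>ip e (at_z g)\<bar> \<le> (1/253) * R\<^sup>2"
proof -
  define a where "a = mu / (2 * R)"
  have a: "0 < a" using pos by (simp add: a_def)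
  let ?u = "\<lambda>z. a * g z"
  have u: "?u \<in> G" by (rule subspace_scale[OF G J g(1)])
  have "a * L2 g \<le> a * R" using a g by (intro mult_left_mono) auto
  also have "\<dots> \<le> mu" using pos by (simp add: a_def)
  finally have u2: "L2 ?u \<le> mu" using a by (simp add: L2norm_scale)
  have uJ: "Jnorm J ?u \<le> 1" using a g pos by (simp add: Jnorm_scale[OF G J g(1)]) (simp add: a_def field_simps)
  {
    assume j: "j < p"
    have "a * \<bar>ip (\<lambda>i. Xs \<omega> i j - h (Zs \<omega> i) j) (at_z g)\<bar> \<le> (1/1012) * mu * (lam / R)"
      using evB[OF j u u2 uJ] a by (simp add: ip_def at_z_def mult.left_commute sum_distrib_left[symmetric] abs_mult)
    also have "\<dots> = a * ((1/506) * lam)" using pos by (simp add: a_def)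
    finally have "\<bar>ip (\<lambda>i. Xs \<omega> i j - h (Zs \<omega> i) j) (at_z g)\<bar> \<le> (1/506) * lam" using a by simp
    then show "\<bar>ip (\<lambda>i. Xs \<omega> i j - h (Zs \<omega> i) j) (at_z g)\<bar> \<le> (1/253) * lam" using pos by simp
  }
  have "a\<^sup>2 * (ip (at_z g) (at_z g) - (L2 g)\<^sup>2) = (\<Sum>i<n. (?u (Zs \<omega> i))\<^sup>2) / real n - (L2 ?u)\<^sup>2"
    by (simp add: ip_def at_z_def L2norm_scale power_mult_distrib sum_distrib_left right_diff_distrib power2_eq_square mult_ac)
  then have "a\<^sup>2 * \<bar>ip (at_z g) (at_z g) - (L2 g)\<^sup>2\<bar> \<le> (1/1012) * mu\<^sup>2"
    using evC[OF u u2 uJ] by (metis abs_mult abs_power2)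
  also have "\<dots> = a\<^sup>2 * ((1/253) * R\<^sup>2)" using pos by (simp add: a_def power_divide power_mult_distrib)
  finally show "\<bar>ip (at_z g) (at_z g) - (L2 g)\<^sup>2\<bar> \<le> (1/253) * R\<^sup>2" using a by simp
  have "a * \<bar>ip e (at_z g)\<bar> \<le> (1/1012) * mu\<^sup>2"
    using evE[OF u u2 uJ] a by (simp add: ip_def at_z_def mult.left_commute sum_distrib_left[symmetric] abs_mult)
  also have "\<dots> = a * ((1/506) * (R * mu))" using pos by (simp add: a_def power2_eq_square)
  finally have "\<bar>ip e (at_z g)\<bar> \<le> (1/506) * (R * mu)" using a by simp
  also have "R * mu \<le> R * R" using mu_bounds pos by (intro mult_left_mono) auto
  finally show "\<bar>ip e (at_z g)\<bar> \<le> (1/253) * R\<^sup>2" by (simp add: power2_eq_square)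
qed

lemma ip_xb_swap: "ip a (xb v) = (\<Sum>j<p. ip a (\<lambda>i. Xs \<omega> i j - h (Zs \<omega> i) j) * v j)"
  unfolding ip_def xb_def sum_distrib_left sum_divide_distrib sum_distrib_right
  by (subst sum.swap) (simp add: mult_ac)

lemma cross_noise: "\<bar>ip e (xb v)\<bar> \<le> (1/253) * lam * N v"
  unfolding ip_xb_swap by (rule abs_sum_mult_le) (use evD in \<open>simp add: ip_def\<close>)

lemma cross_nonparametric:
  assumes g: "g \<in> G" "L2 g \<le> R" "mu * Jnorm J g \<le> 2 * R"
  shows "\<bar>ip (xb v) (at_z g)\<bar> \<le> (1/253) * lam * N v"
  unfolding ip_commute[of "xb v"] ip_xb_swap
  by (rule abs_sum_mult_le) (subst ip_commute, rule scaled_events(1)[OF g])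

lemma design_norm: "\<bar>ip (xb v) (xb v) - q v\<bar> \<le> (1/253) * lam * (N v)\<^sup>2"
proof -
  let ?x = "\<lambda>j i. Xs \<omega> i j - h (Zs \<omega> i) j"
  have "ip (xb v) (xb v) = (\<Sum>j<p. (\<Sum>k<p. ip (?x j) (?x k) * v k) * v j)"
    by (subst ip_xb_swap, subst ip_commute, subst ip_xb_swap) simp
  moreover have "q v = (\<Sum>j<p. (\<Sum>k<p. Sg j k * v k) * v j)"
    by (simp add: qform_def sum_distrib_left sum_distrib_right mult_ac)
  ultimately have "ip (xb v) (xb v) - q v = (\<Sum>j<p. (\<Sum>k<p. (ip (?x j) (?x k) - Sg j k) * v k) * v j)"
    by (simp add: sum_subtractf left_diff_distrib)
  also have "\<bar>\<dots>\<bar> \<le> ((1/253) * lam * N v) * N v"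
    by (intro abs_sum_mult_le) (use evA in \<open>simp add: ip_def\<close>)
  finally show ?thesis by (simp add: power2_eq_square mult.assoc)
qed

text \<open>The L2 constraint is on \<open>k + hb v\<close>, the part orthogonal to
  \<open>x - h(z)\<close>, whereas the seminorm constraint is on \<open>k\<close>, the part that the
  criterion penalises. Passing between them costs \<open>mu * Jh \<le> R / 22\<close>, since
  \<open>R\<^sup>2 \<le> lam\<close> forces \<open>N v \<le> 1\<close>.\<close>

definition localized :: "(nat \<Rightarrow> real) \<Rightarrow> ((nat \<Rightarrow> real) \<Rightarrow> real) \<Rightarrow> bool" where
  "localized v k \<longleftrightarrow> k \<in> G \<and> lam * N v \<le> R\<^sup>2 \<and> q v \<le> R\<^sup>2 \<and> L2 (\<lambda>z. k z + hb v z) \<le> R \<and> mu * Jnorm J k \<le> R"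

lemma localized_bounds:
  assumes l: "localized v k"
  shows "N v \<le> 1" "(\<lambda>z. k z + hb v z) \<in> G" "mu * Jnorm J (\<lambda>z. k z + hb v z) \<le> 2 * R"
proof -
  have k: "k \<in> G" using l by (simp add: localized_def)
  have "lam * N v \<le> lam * 1" using l R_le by (simp add: localized_def)
  then show N1: "N v \<le> 1" using pos by simp
  show "(\<lambda>z. k z + hb v z) \<in> G" by (rule subspace_add[OF G J k hb_G])
  have "Jnorm J (\<lambda>z. k z + hb v z) \<le> Jnorm J k + Jnorm J (hb v)" by (rule Jnorm_triangle[OF G J k hb_G])
  also have "\<dots> \<le> Jnorm J k + Jh * 1"
    using Jnorm_hb[of v] mult_left_mono[OF N1 pos(5)] by linarith
  finally have "mu * Jnorm J (\<lambda>z. k z + hb v z) \<le> mu * (Jnorm J k + Jh * 1)"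
    using pos by (intro mult_left_mono) auto
  also have "\<dots> \<le> R + R / 22" using l mu_bounds(3) by (simp add: localized_def distrib_left)
  finally show "mu * Jnorm J (\<lambda>z. k z + hb v z) \<le> 2 * R" using pos by simp
qed

text \<open>At the sample points this is \<open>X v + k\<close>, written in its orthogonal
  parts.\<close>

definition res :: "(nat \<Rightarrow> real) \<Rightarrow> ((nat \<Rightarrow> real) \<Rightarrow> real) \<Rightarrow> nat \<Rightarrow> real" where
  "res v k i = xb v i + at_z (\<lambda>z. k z + hb v z) i"

text \<open>A contraction: inside the ball all stochastic terms are small multiples of
  \<open>R\<^sup>2\<close>, so the basic inequality pushes the pair into a much smaller
  ball.\<close>

lemma localization_step:
  assumes l: "localized v k"
    and basic: "ip (res v k) (res v k) - 2 * ip e (res v k) + lam * (N (\<lambda>j. \<beta>0 j + v j) - N \<beta>0)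
      + mu\<^sup>2 * ((Jnorm J (\<lambda>z. g0 z + k z))\<^sup>2 - (Jnorm J g0)\<^sup>2) \<le> 0"
  shows "lam * N v \<le> R\<^sup>2 / 16" "q v \<le> (R / 4)\<^sup>2" "L2 (\<lambda>z. k z + hb v z) \<le> R / 4" "mu * Jnorm J k \<le> R / 4"
proof -
  let ?k = "\<lambda>z. k z + hb v z"
  let ?J = "Jnorm J (\<lambda>z. g0 z + k z)"
  have k: "k \<in> G" and b: "lam * N v \<le> R\<^sup>2" "L2 ?k \<le> R" using l by (auto simp: localized_def)
  note lb = localized_bounds[OF l]
  note ev = scaled_events[OF lb(2) b(2) lb(3)] cross_nonparametric[OF lb(2) b(2) lb(3), of v]
  have NN: "lam * (N v)\<^sup>2 \<le> R\<^sup>2"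
  proof -
    have "(lam * N v) * N v \<le> R\<^sup>2 * 1" using b lb(1) l1norm_nonneg by (intro mult_mono) auto
    then show ?thesis by (simp add: power2_eq_square mult.assoc)
  qed
  have rr: "ip (res v k) (res v k) = ip (xb v) (xb v) + 2 * ip (xb v) (at_z ?k) + ip (at_z ?k) (at_z ?k)"
    using ip_sq_lin[of "xb v" 1 "at_z ?k"] by (simp add: res_def[abs_def])
  have er: "ip e (res v k) = ip e (xb v) + ip e (at_z ?k)"
    using ip_add_right by (simp add: res_def[abs_def])
  have g0b: "mu\<^sup>2 * (Jnorm J g0)\<^sup>2 \<le> R\<^sup>2 / 484"
    using power_mono[OF mu_bounds(2), of 2] pos Jnorm_nonneg[OF G J g0] by (simp add: power_mult_distrib power_divide)
  have lamd: "lam * (N \<beta>0 - N (\<lambda>j. \<beta>0 j + v j)) \<le> lam * on_supp v - lam * off_supp v"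
    using mult_left_mono[OF N_diff, of lam v] pos by (simp add: right_diff_distrib)
  \<comment> \<open>Count of the 8/253: one from the design norm, two from the cross term, one from
    the empirical norm of \<open>k + hb v\<close>, four from the doubled noise terms. The 1/484
    comes from the penalty of \<open>g0\<close>.\<close>
  have main: "q v + (L2 ?k)\<^sup>2 + lam * off_supp v + mu\<^sup>2 * ?J\<^sup>2 \<le> 8/253 * R\<^sup>2 + R\<^sup>2 / 484 + lam * on_supp v"
  proof -
    have bounds: "\<bar>ip (xb v) (xb v) - q v\<bar> \<le> R\<^sup>2 / 253" "\<bar>ip (xb v) (at_z ?k)\<bar> \<le> R\<^sup>2 / 253"
      "\<bar>ip (at_z ?k) (at_z ?k) - (L2 ?k)\<^sup>2\<bar> \<le> R\<^sup>2 / 253"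
      "\<bar>ip e (at_z ?k)\<bar> \<le> R\<^sup>2 / 253" "\<bar>ip e (xb v)\<bar> \<le> R\<^sup>2 / 253"
      using design_norm[of v] NN ev(2-4) cross_noise[of v] b(1) by simp_all
    have "ip (xb v) (xb v) + 2 * ip (xb v) (at_z ?k) + ip (at_z ?k) (at_z ?k)
        - 2 * (ip e (xb v) + ip e (at_z ?k)) + (lam * N (\<lambda>j. \<beta>0 j + v j) - lam * N \<beta>0)
        + (mu\<^sup>2 * ?J\<^sup>2 - mu\<^sup>2 * (Jnorm J g0)\<^sup>2) \<le> 0"
      using basic unfolding rr er right_diff_distrib .
    moreover have "q v \<le> ip (xb v) (xb v) + R\<^sup>2 / 253" "- (2 * ip (xb v) (at_z ?k)) \<le> 2 * (R\<^sup>2 / 253)"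
      "(L2 ?k)\<^sup>2 \<le> ip (at_z ?k) (at_z ?k) + R\<^sup>2 / 253"
      "2 * (ip e (xb v) + ip e (at_z ?k)) \<le> 4 * (R\<^sup>2 / 253)"
      using abs_le_D2[OF bounds(1)] abs_le_D2[OF bounds(2)] abs_le_D2[OF bounds(3)]
        abs_le_D1[OF bounds(4)] abs_le_D1[OF bounds(5)] by (simp_all add: algebra_simps)
    ultimately show ?thesis using lamd g0b unfolding right_diff_distrib by linarith
  qed
  note am = on_supp_am_gm(1)[of v]
  have nn: "0 \<le> lam * off_supp v" "0 \<le> mu\<^sup>2 * ?J\<^sup>2" "0 \<le> (L2 ?k)\<^sup>2" "0 \<le> R\<^sup>2"
    using supp_nonneg pos by auto
  have qb: "q v \<le> R\<^sup>2 / 16" using main am M_le nn by linarith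
  then show "q v \<le> (R / 4)\<^sup>2" by (simp add: power_divide)
  have "lam * on_supp v + lam * off_supp v \<le> R\<^sup>2 / 16" using main am M_le nn qb q_nonneg[of v] by linarith
  then show "lam * N v \<le> R\<^sup>2 / 16" by (simp add: N_split distrib_left)
  have "(L2 ?k)\<^sup>2 \<le> R\<^sup>2 / 16" using main am M_le nn q_nonneg[of v] by linarith
  then have "(L2 ?k)\<^sup>2 \<le> (R / 4)\<^sup>2" by (simp add: power_divide)
  then show "L2 ?k \<le> R / 4" by (rule power2_le_imp_le) (use pos in simp)
  \<comment> \<open>1/25 instead of 1/16 leaves room for \<open>g0\<close> in the triangle
    inequality below: 1/5 + 1/22 is at most 1/4.\<close>
  have "mu\<^sup>2 * ?J\<^sup>2 \<le> R\<^sup>2 / 25" using main am M_le nn q_nonneg[of v] by linarith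
  then have "(mu * ?J)\<^sup>2 \<le> (R * (1/5))\<^sup>2" by (simp add: power_mult_distrib power_divide)
  then have Jb: "mu * ?J \<le> R * (1/5)" by (rule power2_le_imp_le) (use pos in simp)
  have gk: "(\<lambda>z. g0 z + k z) \<in> G" by (rule subspace_add[OF G J g0 k])
  have "Jnorm J (\<lambda>z. (g0 z + k z) + (-1) * g0 z) \<le> ?J + Jnorm J (\<lambda>z. (-1) * g0 z)"
    by (rule Jnorm_triangle[OF G J gk subspace_scale[OF G J g0]])
  moreover have "(\<lambda>z. (g0 z + k z) + (-1) * g0 z) = k" by auto
  moreover have "Jnorm J (\<lambda>z. (-1) * g0 z) = Jnorm J g0" using Jnorm_scale[OF G J g0, of "-1"] by (simp only: abs_neg_one mult_1_left)
  ultimately have "Jnorm J k \<le> ?J + Jnorm J g0" by (simp only:)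
  then have "mu * Jnorm J k \<le> mu * (?J + Jnorm J g0)" using pos by (intro mult_left_mono) auto
  then have "mu * Jnorm J k \<le> mu * ?J + mu * Jnorm J g0" by (simp only: distrib_left)
  then show "mu * Jnorm J k \<le> R / 4" using Jb mu_bounds(2) pos by linarith
qed

section \<open>From minimality to localisation\<close>

lemma criterion_eq:
  "criterion n p J \<beta>0 g0 lam mu \<omega> (\<lambda>j. \<beta>0 j + v j) (\<lambda>z. g0 z + k z)
    = ip (\<lambda>i. e i + (-1) * res v k i) (\<lambda>i. e i + (-1) * res v k i) + lam * N (\<lambda>j. \<beta>0 j + v j)
      + mu\<^sup>2 * (Jnorm J (\<lambda>z. g0 z + k z))\<^sup>2"
proof -
  have "Ys p \<beta>0 g0 \<omega> i - (\<Sum>j<p. Xs \<omega> i j * (\<beta>0 j + v j)) - (g0 (Zs \<omega> i) + k (Zs \<omega> i))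
      = e i + (-1) * res v k i" for i
    by (simp add: Ys_def res_def xb_def hb_def at_z_def sum.distrib sum_subtractf algebra_simps)
  then show ?thesis by (simp add: criterion_def emp_sq_ip)
qed

text \<open>The comparison with the truth survives shrinking the error by any \<open>s\<close> in
  the unit interval: the l1 norm is convex along the segment, and the quadratic terms scale with
  \<open>s\<^sup>2 \<le> s\<close>. The \<open>+ 0\<close> gives the truth the shape required by
  \<open>criterion_eq\<close>.\<close>

lemma basic_inequality:
  assumes k: "k \<in> G" and s: "0 \<le> s" "s \<le> 1"
    and min: "criterion n p J \<beta>0 g0 lam mu \<omega> (\<lambda>j. \<beta>0 j + b j) (\<lambda>z. g0 z + k z)
      \<le> criterion n p J \<beta>0 g0 lam mu \<omega> (\<lambda>j. \<beta>0 j + 0) (\<lambda>z. g0 z + 0)"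
  defines "v \<equiv> \<lambda>j. s * b j" and "f \<equiv> \<lambda>z. s * k z"
  shows "ip (res v f) (res v f) - 2 * ip e (res v f) + lam * (N (\<lambda>j. \<beta>0 j + v j) - N \<beta>0)
      + mu\<^sup>2 * ((Jnorm J (\<lambda>z. g0 z + f z))\<^sup>2 - (Jnorm J g0)\<^sup>2) \<le> 0"
proof -
  define r where "r = res b k"
  have rs: "res v f = (\<lambda>i. s * r i)"
    by (rule ext) (simp add: res_def r_def v_def f_def xb_scale hb_scale at_z_def algebra_simps)
  have r0: "res (\<lambda>_. 0) (\<lambda>_. 0) = (\<lambda>_. 0)"
    by (rule ext) (simp add: res_def xb_def at_z_def hb_def)
  have J2: "(Jnorm J (\<lambda>z. g0 z + t * k z))\<^sup>2 = J g0 g0 + 2 * t * J g0 k + t\<^sup>2 * J k k" for t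
    using semi_inner_quadratic[OF G J g0 k, of 1 t] subspace_add[OF G J g0 subspace_scale[OF G J k]]
    by (simp add: Jnorm_square[OF G J])
  have J0: "(Jnorm J g0)\<^sup>2 = J g0 g0" by (rule Jnorm_square[OF G J g0])
  have Jk: "0 \<le> J k k" by (rule semi_inner_nonneg[OF G J k])
  have "ip r r - 2 * ip e r + lam * (N (\<lambda>j. \<beta>0 j + b j) - N \<beta>0) + mu\<^sup>2 * (2 * J g0 k + J k k) \<le> 0"
    using min unfolding criterion_eq r_def[symmetric] r0
    using J2[of 1] J0 by (simp add: ip_sq_lin[of e "-1" r, simplified] algebra_simps)
  then have "s * (ip r r - 2 * ip e r + lam * (N (\<lambda>j. \<beta>0 j + b j) - N \<beta>0) + mu\<^sup>2 * (2 * J g0 k + J k k)) \<le> 0"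
    using s by (simp add: mult_nonneg_nonpos)
  moreover have "lam * N (\<lambda>j. \<beta>0 j + v j) \<le> lam * ((1 - s) * N \<beta>0 + s * N (\<lambda>j. \<beta>0 j + b j))"
    unfolding v_def using pos s by (intro mult_left_mono l1norm_convex) auto
  moreover have "(s - s\<^sup>2) * (ip r r + mu\<^sup>2 * J k k) \<ge> 0"
    using s ip_nonneg[of r] Jk by (intro mult_nonneg_nonneg) (auto simp: power2_eq_square mult_left_le)
  ultimately show ?thesis
    unfolding rs unfolding f_def J2 J0 ip_scale_right ip_commute[of "\<lambda>i. s * r i"]
    by (simp add: algebra_simps power2_eq_square)
qed

text \<open>If the error left the ball, the sum \<open>T\<close> of its four normalised sizes would
  exceed 1. Shrinking by \<open>1 / T\<close> brings that sum to exactly 1 and the pair into the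
  ball, where \<open>localization_step\<close> bounds the same sum by 1/16 + 3/4, a
  contradiction.\<close>

lemma minimizer_local:
  assumes k: "k \<in> G"
    and min: "criterion n p J \<beta>0 g0 lam mu \<omega> (\<lambda>j. \<beta>0 j + b j) (\<lambda>z. g0 z + k z)
      \<le> criterion n p J \<beta>0 g0 lam mu \<omega> (\<lambda>j. \<beta>0 j + 0) (\<lambda>z. g0 z + 0)"
  shows "localized b k"
proof (rule ccontr)
  assume notl: "\<not> localized b k"
  define t1 where "t1 = lam * N b / R\<^sup>2"
  define t2 where "t2 = sqrt (q b) / R"
  define t3 where "t3 = L2 (\<lambda>z. k z + hb b z) / R"
  define t4 where "t4 = mu * Jnorm J k / R"
  define T where "T = t1 + t2 + t3 + t4"
  have t: "0 \<le> t1" "0 \<le> t2" "0 \<le> t3" "0 \<le> t4"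
    using pos l1norm_nonneg q_nonneg L2norm_nonneg Jnorm_nonneg[OF G J k]
    by (auto simp: t1_def t2_def t3_def t4_def)
  have e1: "lam * N b = t1 * R\<^sup>2" and e2: "q b = (t2 * R)\<^sup>2" and e3: "L2 (\<lambda>z. k z + hb b z) = t3 * R"
    and e4: "mu * Jnorm J k = t4 * R"
    using pos q_nonneg[of b] by (auto simp: t1_def t2_def t3_def t4_def)
  have "T > 1"
  proof (rule ccontr)
    assume "\<not> T > 1"
    then have "t1 \<le> 1" "t2 \<le> 1" "t3 \<le> 1" "t4 \<le> 1" using t by (auto simp: T_def)
    moreover from this(2) have "(t2 * R)\<^sup>2 \<le> (1 * R)\<^sup>2"
      using t pos by (intro power_mono mult_right_mono) auto
    ultimately have "localized b k"
      unfolding localized_def e1 e2 e3 e4 using k pos by simp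
    then show False using notl by simp
  qed
  define s where "s = 1 / T"
  have s: "0 < s" "s \<le> 1" "s * T = 1" using \<open>T > 1\<close> by (auto simp: s_def)
  have st: "s * t1 \<le> 1" "s * t2 \<le> 1" "s * t3 \<le> 1" "s * t4 \<le> 1"
  proof -
    have *: "s * x \<le> 1" if "x \<le> T" for x using mult_left_mono[OF that, of s] s by simp
    show "s * t1 \<le> 1" "s * t2 \<le> 1" "s * t3 \<le> 1" "s * t4 \<le> 1"
      by (rule *, use t in \<open>simp add: T_def\<close>)+
  qed
  let ?v = "\<lambda>j. s * b j" and ?f = "\<lambda>z. s * k z"
  have f1: "lam * N ?v = (s * t1) * R\<^sup>2" using e1 s by (simp add: l1norm_scale mult_ac)
  have f2: "q ?v = (s * t2 * R)\<^sup>2" using e2 by (simp add: q_scale power_mult_distrib)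
  have f3: "L2 (\<lambda>z. ?f z + hb ?v z) = (s * t3) * R"
  proof -
    have "(\<lambda>z. ?f z + hb ?v z) = (\<lambda>z. s * (k z + hb b z))"
      by (simp add: hb_scale distrib_left)
    then show ?thesis using e3 s by (simp add: L2norm_scale)
  qed
  have f4: "mu * Jnorm J ?f = (s * t4) * R" using e4 s by (simp add: Jnorm_scale[OF G J k] mult_ac)
  have "(s * t2 * R)\<^sup>2 \<le> (1 * R)\<^sup>2"
    using st s t pos by (intro power_mono mult_right_mono) auto
  then have "localized ?v ?f"
    unfolding localized_def f1 f2 f3 f4 using st pos subspace_scale[OF G J k] by simp
  note L = localization_step[OF this basic_inequality[OF k _ s(2) min]]
  have "s * t1 \<le> 1/16"
    using L(1) s pos unfolding f1 by simp
  moreover have "s * t2 \<le> 1/4"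
  proof -
    have "(s * t2 * R)\<^sup>2 \<le> (R / 4)\<^sup>2" using L(2) s unfolding f2 by simp
    then have "s * t2 * R \<le> R / 4" by (rule power2_le_imp_le) (use pos in simp)
    then show ?thesis using pos by simp
  qed
  moreover have "s * t3 \<le> 1/4" using L(3) s pos unfolding f3 by simp
  moreover have "s * t4 \<le> 1/4" using L(4) s pos unfolding f4 by simp
  ultimately have "s * T < 1" by (simp add: T_def distrib_left)
  then show False using s by simp
qed

text \<open>First-order optimality along the direction that moves \<open>\<beta>\<close> towards \<open>\<beta>0\<close> and compensates
  in the nonparametric part by \<open>h\<close>, so that only \<open>x - h(z)\<close> enters.\<close>

lemma first_order_condition:
  assumes k: "k \<in> G"
    and min: "\<And>\<beta>' g'. g' \<in> G \<Longrightarrow> criterion n p J \<beta>0 g0 lam mu \<omega> (\<lambda>j. \<beta>0 j + b j) (\<lambda>z. g0 z + k z)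
      \<le> criterion n p J \<beta>0 g0 lam mu \<omega> \<beta>' g'"
  defines "g \<equiv> \<lambda>z. g0 z + k z"
  shows "2 * ip (xb b) (xb b) \<le> 2 * ip e (xb b) - 2 * ip (xb b) (at_z (\<lambda>z. k z + hb b z))
    + lam * (N \<beta>0 - N (\<lambda>j. \<beta>0 j + b j)) + 2 * mu\<^sup>2 * J g (hb b)"
proof -
  let ?X = "xb b" and ?r = "\<lambda>i. e i + (-1) * res b k i"
  have g: "g \<in> G" unfolding g_def by (rule subspace_add[OF G J g0 k])
  have "0 \<le> s * (2 * ip ?r ?X + lam * (N \<beta>0 - N (\<lambda>j. \<beta>0 j + b j)) + 2 * mu\<^sup>2 * J g (hb b))
      + s\<^sup>2 * (ip ?X ?X + mu\<^sup>2 * J (hb b) (hb b))" if s: "0 < s" "s \<le> 1" for s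
  proof -
    \<comment> \<open>The two changes compensate:
      \<open>(k + s * hb b) + (1 - s) * hb b = k + hb b\<close>. Hence the residual moves by
      \<open>s * xb b\<close> alone.\<close>
    let ?v = "\<lambda>j. (1 - s) * b j" and ?k = "\<lambda>z. k z + s * hb b z"
    have kG: "?k \<in> G" by (rule subspace_add[OF G J k subspace_scale[OF G J hb_G]])
    have gk: "(\<lambda>z. g0 z + ?k z) \<in> G" by (rule subspace_add[OF G J g0 kG])
    have r: "(\<lambda>i. e i + (-1) * res ?v ?k i) = (\<lambda>i. ?r i + s * ?X i)"
      by (rule ext) (simp only: res_def xb_scale hb_scale at_z_def, simp add: algebra_simps)
    have "(\<lambda>z. g0 z + ?k z) = (\<lambda>z. 1 * g z + s * hb b z)" by (simp add: g_def add.assoc)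
    then have J1: "(Jnorm J (\<lambda>z. g0 z + ?k z))\<^sup>2 = J g g + 2 * s * J g (hb b) + s\<^sup>2 * J (hb b) (hb b)"
      using semi_inner_quadratic[OF G J g hb_G, of 1 s b] Jnorm_square[OF G J gk] by simp
    have J0: "(Jnorm J (\<lambda>z. g0 z + k z))\<^sup>2 = J g g"
      using Jnorm_square[OF G J g] by (simp add: g_def)
    have "lam * N (\<lambda>j. \<beta>0 j + ?v j) \<le> lam * (s * N \<beta>0 + (1 - s) * N (\<lambda>j. \<beta>0 j + b j))"
      using l1norm_convex[of "1 - s" p \<beta>0 b] s pos by (intro mult_left_mono) auto
    moreover have "ip ?r ?r + lam * N (\<lambda>j. \<beta>0 j + b j) + mu\<^sup>2 * J g g
       \<le> (ip ?r ?r + 2 * s * ip ?r ?X + s\<^sup>2 * ip ?X ?X) + lam * N (\<lambda>j. \<beta>0 j + ?v j)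
        + mu\<^sup>2 * (J g g + 2 * s * J g (hb b) + s\<^sup>2 * J (hb b) (hb b))"
      using min[OF gk, of "\<lambda>j. \<beta>0 j + ?v j"] unfolding criterion_eq r J1 J0 ip_sq_lin[of ?r s ?X] .
    ultimately show ?thesis by (simp add: algebra_simps)
  qed
  then have "0 \<le> 2 * ip ?r ?X + lam * (N \<beta>0 - N (\<lambda>j. \<beta>0 j + b j)) + 2 * mu\<^sup>2 * J g (hb b)"
    by (rule nonneg_if_first_order)
  moreover have "ip ?r ?X = ip e ?X - ip ?X ?X - ip ?X (at_z (\<lambda>z. k z + hb b z))"
  proof -
    have "ip ?X ?r = ip ?X e + ip ?X (\<lambda>i. (-1) * res b k i)" by (rule ip_add_right)
    also have "ip ?X (\<lambda>i. (-1) * res b k i) = (-1) * ip ?X (res b k)" by (rule ip_scale_right)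
    also have "ip ?X (res b k) = ip ?X ?X + ip ?X (at_z (\<lambda>z. k z + hb b z))"
      unfolding res_def[abs_def] by (rule ip_add_right)
    finally have "ip ?r ?X = ip ?X e + (-1) * (ip ?X ?X + ip ?X (at_z (\<lambda>z. k z + hb b z)))"
      by (simp only: ip_commute[of ?r ?X])
    then show ?thesis by (simp add: ip_commute[of ?X e])
  qed
  ultimately show ?thesis by simp
qed

lemma oracle_inequality:
  assumes "is_minimizer n p G J \<beta>0 g0 lam mu \<omega> \<beta> g"
  shows "emp_sq n (\<lambda>i. \<Sum>j<p. (Xs \<omega> i j - h (Zs \<omega> i) j) * (\<beta> j - \<beta>0 j))
      + lam / 4 * l1norm p (\<lambda>j. \<beta> j - \<beta>0 j)
    \<le> real (card {j\<in>{..<p}. \<beta>0 j \<noteq> 0}) * lam\<^sup>2 / LX\<^sup>2"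
proof -
  define b where "b j = \<beta> j - \<beta>0 j" for j
  define k where "k z = g z - g0 z" for z
  have gG: "g \<in> G" using assms by (simp add: is_minimizer_def)
  have k: "k \<in> G" unfolding k_def by (rule subspace_diff[OF G J gG g0])
  have \<beta>b: "\<beta> = (\<lambda>j. \<beta>0 j + b j)" and gk: "g = (\<lambda>z. g0 z + k z)" by (auto simp: b_def k_def)
  have min: "criterion n p J \<beta>0 g0 lam mu \<omega> (\<lambda>j. \<beta>0 j + b j) (\<lambda>z. g0 z + k z)
      \<le> criterion n p J \<beta>0 g0 lam mu \<omega> \<beta>' g'" if "g' \<in> G" for \<beta>' g'
    using assms that unfolding is_minimizer_def \<beta>b[symmetric] gk[symmetric] by blast
  have l: "localized b k"
    by (rule minimizer_local[OF k min]) (use g0 in simp)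
  note lb = localized_bounds[OF l]
  have b2: "L2 (\<lambda>z. k z + hb b z) \<le> R" "mu * Jnorm J k \<le> R" using l by (auto simp: localized_def)
  let ?a = "ip (xb b) (xb b)"
  \<comment> \<open>Cauchy-Schwarz for \<open>J\<close> with
    \<open>mu * Jnorm J g \<le> 23/22 * R\<close> and \<open>mu * Jh \<le> R / 22\<close>; the
    product of these is below \<open>R\<^sup>2 / 20\<close>, and \<open>R\<^sup>2 \<le> lam\<close>
    turns it into a share of the l1 penalty.\<close>
  have pen: "mu\<^sup>2 * J g (hb b) \<le> lam * N b / 20"
  proof -
    have "Jnorm J g \<le> Jnorm J g0 + Jnorm J k" unfolding gk by (rule Jnorm_triangle[OF G J g0 k])
    then have "mu * Jnorm J g \<le> mu * (Jnorm J g0 + Jnorm J k)" using pos by (intro mult_left_mono) auto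
    then have "mu * Jnorm J g \<le> mu * Jnorm J g0 + mu * Jnorm J k" by (simp only: distrib_left)
    then have Jg: "mu * Jnorm J g \<le> 23 / 22 * R" using mu_bounds(2) b2(2) by linarith
    have "J g (hb b) \<le> Jnorm J g * Jnorm J (hb b)"
      using semi_inner_Cauchy_Schwarz[OF G J gG hb_G, of b] by linarith
    also have "\<dots> \<le> Jnorm J g * (Jh * N b)"
      using Jnorm_hb Jnorm_nonneg[OF G J gG] by (intro mult_left_mono)
    finally have "mu\<^sup>2 * J g (hb b) \<le> mu\<^sup>2 * (Jnorm J g * (Jh * N b))" by (intro mult_left_mono) auto
    also have "\<dots> = ((mu * Jnorm J g) * (mu * Jh)) * N b" by (simp add: power2_eq_square mult_ac)
    also have "\<dots> \<le> ((23 / 22 * R) * (R / 22)) * N b"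
      using pos l1norm_nonneg by (intro mult_right_mono[OF mult_mono[OF Jg mu_bounds(3)]]) auto
    also have "\<dots> = (23 / 484 * R\<^sup>2) * N b" by (simp add: power2_eq_square)
    also have "\<dots> \<le> (1 / 20 * lam) * N b"
      using R_le pos l1norm_nonneg by (intro mult_right_mono) auto
    finally show ?thesis by simp
  qed
  have lamd: "lam * (N \<beta>0 - N (\<lambda>j. \<beta>0 j + b j)) \<le> lam * on_supp b - lam * off_supp b"
    using mult_left_mono[OF N_diff, of lam b] pos by (simp add: right_diff_distrib)
  \<comment> \<open>Localisation gives \<open>N b \<le> 1\<close>, so the quadratic l1 error of the
    design norm becomes linear.\<close>
  have qa: "q b \<le> ?a + (1/253) * lam * N b"
  proof -
    have "lam * (N b)\<^sup>2 \<le> lam * N b"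
      using lb(1) l1norm_nonneg[of p b] pos by (simp add: power2_eq_square mult_left_le)
    then have "\<bar>?a - q b\<bar> \<le> (1/253) * lam * N b" using design_norm[of b] by simp
    then show ?thesis by linarith
  qed
  have NS: "lam * N b = lam * on_supp b + lam * off_supp b" by (simp add: N_split distrib_left)
  have "0 \<le> lam * N b" using pos l1norm_nonneg by simp
  moreover have "2 * ?a \<le> 2 * ip e (xb b) - 2 * ip (xb b) (at_z (\<lambda>z. k z + hb b z))
    + lam * (N \<beta>0 - N (\<lambda>j. \<beta>0 j + b j)) + 2 * (mu\<^sup>2 * J g (hb b))"
    using first_order_condition[OF k min, unfolded gk[symmetric]] by (simp only: mult.assoc)
  moreover have "\<bar>ip e (xb b)\<bar> \<le> (lam * N b) / 253" "\<bar>ip (xb b) (at_z (\<lambda>z. k z + hb b z))\<bar> \<le> (lam * N b) / 253"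
    "q b \<le> ?a + (lam * N b) / 253"
    using cross_noise[of b] cross_nonparametric[OF lb(2) b2(1) lb(3), of b] qa by simp_all
  \<comment> \<open>The penalty difference is at most
    \<open>2 * lam * on_supp b - lam * N b\<close>. The first term is at most
    \<open>M + q b\<close>, and replacing \<open>q b\<close> by \<open>?a\<close> uses up one of the
    two \<open>?a\<close> on the left. The small multiples of \<open>lam * N b\<close> still leave
    more than a quarter of it.\<close>
  ultimately have "?a + (lam * N b) / 4 \<le> M"
    using lamd pen on_supp_am_gm(2)[of b] NS by linarith
  then have "?a + lam / 4 * N b \<le> M" by simp
  moreover have "emp_sq n (\<lambda>i. \<Sum>j<p. (Xs \<omega> i j - h (Zs \<omega> i) j) * (\<beta> j - \<beta>0 j)) = ?a"
    by (simp add: emp_sq_ip xb_def[abs_def] b_def)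
  ultimately show ?thesis by (simp add: M_def b_def[abs_def] mult.commute)
qed

end

section \<open>Choice of the constants\<close>

text \<open>\<open>\<kappa>T\<close> solves the entropy balance: equality means that
  \<open>mu\<close> to the power \<open>2 + 1/m\<close> equals \<open>4 * A / (c * n)\<close>, and
  raising to \<open>2 * m / (2 * m + 1)\<close> isolates \<open>mu\<^sup>2\<close>.\<close>

lemma rate_from_kappa:
  fixes A c m mu :: real and n :: nat
  assumes "A > 0" "c > 0" "m > 1/2" "mu > 0" "n > 0"
    and k: "(4 * A / c) powr (2 * m / (2 * m + 1)) * real n powr (-(2*m)/(2*m+1)) \<le> mu\<^sup>2"
  shows "A * mu powr (-1/m) \<le> c / 4 * (real n * mu\<^sup>2)"
proof -
  let ?e = "2 * m / (2 * m + 1)"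
  have e: "0 < ?e" using assms by simp
  have "(4 * A / c / real n) powr ?e = (4 * A / c) powr ?e * real n powr (-(2*m)/(2*m+1))"
  proof -
    have "-(2*m)/(2*m+1) = - ?e" by simp
    then have "real n powr (-(2*m)/(2*m+1)) = 1 / real n powr ?e" by (simp only: powr_minus_divide)
    moreover have "(4 * A / c / real n) powr ?e = (4 * A / c) powr ?e / real n powr ?e"
      by (rule powr_divide)
    ultimately show ?thesis by simp
  qed
  with k have "(4 * A / c / real n) powr ?e \<le> mu\<^sup>2" by simp
  then have "((4 * A / c / real n) powr ?e) powr (1 / ?e) \<le> (mu\<^sup>2) powr (1 / ?e)"
    by (intro powr_mono2 order_less_imp_le[OF divide_pos_pos[OF zero_less_one e]]) auto
  moreover have "((4 * A / c / real n) powr ?e) powr (1 / ?e) = 4 * A / c / real n"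
    using e assms by (subst powr_powr) simp
  moreover have "(mu\<^sup>2) powr (1 / ?e) = mu\<^sup>2 * mu powr (1 / m)"
  proof -
    have "(mu\<^sup>2) powr (1 / ?e) = (mu powr 2) powr (1 / ?e)" using assms by (simp add: powr_numeral)
    also have "\<dots> = mu powr (2 * (1 / ?e))" by (rule powr_powr)
    also have "2 * (1 / ?e) = 2 + 1 / m" using assms by (simp add: field_simps)
    also have "mu powr (2 + 1 / m) = mu\<^sup>2 * mu powr (1 / m)"
      using assms by (simp add: powr_add powr_numeral)
    finally show ?thesis .
  qed
  ultimately have "4 * A / c / real n \<le> mu\<^sup>2 * mu powr (1 / m)" by simp
  then have "A \<le> c / 4 * (real n * mu\<^sup>2) * mu powr (1 / m)"
    using assms by (simp add: field_simps)
  then have "A * mu powr (-1/m) \<le> (c / 4 * (real n * mu\<^sup>2) * mu powr (1 / m)) * mu powr (-1/m)"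
    by (rule mult_right_mono) simp
  also have "\<dots> = c / 4 * (real n * mu\<^sup>2)"
    using assms by (simp add: mult.assoc powr_add[symmetric])
  finally show ?thesis .
qed

text \<open>With \<open>x = n * dT\<^sup>2 * mu\<^sup>2\<close> and \<open>l = ln (2 * p)\<close>,
  the 12 in \<open>dT\<close> gives \<open>12 * x \<le> c * n * mu\<^sup>2\<close> and
  \<open>24 * l \<le> c * n * lam\<^sup>2\<close>. Half of the exponent then covers \<open>x\<close>
  for the final bound, \<open>2 * x \<ge> 2\<close> for the numerical factors, and for the design
  also \<open>l\<close> for the union over columns. The covariance and noise entries get
  \<open>exp (- 4 * l)\<close>, which absorbs \<open>p\<^sup>2\<close>.\<close>

lemma failure_probability:
  fixes c dT mu lam \<rho> \<nu> m Kt :: real and n p :: nat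
  assumes c: "c > 0" "c \<le> 1" "c \<le> (1/1012)\<^sup>2 / Kt ^ 4" and m: "m > 0" and Kt: "1 \<le> Kt"
    and dT: "dT\<^sup>2 = c / (12 + 2 * m)" and n: "n > 0" and p: "p > 0"
    and x: "1 \<le> real n * dT\<^sup>2 * mu\<^sup>2" and mu: "0 < mu" "mu \<le> 1" and \<rho>: "mu \<le> \<rho>" "lam \<le> \<rho>"
    and lam: "0 < lam" "2 * ln (2 * real p) \<le> real n * (dT\<^sup>2 * lam\<^sup>2)"
    and \<nu>: "\<nu> = (1/253) * lam"
  shows "8 * exp (- (c * real n * mu\<^sup>2 / 2)) + exp (- real n)
      + real p * (4 * exp (- (c * real n * \<rho>\<^sup>2 / 2)))
      + (real p)\<^sup>2 * (2 * exp (- (real n * \<nu>\<^sup>2 / (16 * Kt ^ 4))))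
      + real p * (2 * exp (- (real n * \<nu>\<^sup>2 / (4 * Kt\<^sup>2))))
    \<le> 2 / real p + 6 * exp (- real n * dT\<^sup>2 * mu\<^sup>2)"
proof -
  define x where "x = real n * dT\<^sup>2 * mu\<^sup>2"
  define l where "l = ln (2 * real p)"
  have x1: "1 \<le> x" using assms(9) by (simp add: x_def)
  have p1: "1 \<le> real p" using p by simp
  then have l0: "0 \<le> l" by (simp add: l_def)
  have cd: "c = (12 + 2 * m) * dT\<^sup>2" using dT m by (simp add: field_simps)
  have c12: "12 * dT\<^sup>2 \<le> c" unfolding cd using m by (intro mult_right_mono) auto
  have el: "exp (- l) = 1 / (2 * real p)" using p1 by (simp add: l_def exp_minus inverse_eq_divide)
  have cmu: "12 * x \<le> c * (real n * mu\<^sup>2)"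
  proof -
    have "12 * x = (12 * dT\<^sup>2) * (real n * mu\<^sup>2)" by (simp add: x_def)
    also have "\<dots> \<le> c * (real n * mu\<^sup>2)" using c12 by (intro mult_right_mono) auto
    finally show ?thesis .
  qed
  have clam: "24 * l \<le> c * (real n * lam\<^sup>2)"
  proof -
    have "24 * l \<le> (12 * dT\<^sup>2) * (real n * lam\<^sup>2)" using lam(2) by (simp add: l_def algebra_simps)
    also have "\<dots> \<le> c * (real n * lam\<^sup>2)" using c12 by (intro mult_right_mono) auto
    finally show ?thesis .
  qed
  have e4: "4 * exp (- (2 * x)) \<le> 1"
  proof -
    have "exp (2 * x) \<ge> exp 2" using x1 by simp
    moreover have "1 + 2 + 2\<^sup>2 / 2 \<le> exp (2::real)" by (rule exp_lower_Taylor_quadratic) simp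
    then have "4 \<le> exp (2::real)" by simp
    ultimately have "4 \<le> exp (2 * x)" by linarith
    then show ?thesis by (simp add: exp_minus field_simps)
  qed
  have t1: "8 * exp (- (c * real n * mu\<^sup>2 / 2)) \<le> 2 * exp (- x)"
  proof -
    have "exp (- (c * real n * mu\<^sup>2 / 2)) \<le> exp (- (2 * x) + - x)" using cmu x1 by (simp add: mult.assoc)
    also have "\<dots> = exp (- (2 * x)) * exp (- x)" by (rule exp_add)
    finally have "8 * exp (- (c * real n * mu\<^sup>2 / 2)) \<le> 2 * ((4 * exp (- (2 * x))) * exp (- x))" by simp
    also have "\<dots> \<le> 2 * (1 * exp (- x))" using e4 by (intro mult_left_mono mult_right_mono) auto
    finally show ?thesis by simp
  qed
  have t2: "exp (- real n) \<le> exp (- x)"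
  proof -
    have "dT\<^sup>2 \<le> 1" using c12 c(2) by (smt (verit) zero_le_power2)
    moreover have "mu\<^sup>2 \<le> 1" using mu by (simp add: power_le_one)
    ultimately have "dT\<^sup>2 * mu\<^sup>2 \<le> 1 * 1" by (intro mult_mono) auto
    then have "real n * (dT\<^sup>2 * mu\<^sup>2) \<le> real n * 1" by (intro mult_left_mono) auto
    then show ?thesis by (simp add: x_def mult.assoc)
  qed
  have t3: "real p * (4 * exp (- (c * real n * \<rho>\<^sup>2 / 2))) \<le> exp (- x)"
  proof -
    have "mu\<^sup>2 \<le> \<rho>\<^sup>2" "lam\<^sup>2 \<le> \<rho>\<^sup>2" using mu lam \<rho> by (auto intro!: power_mono)
    then have "c * (real n * mu\<^sup>2) \<le> c * (real n * \<rho>\<^sup>2)" "c * (real n * lam\<^sup>2) \<le> c * (real n * \<rho>\<^sup>2)"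
      using c by (auto intro!: mult_left_mono)
    then have "(2 * x + x) + l \<le> c * real n * \<rho>\<^sup>2 / 2" using cmu clam l0 by (simp add: mult.assoc)
    then have "exp (- (c * real n * \<rho>\<^sup>2 / 2)) \<le> exp (- (2 * x) + (- x) + (- l))" by simp
    also have "\<dots> = exp (- (2 * x)) * exp (- x) * (1 / (2 * real p))" unfolding exp_add el ..
    finally have "real p * (4 * exp (- (c * real n * \<rho>\<^sup>2 / 2)))
      \<le> real p * (4 * (exp (- (2 * x)) * exp (- x) * (1 / (2 * real p))))"
      by (intro mult_left_mono) auto
    also have "\<dots> = (4 * exp (- (2 * x))) * exp (- x) / 2" using p1 by simp
    also have "\<dots> \<le> 1 * exp (- x)" using e4 mult_right_mono[OF e4, of "exp (- x)"] by simp
    finally show ?thesis by simp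
  qed
  have big: "4 * l \<le> real n * \<nu>\<^sup>2 / (16 * Kt ^ 4)"
  proof -
    have "4 * l \<le> c * (real n * lam\<^sup>2)" using clam l0 by linarith
    also have "\<dots> \<le> ((1/1012)\<^sup>2 / Kt ^ 4) * (real n * lam\<^sup>2)" using c by (intro mult_right_mono) auto
    \<comment> \<open>Exact because 1012 = 4 * 253 and the 16 is 4 squared.\<close>
    also have "\<dots> = real n * \<nu>\<^sup>2 / (16 * Kt ^ 4)" unfolding \<nu> by (simp add: power_mult_distrib power_divide)
    finally show ?thesis .
  qed
  have big2: "4 * l \<le> real n * \<nu>\<^sup>2 / (4 * Kt\<^sup>2)"
  proof -
    have "4 * Kt\<^sup>2 \<le> 16 * Kt ^ 4" using Kt by (intro mult_mono power_increasing) auto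
    then have "real n * \<nu>\<^sup>2 / (16 * Kt ^ 4) \<le> real n * \<nu>\<^sup>2 / (4 * Kt\<^sup>2)"
      using Kt by (intro divide_left_mono) auto
    then show ?thesis using big by linarith
  qed
  have ex4: "exp (- y) \<le> (1 / (2 * real p)) ^ 4" if "4 * l \<le> y" for y
  proof -
    have "exp (- y) \<le> exp (of_nat 4 * (- l))" using that by simp
    also have "\<dots> = exp (- l) ^ 4" by (rule exp_of_nat_mult)
    finally show ?thesis by (simp add: el)
  qed
  have t4: "(real p)\<^sup>2 * (2 * exp (- (real n * \<nu>\<^sup>2 / (16 * Kt ^ 4)))) \<le> 1 / real p"
  proof -
    have "(real p)\<^sup>2 * (2 * exp (- (real n * \<nu>\<^sup>2 / (16 * Kt ^ 4)))) \<le> (real p)\<^sup>2 * (2 * (1 / (2 * real p)) ^ 4)"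
      by (intro mult_left_mono ex4[OF big]) auto
    also have "\<dots> = (1 / real p) * (1 / (8 * real p))"
      using p1 by (simp add: field_simps power4_eq_xxxx power2_eq_square)
    also have "\<dots> \<le> (1 / real p) * 1" using p1 by (intro mult_left_mono) auto
    finally show ?thesis by simp
  qed
  have t5: "real p * (2 * exp (- (real n * \<nu>\<^sup>2 / (4 * Kt\<^sup>2)))) \<le> 1 / real p"
  proof -
    have "real p * (2 * exp (- (real n * \<nu>\<^sup>2 / (4 * Kt\<^sup>2)))) \<le> (real p)\<^sup>2 * (2 * (1 / (2 * real p)) ^ 4)"
      using p1 by (intro mult_mono mult_left_mono ex4[OF big2]) (auto simp: power2_eq_square)
    also have "\<dots> = (1 / real p) * (1 / (8 * real p))"
      using p1 by (simp add: field_simps power4_eq_xxxx power2_eq_square)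
    also have "\<dots> \<le> (1 / real p) * 1" using p1 by (intro mult_left_mono) auto
    finally show ?thesis by simp
  qed
  have "exp (- real n * dT\<^sup>2 * mu\<^sup>2) = exp (- x)" by (simp add: x_def)
  then show ?thesis using t1 t2 t3 t4 t5 exp_ge_zero[of "- x"] by linarith
qed

theorem theorem2:
  fixes LX Lh KX Kg Jh A m :: real
  assumes "A > 0" and "m > 1/2" and "LX > 0" and "Lh \<ge> 0"
  shows "\<exists>\<delta>0 \<delta>T \<kappa>T. 0 < \<delta>0 \<and> \<delta>0 \<le> 1/253 \<and> \<delta>T > 0 \<and> \<kappa>T > 0 \<and>
    (\<forall>(n::nat) (p::nat) (d::nat) Q G J h \<beta>0 g0 lam mu R.
       prob_space Q \<and> sets Q = sets (Rvec p \<Otimes>\<^sub>M Rvec d) \<and>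
       L2_subspace (marg_z d Q) G \<and> semi_inner_on G J \<and>
       is_cond_exp_x_given_z p d Q h \<and>
       g0 \<in> G \<and>
       cond_C2 p Q KX \<and> cond_C3 p Q h LX Lh \<and> cond_C4 d (marg_z d Q) G J A m \<and>
       cond_C5 d (marg_z d Q) G J Kg \<and> cond_C6 p G J h Jh \<and>
       lam > 0 \<and> mu > 0 \<and> R > 0 \<and>
       \<kappa>T * real n powr (-(2*m)/(2*m+1)) \<le> mu\<^sup>2 \<and>
       mu\<^sup>2 \<le> \<delta>0 * R\<^sup>2 / (2 * (1 + Jnorm J g0 + Jh)\<^sup>2) \<and>
       R\<^sup>2 \<le> lam \<and> lam \<le> 1 \<and>
       4 * lam\<^sup>2 * real (card {j\<in>{..<p}. \<beta>0 j \<noteq> 0}) / LX\<^sup>2 \<le> \<delta>0 * R\<^sup>2 \<and>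
       lam \<ge> sqrt (2 * ln (2 * real p) / real n) / \<delta>T \<and>
       1 + Lh / LX \<le> 1 / mu
     \<longrightarrow>
       (\<exists>E\<in>sets (sample_space n Q).
          measure (sample_space n Q) E
            \<ge> 1 - 2 / real p - 6 * exp (- real n * \<delta>T\<^sup>2 * mu\<^sup>2) \<and>
          (\<forall>\<omega>\<in>E. \<forall>\<beta> g. is_minimizer n p G J \<beta>0 g0 lam mu \<omega> \<beta> g \<longrightarrow>
              emp_sq n (\<lambda>i. \<Sum>j<p. (Xs \<omega> i j - h (Zs \<omega> i) j) * (\<beta> j - \<beta>0 j))
              + lam / 4 * l1norm p (\<lambda>j. \<beta> j - \<beta>0 j)
              \<le> real (card {j\<in>{..<p}. \<beta>0 j \<noteq> 0}) * lam\<^sup>2 / LX\<^sup>2)))"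
proof -
  \<comment> \<open>Copies of the constants \<open>Kb\<close> and \<open>Kt\<close> of the model:
    the constants must be fixed before \<open>Q\<close>, \<open>G\<close> and \<open>h\<close>
    are.\<close>
  define kb where "kb = \<bar>Kg\<bar> + 1"
  define kt where "kt = \<bar>KX\<bar> + kb * (1 + \<bar>Jh\<bar> + \<bar>KX\<bar>)"
  define c where "c = (1/1012)\<^sup>2 * (1 - 2 powr (- (1 - 1 / (2 * m))))\<^sup>2 / (1296 * (4 * kb + kt) ^ 4)"
  \<comment> \<open>The 12 serves \<open>failure_probability\<close>; the \<open>2 * m\<close> gives
    \<open>2 * m \<le> c * (n * mu\<^sup>2)\<close> as soon as
    \<open>n * dT\<^sup>2 * mu\<^sup>2 \<ge> 1\<close>.\<close>
  define dT where "dT = sqrt (c / (12 + 2 * m))"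
  define \<kappa> where "\<kappa> = (4 * A / c) powr (2 * m / (2 * m + 1))"
  have m: "m > 1/2" by fact
  have kb1: "1 \<le> kb" by (simp add: kb_def)
  have "1 * 1 \<le> kb * (1 + \<bar>Jh\<bar> + \<bar>KX\<bar>)" using kb1 by (intro mult_mono) auto
  then have kt1: "1 \<le> kt" by (simp add: kt_def)
  have \<eta>: "0 < 1 - 2 powr (- (1 - 1 / (2 * m)))" "1 - 2 powr (- (1 - 1 / (2 * m))) < 1"
    using m powr_less_one[of 2 "- (1 - 1 / (2 * m))"] by (auto simp: field_simps)
  have c: "0 < c"
    unfolding c_def using \<eta> kb1 kt1 by (intro divide_pos_pos mult_pos_pos zero_less_power) linarith+
  have ckt: "c \<le> (1/1012)\<^sup>2 / kt ^ 4"
  proof -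
    have "kt ^ 4 \<le> (4 * kb + kt) ^ 4" using kb1 kt1 by (intro power_mono) auto
    moreover have "0 \<le> (4 * kb + kt) ^ 4" using kb1 kt1 by simp
    ultimately have k4: "kt ^ 4 \<le> 1296 * (4 * kb + kt) ^ 4" by linarith
    have "c \<le> (1/1012)\<^sup>2 * 1 / kt ^ 4"
      unfolding c_def using \<eta> kt1 k4
      by (intro frac_le mult_left_mono) (auto simp: power_le_one)
    then show ?thesis by simp
  qed
  have c1: "c \<le> 1"
  proof -
    have "(1/1012)\<^sup>2 / kt ^ 4 \<le> 1 / 1" using kt1 by (intro frac_le) (auto simp: power_divide)
    then show ?thesis using ckt by linarith
  qed
  have dT2: "dT\<^sup>2 = c / (12 + 2 * m)" using c m by (simp add: dT_def)
  have dT: "0 < dT" using c m by (simp add: dT_def)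
  have \<kappa>: "0 < \<kappa>" using c assms by (simp add: \<kappa>_def)
  have main: "\<exists>E\<in>sets (sample_space n Q).
          measure (sample_space n Q) E
            \<ge> 1 - 2 / real p - 6 * exp (- real n * dT\<^sup>2 * mu\<^sup>2) \<and>
          (\<forall>\<omega>\<in>E. \<forall>\<beta> g. is_minimizer n p G J \<beta>0 g0 lam mu \<omega> \<beta> g \<longrightarrow>
              emp_sq n (\<lambda>i. \<Sum>j<p. (Xs \<omega> i j - h (Zs \<omega> i) j) * (\<beta> j - \<beta>0 j))
              + lam / 4 * l1norm p (\<lambda>j. \<beta> j - \<beta>0 j)
              \<le> real (card {j\<in>{..<p}. \<beta>0 j \<noteq> 0}) * lam\<^sup>2 / LX\<^sup>2)"
    if Q: "prob_space Q" "sets Q = sets (Rvec p \<Otimes>\<^sub>M Rvec d)"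
      and G: "L2_subspace (marg_z d Q) G" and J: "semi_inner_on G J"
      and ce: "is_cond_exp_x_given_z p d Q h" and g0: "g0 \<in> G"
      and C2: "cond_C2 p Q KX" and C3: "cond_C3 p Q h LX Lh" and C4: "cond_C4 d (marg_z d Q) G J A m"
      and C5: "cond_C5 d (marg_z d Q) G J Kg" and C6: "cond_C6 p G J h Jh"
      and muk: "\<kappa> * real n powr (-(2*m)/(2*m+1)) \<le> mu\<^sup>2"
      and muR: "mu\<^sup>2 \<le> (1/253) * R\<^sup>2 / (2 * (1 + Jnorm J g0 + Jh)\<^sup>2)"
      and Rlam: "R\<^sup>2 \<le> lam" "lam \<le> 1"
      and sparse: "4 * lam\<^sup>2 * real (card {j\<in>{..<p}. \<beta>0 j \<noteq> 0}) / LX\<^sup>2 \<le> (1/253) * R\<^sup>2"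
      and lamT: "lam \<ge> sqrt (2 * ln (2 * real p) / real n) / dT"
      and muL: "1 + Lh / LX \<le> 1 / mu"
      and pos: "lam > 0" "mu > 0" "R > 0"
    for n p d :: nat and Q G J h \<beta>0 g0 lam mu R
  \<comment> \<open>If the claimed probability is not positive, the empty event works. Otherwise the
    exponent is at least 1, since \<open>exp 1 \<le> 3\<close>; this also rules out
    \<open>n = 0\<close>.\<close>
  proof (cases "6 * exp (- real n * dT\<^sup>2 * mu\<^sup>2) \<ge> 1")
    case True
    moreover have "0 \<le> 2 / real p" by simp
    ultimately have "1 - 2 / real p - 6 * exp (- real n * dT\<^sup>2 * mu\<^sup>2) \<le> 0" by linarith
    then show ?thesis by (intro bexI[of _ "{}"]) auto
  next
    case False
    let ?x = "real n * dT\<^sup>2 * mu\<^sup>2"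
    have x: "1 \<le> ?x"
    proof (rule ccontr)
      assume "\<not> 1 \<le> ?x"
      then have "exp ?x \<le> exp 1" by simp
      also have "\<dots> \<le> 3" by (rule exp_le)
      finally have "1 / 3 \<le> exp (- ?x)" by (simp add: exp_minus field_simps)
      then show False using False by simp
    qed
    then have n: "n > 0" by (cases n) auto
    interpret plm: partial_linear_model p d Q G J h KX Kg Jh
      by (intro partial_linear_model.intro Q G J ce C2 C5 C6)
    have Kb: "plm.Kb = kb" and Kt: "plm.Kt = kt"
      by (simp_all add: plm.Kb_def plm.Kt_def kb_def kt_def)
    \<comment> \<open>The condition linking \<open>mu\<close> to \<open>Lh / LX\<close> enters as
      \<open>mu \<le> 1\<close>, which places the class \<open>U\<close> inside the unit ball of
      (C4) and (C5).\<close>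
    have "0 \<le> Lh / LX" using assms by simp
    then have "1 \<le> 1 / mu" using muL by linarith
    then have mu1: "mu \<le> 1" using pos by (simp add: field_simps)
    have rate1: "A * mu powr (-1/m) \<le> c / 4 * (real n * mu\<^sup>2)"
      by (rule rate_from_kappa) (use assms c pos n muk in \<open>auto simp: \<kappa>_def\<close>)
    have rate2: "2 * m \<le> c * (real n * mu\<^sup>2)"
    proof -
      have "2 * m \<le> (12 + 2 * m) * ?x"
        using x m mult_mono[of "2 * m" "12 + 2 * m" 1 ?x] by simp
      also have "\<dots> = c * (real n * mu\<^sup>2)" using m unfolding dT2 by (simp add: field_simps)
      finally show ?thesis .
    qed
    interpret loc: localized_sample p d Q G J h KX Kg Jh n mu "1/1012" c A m
    proof (intro localized_sample.intro localized_sample_axioms.intro plm.partial_linear_model_axioms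
        n pos(2) mu1 assms(1) m C4 c rate1 rate2)
      show "c \<le> (1/1012)\<^sup>2 * (1 - 2 powr (- (1 - 1 / (2 * m))))\<^sup>2 / (1296 * (4 * plm.Kb + plm.Kt) ^ 4)"
        unfolding Kb Kt c_def ..
    qed simp_all
    \<comment> \<open>An eigenvector has a nonzero coordinate below \<open>p\<close>; the existing
      column then gives \<open>0 \<le> Jh\<close> as well.\<close>
    have p: "p > 0" using C3 by (auto simp: cond_C3_def is_min_eigenvalue_def is_eigenvalue_def)
    have Jh: "0 \<le> Jh"
      using plm.Jnorm_h[OF p] Jnorm_nonneg[OF G J plm.h_in_G[OF p]] by linarith
    have "mu\<^sup>2 \<le> R\<^sup>2"
    proof -
      have "1 \<le> 1 + Jnorm J g0 + Jh" using Jnorm_nonneg[OF G J g0] Jh by simp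
      then have "1 \<le> (1 + Jnorm J g0 + Jh)\<^sup>2" by simp
      then have "(1/253) * R\<^sup>2 / (2 * (1 + Jnorm J g0 + Jh)\<^sup>2) \<le> R\<^sup>2 / 1"
        by (intro frac_le) auto
      then show ?thesis using muR by simp
    qed
    then have muR': "mu \<le> R" by (rule power2_le_imp_le) (use pos in simp)
    \<comment> \<open>The level \<open>lam / R\<close> dominates \<open>mu\<close> through
      \<open>mu \<le> R\<close> and \<open>R\<^sup>2 \<le> lam\<close>, and dominates
      \<open>lam\<close> because \<open>R \<le> 1\<close>.\<close>
    have "R \<le> lam / R" using Rlam pos by (simp add: field_simps power2_eq_square)
    then have \<rho>: "mu \<le> lam / R" using muR' by linarith
    have "R \<le> 1"
    proof -
      have "R\<^sup>2 \<le> 1\<^sup>2" using Rlam by simp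
      then show ?thesis by (rule power2_le_imp_le) simp
    qed
    then have \<rho>2: "lam \<le> lam / R" using pos by (simp add: field_simps)
    have lam2: "2 * ln (2 * real p) \<le> real n * (dT\<^sup>2 * lam\<^sup>2)"
    proof -
      have l0: "0 \<le> 2 * ln (2 * real p) / real n" using p by simp
      have "sqrt (2 * ln (2 * real p) / real n) \<le> dT * lam"
        using lamT dT by (simp add: pos_divide_le_eq mult.commute)
      then have "(sqrt (2 * ln (2 * real p) / real n))\<^sup>2 \<le> (dT * lam)\<^sup>2"
        using l0 by (intro power_mono) auto
      then have "2 * ln (2 * real p) / real n \<le> dT\<^sup>2 * lam\<^sup>2" using l0 by (simp add: power_mult_distrib)
      then show ?thesis using n by (simp add: pos_divide_le_eq mult.commute)
    qed
    have \<nu>: "0 \<le> (1/253) * lam" using pos by simp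
    note fail = failure_probability[OF c c1 ckt _ kt1 dT2 n p x pos(2) mu1 \<rho> \<rho>2 pos(1) lam2 refl]
    obtain E where E: "E \<in> sets loc.M"
      and PE: "loc.M.prob (space loc.M - E) \<le> 2 / real p + 6 * exp (- real n * dT\<^sup>2 * mu\<^sup>2)"
      and ev: "\<And>\<omega>. \<omega> \<in> E \<Longrightarrow>
      (\<forall>j<p. \<forall>k<p. \<bar>(\<Sum>i<n. (Xs \<omega> i j - h (Zs \<omega> i) j) * (Xs \<omega> i k - h (Zs \<omega> i) k)) / real n
          - Sigma_xtilde Q h j k\<bar> \<le> (1/253) * lam) \<and>
      (\<forall>j<p. \<forall>u\<in>loc.U. \<bar>(\<Sum>i<n. (Xs \<omega> i j - h (Zs \<omega> i) j) * u (Zs \<omega> i)) / real n\<bar> \<le> (1/1012) * mu * (lam / R)) \<and>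
      (\<forall>u\<in>loc.U. \<bar>(\<Sum>i<n. (u (Zs \<omega> i))\<^sup>2) / real n - (L2norm (marg_z d Q) u)\<^sup>2\<bar> \<le> (1/1012) * mu\<^sup>2) \<and>
      (\<forall>j<p. \<bar>(\<Sum>i<n. Es \<omega> i * (Xs \<omega> i j - h (Zs \<omega> i) j)) / real n\<bar> \<le> (1/253) * lam) \<and>
      (\<forall>u\<in>loc.U. \<bar>(\<Sum>i<n. Es \<omega> i * u (Zs \<omega> i)) / real n\<bar> \<le> (1/1012) * mu\<^sup>2)"
      using loc.good_event[OF \<rho> \<nu>] order_trans[OF _ fail] m unfolding Kt by (auto simp del: times_divide_eq_left)
    show ?thesis
    proof (rule bexI[of _ E], intro conjI ballI allI impI)
      show "E \<in> sets (sample_space n Q)" using E by (simp add: sample_space_def)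
      show "1 - 2 / real p - 6 * exp (- real n * dT\<^sup>2 * mu\<^sup>2) \<le> measure (sample_space n Q) E"
        using PE loc.M.prob_compl[OF E] by (simp add: sample_space_def)
    next
      fix \<omega> \<beta> g assume \<omega>: "\<omega> \<in> E" and min: "is_minimizer n p G J \<beta>0 g0 lam mu \<omega> \<beta> g"
      note e = ev[OF \<omega>]
      interpret noise_controlled n p "marg_z d Q" G J h \<omega> \<beta>0 g0 lam mu R Jh LX "Sigma_xtilde Q h"
      proof unfold_locales
        show "LX\<^sup>2 * (\<Sum>j<p. (v j)\<^sup>2) \<le> qform p (Sigma_xtilde Q h) v" for v
          by (rule min_eigenvalue_le_qform) (use C3 in \<open>auto simp: cond_C3_def Sigma_xtilde_def mult.commute\<close>)
      qed (use n G J plm.h_in_G plm.Jnorm_h g0 pos assms Jh muR Rlam sparse e in \<open>simp_all add: loc.U_def\<close>)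
      show "emp_sq n (\<lambda>i. \<Sum>j<p. (Xs \<omega> i j - h (Zs \<omega> i) j) * (\<beta> j - \<beta>0 j))
              + lam / 4 * l1norm p (\<lambda>j. \<beta> j - \<beta>0 j)
              \<le> real (card {j\<in>{..<p}. \<beta>0 j \<noteq> 0}) * lam\<^sup>2 / LX\<^sup>2"
        by (rule oracle_inequality[OF min])
    qed
  qed
  show ?thesis
  proof (rule exI[of _ "1/253"], rule exI[of _ dT], rule exI[of _ \<kappa>], intro conjI dT \<kappa> allI impI)
  qed (simp, simp, elim conjE, rule main, assumption+)
qed

end
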